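(* (a) Let $f=(\mathsf{z},\mathsf{t})\in W^{1,2}_{loc}(\mathbb{R}^n,\mathbb{H}^m)$ be a weak solution on $\mathbb{R}^n$ of the system $$\int_{\mathbb{R}^n}\sum_{k=1}^m\Big(|\nabla\mathsf{z}^k|^2\frac{\partial\phi}{\partial x_\gamma}-2\sum_{\beta=1}^n\frac{\partial\mathsf{z}^k}{\partial x_\beta}\overline{\frac{\partial\mathsf{z}^k}{\partial x_\gamma}}\,\frac{\partial\phi}{\partial x_\beta}\Big)dx=0,\qquad \gamma=1,\dots,n,\ \phi\in C_0^\infty(\mathbb{R}^n,\mathbb{R}),$$ satisfying $$\lim_{r\to\infty}\frac{1}{r^{n-2}}\int_{B(0,r)}|\nabla\mathsf{z}|^2\,dx=0.$$ Then $|\nabla\mathsf{z}|\equiv0$ in $\mathbb{R}^n$. (b) If $f=(\mathsf{z},\mathsf{t})\in W^{1,2}(\mathbb{R}^n,\mathbb{H}^m)$ is a weak solution of the same system on $\mathbb{R}^n$, then $|\nabla\mathsf{z}|\equiv0$ in $\mathbb{R}^n$.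
   Context: The Heisenberg group $\mathbb{H}^m$ is $\mathbb{R}^{2m+1}$ with coordinates $(\mathsf{x},\mathsf{y},\mathsf{t})$, $\mathsf{x},\mathsf{y}\in\mathbb{R}^m$, $\mathsf{t}\in\mathbb{R}$, and product $(\mathsf{x},\mathsf{y},\mathsf{t})(\mathsf{x}',\mathsf{y}',\mathsf{t}')=(\mathsf{x}+\mathsf{x}',\mathsf{y}+\mathsf{y}',\mathsf{t}+\mathsf{t}'-2\mathsf{x}\cdot\mathsf{y}'+2\mathsf{y}\cdot\mathsf{x}')$, with the Korányi metric $d(p,q)=\|p^{-1}q\|$, $\|(\mathsf{x},\mathsf{y},\mathsf{t})\|=((|\mathsf{x}|^2+|\mathsf{y}|^2)^2+\mathsf{t}^2)^{1/4}$, and contact form $\theta=d\mathsf{t}+2\sum_i(\mathsf{x}_id\mathsf{y}_i-\mathsf{y}_id\mathsf{x}_i)$. A map to $\mathbb{H}^m$ is written $f=(\mathsf{z},\mathsf{t})$ with $\mathsf{z}=\mathsf{x}+i\mathsf{y}=(\mathsf{z}^1,\dots,\mathsf{z}^m)$, and $|\nabla\mathsf{z}|^2=\sum_k|\nabla\mathsf{z}^k|^2=\sum_k(|\nabla\mathsf{x}^k|^2+|\nabla\mathsf{y}^k|^2)$. $L^2(\Omega,\mathbb{H}^m)$ is the set of Borel maps $f:\Omega\to\mathbb{H}^m$ with $\int_\Omega d(f(p),P_0)^2dp<\infty$ for some $P_0\in\mathbb{H}^m$. The Korevaar--Schoen energy of $f\in L^2(\Omega,\mathbb{H}^m)$ is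 $$E^2(f,\Omega)=\sup\Big\{\limsup_{\epsilon\to0}\int_\Omega\varphi(p)e_{f,\epsilon}(p)\,dp:\varphi\in C_0(\Omega,[0,1])\Big\},\qquad e_{f,\epsilon}(p)=\int_{\partial B_\epsilon(p)}\Big(\frac{d(f(p),f(q))}{\epsilon}\Big)^2\frac{d\sigma_\epsilon(q)}{\epsilon^{n-1}},$$ with $d\sigma_\epsilon$ the surface measure on $\partial B_\epsilon(p)$. The Sobolev space $W^{1,2}(\Omega,\mathbb{H}^m)$ is the set of such $f$ with $E^2(f,\Omega)<\infty$; $f\in W^{1,2}_{loc}(\mathbb{R}^n,\mathbb{H}^m)$ means the restriction of $f$ to every bounded smooth domain of $\mathbb{R}^n$ lies in the corresponding $W^{1,2}$ space. It is known (Capogna--Lin) that on bounded smooth domains finite energy implies $\mathsf{z}\in W^{1,2}(\Omega,\mathbb{R}^{2m})$, $\mathsf{t}\in L^1$ is weakly differentiable, $f^*\theta=0$ a.e. (equivalently $\nabla\mathsf{t}=2(\mathsf{y}\cdot\nabla\mathsf{x}-\mathsf{x}\cdot\nabla\mathsf{y})$ a.e.), the isotropy condition $\sum_k\big(\frac{\partial\mathsf{x}^k}{\partial x_\alpha}\frac{\partial\mathsf{y}^k}{\partial x_\beta}-\frac{\partial\mathsf{x}^k}{\partial x_\beta}\frac{\partial\mathsf{y}^k}{\partial x_\alpha}\big)=0$ holds a.e. for all $\alpha<\beta$, and (with suitable normalization) $E^2(f,\Omega)=\int_\Omega|\nabla\mathsf{z}|^2dx$. The system in the claim is the Euler--Lagrange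 system of this energy for domain variations $\mathsf{z}_s(x)=\mathsf{z}(x+s\xi(x))$.
   Formalization: Part (b) is stated except for n = 2 with m ≥ 2, where it is false: a conformally parametrised Whitney sphere, lifted to a Legendrian map and composed with ζ ↦ ζ² on the plane, is a nonconstant weak solution in W^{1,2}(R^2, H^m). *)

theory Defs
  imports "HOL-Analysis.Analysis"
begin

section \<open>The Heisenberg group with the Koranyi metric\<close>

text \<open>Triples \<open>(x, y, t)\<close>. The Koranyi metric induces the Euclidean topology, so the Borel
  sets of this product type are those of the Heisenberg group. Do not confuse \<open>heis_dist\<close> with
  the Euclidean \<open>dist\<close> that the product type carries.\<close>

type_synonym 'm heis = "(real ^ 'm) \<times> (real ^ 'm) \<times> real"

definition heis_mult :: "'m::finite heis \<Rightarrow> 'm heis \<Rightarrow> 'm heis" where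
  "heis_mult = (\<lambda>(x, y, t) (x', y', t').
     (x + x', y + y', t + t' - 2 * (x \<bullet> y') + 2 * (y \<bullet> x')))"

definition heis_inv :: "'m::finite heis \<Rightarrow> 'm heis" where
  "heis_inv = (\<lambda>(x, y, t). (- x, - y, - t))"

definition heis_norm :: "'m::finite heis \<Rightarrow> real" where
  "heis_norm = (\<lambda>(x, y, t). root 4 (((norm x)\<^sup>2 + (norm y)\<^sup>2)\<^sup>2 + t\<^sup>2))"

definition heis_dist :: "'m::finite heis \<Rightarrow> 'm heis \<Rightarrow> real" where
  "heis_dist p q = heis_norm (heis_mult (heis_inv p) q)"

lemma heis_mult_inv: "heis_mult (heis_inv p) p = (0, 0, 0)"
  by (cases p) (simp add: heis_mult_def heis_inv_def inner_commute)

text \<open>For \<open>f = (z, t)\<close> with \<open>z = x + i y\<close>, the \<open>k\<close>-th complex component of \<open>z\<close>.\<close>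

definition zcomp :: "('a \<Rightarrow> 'm::finite heis) \<Rightarrow> 'm \<Rightarrow> 'a \<Rightarrow> complex" where
  "zcomp f k p = Complex (fst (f p) $ k) (fst (snd (f p)) $ k)"


section \<open>Smooth functions, test functions, smooth domains\<close>

definition pderivative :: "'n \<Rightarrow> (real ^ 'n::finite \<Rightarrow> real) \<Rightarrow> real ^ 'n \<Rightarrow> real" where
  "pderivative i u x = frechet_derivative u (at x) (axis i 1)"

fun Ck :: "nat \<Rightarrow> (real ^ 'n::finite \<Rightarrow> real) \<Rightarrow> bool" where
  "Ck 0 u \<longleftrightarrow> continuous_on UNIV u"
| "Ck (Suc k) u \<longleftrightarrow> (\<forall>x. u differentiable (at x)) \<and> (\<forall>i. Ck k (pderivative i u))"

definition smooth :: "(real ^ 'n::finite \<Rightarrow> real) \<Rightarrow> bool" where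
  "smooth u \<longleftrightarrow> (\<forall>k. Ck k u)"

definition test_function :: "(real ^ 'n::finite \<Rightarrow> real) \<Rightarrow> bool" where
  "test_function \<phi> \<longleftrightarrow> smooth \<phi> \<and> compact (closure {x. \<phi> x \<noteq> 0})"

text \<open>The boundary is described locally by a defining function with non-vanishing gradient.
  Taking the defining function smooth on the whole space is no restriction, since a local one
  can be multiplied by a cutoff.\<close>

definition bounded_smooth_domain :: "(real ^ 'n::finite) set \<Rightarrow> bool" where
  "bounded_smooth_domain \<Omega> \<longleftrightarrow>
     open \<Omega> \<and> connected \<Omega> \<and> \<Omega> \<noteq> {} \<and> bounded \<Omega> \<and>
     (\<forall>p\<in>frontier \<Omega>. \<exists>U \<rho>. open U \<and> p \<in> U \<and> smooth \<rho> \<and>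
        (\<exists>i. pderivative i \<rho> p \<noteq> 0) \<and> \<Omega> \<inter> U = {x\<in>U. \<rho> x < 0})"


section \<open>Korevaar--Schoen energy and Sobolev spaces\<close>

text \<open>Surface measure on the sphere of radius \<open>r\<close> about \<open>p\<close>, given by polar coordinates: the
  surface measure of a subset \<open>A\<close> of the unit sphere is \<open>n\<close> times the volume of the part of the
  unit ball lying over \<open>A\<close>, and radius \<open>r\<close> scales it by \<open>r ^ (n - 1)\<close>. For \<open>n = 1\<close> it is the
  counting measure on the two points \<open>p - r\<close> and \<open>p + r\<close>.\<close>

definition sphere_measure :: "real ^ 'n::finite \<Rightarrow> real \<Rightarrow> (real ^ 'n) measure" where
  "sphere_measure p r =
     scale_measure (ennreal (real CARD('n) * r ^ (CARD('n) - 1)))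
       (distr (restrict_space lborel (ball 0 1)) borel (\<lambda>x. p + r *\<^sub>R sgn x))"

text \<open>Only the values of \<open>f\<close> on \<open>\<Omega>\<close> enter. Discarding the part of the sphere outside \<open>\<Omega>\<close> does
  not affect the energy: for \<open>p\<close> in the support of the cutoff \<open>\<phi>\<close> below and small \<open>\<epsilon>\<close>, the
  sphere lies in \<open>\<Omega>\<close>.\<close>

definition ks_density ::
    "(real ^ 'n::finite) set \<Rightarrow> (real ^ 'n \<Rightarrow> 'm::finite heis) \<Rightarrow> real \<Rightarrow> real ^ 'n \<Rightarrow> ennreal" where
  "ks_density \<Omega> f \<epsilon> p =
     (\<integral>\<^sup>+q\<in>\<Omega>. ennreal ((heis_dist (f p) (f q) / \<epsilon>)\<^sup>2) \<partial>sphere_measure p \<epsilon>)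
       / ennreal (\<epsilon> ^ (CARD('n) - 1))"

text \<open>Continuous functions into \<open>[0, 1]\<close> with compact support in \<open>\<Omega>\<close>, extended by zero.\<close>

definition cutoffs :: "(real ^ 'n::finite) set \<Rightarrow> (real ^ 'n \<Rightarrow> real) set" where
  "cutoffs \<Omega> = {\<phi>. continuous_on UNIV \<phi> \<and> range \<phi> \<subseteq> {0..1} \<and>
     (\<exists>K. compact K \<and> K \<subseteq> \<Omega> \<and> (\<forall>x. x \<notin> K \<longrightarrow> \<phi> x = 0))}"

definition ks_energy :: "(real ^ 'n::finite) set \<Rightarrow> (real ^ 'n \<Rightarrow> 'm::finite heis) \<Rightarrow> ennreal" where
  "ks_energy \<Omega> f = (SUP \<phi>\<in>cutoffs \<Omega>.
     Limsup (at_right 0) (\<lambda>\<epsilon>. \<integral>\<^sup>+p\<in>\<Omega>. ennreal (\<phi> p) * ks_density \<Omega> f \<epsilon> p \<partial>lborel))"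

definition L2_heis :: "(real ^ 'n::finite) set \<Rightarrow> (real ^ 'n \<Rightarrow> 'm::finite heis) \<Rightarrow> bool" where
  "L2_heis \<Omega> f \<longleftrightarrow> f \<in> borel_measurable (restrict_space borel \<Omega>) \<and>
     (\<exists>P0. (\<integral>\<^sup>+p\<in>\<Omega>. ennreal ((heis_dist (f p) P0)\<^sup>2) \<partial>lborel) < \<infinity>)"

definition W12 :: "(real ^ 'n::finite) set \<Rightarrow> (real ^ 'n \<Rightarrow> 'm::finite heis) \<Rightarrow> bool" where
  "W12 \<Omega> f \<longleftrightarrow> L2_heis \<Omega> f \<and> ks_energy \<Omega> f < \<infinity>"

definition W12_loc :: "(real ^ 'n::finite \<Rightarrow> 'm::finite heis) \<Rightarrow> bool" where
  "W12_loc f \<longleftrightarrow> (\<forall>\<Omega>. bounded_smooth_domain \<Omega> \<longrightarrow> W12 \<Omega> f)"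


section \<open>Weak gradients and the domain-variation system\<close>

definition locally_integrable :: "(real ^ 'n::finite \<Rightarrow> complex) \<Rightarrow> bool" where
  "locally_integrable u \<longleftrightarrow> (\<forall>K. compact K \<longrightarrow> set_integrable lborel K u)"

definition weak_pderivative ::
    "'n \<Rightarrow> (real ^ 'n::finite \<Rightarrow> complex) \<Rightarrow> (real ^ 'n \<Rightarrow> complex) \<Rightarrow> bool" where
  "weak_pderivative i u g \<longleftrightarrow> locally_integrable u \<and> locally_integrable g \<and>
     (\<forall>\<phi>. test_function \<phi> \<longrightarrow>
        (\<integral>x. pderivative i \<phi> x *\<^sub>R u x \<partial>lborel) = - (\<integral>x. \<phi> x *\<^sub>R g x \<partial>lborel))"

text \<open>\<open>Dz k \<beta>\<close> is a representative of the weak derivative of the \<open>k\<close>-th complex component of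
  \<open>z\<close> in direction \<open>\<beta>\<close>; it is determined up to null sets. No square integrability is required
  here.\<close>

definition weak_gradient ::
    "(real ^ 'n::finite \<Rightarrow> 'm::finite heis) \<Rightarrow> ('m \<Rightarrow> 'n \<Rightarrow> real ^ 'n \<Rightarrow> complex) \<Rightarrow> bool" where
  "weak_gradient f Dz \<longleftrightarrow> (\<forall>k \<beta>. weak_pderivative \<beta> (zcomp f k) (Dz k \<beta>))"

definition comp_grad_sq ::
    "('m::finite \<Rightarrow> 'n::finite \<Rightarrow> real ^ 'n \<Rightarrow> complex) \<Rightarrow> 'm \<Rightarrow> real ^ 'n \<Rightarrow> real" where
  "comp_grad_sq Dz k x = (\<Sum>\<beta>\<in>UNIV. (cmod (Dz k \<beta> x))\<^sup>2)"

definition grad_norm ::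
    "('m::finite \<Rightarrow> 'n::finite \<Rightarrow> real ^ 'n \<Rightarrow> complex) \<Rightarrow> real ^ 'n \<Rightarrow> real" where
  "grad_norm Dz x = sqrt (\<Sum>k\<in>UNIV. comp_grad_sq Dz k x)"

definition weak_solution :: "('m::finite \<Rightarrow> 'n::finite \<Rightarrow> real ^ 'n \<Rightarrow> complex) \<Rightarrow> bool" where
  "weak_solution Dz \<longleftrightarrow> (\<forall>\<gamma> \<phi>. test_function \<phi> \<longrightarrow>
     (\<integral>x. (\<Sum>k\<in>UNIV. of_real (comp_grad_sq Dz k x) * of_real (pderivative \<gamma> \<phi> x)
            - 2 * (\<Sum>\<beta>\<in>UNIV. Dz k \<beta> x * cnj (Dz k \<gamma> x) * of_real (pderivative \<beta> \<phi> x)))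
        \<partial>lborel) = 0)"

end

theory Submission
  imports Defs
begin

text \<open>Write \<open>e = |\<nabla>z|\<^sup>2\<close>. Testing the system with the radial fields \<open>\<phi>\<^sub>\<gamma> = x\<^sub>\<gamma> h(|x|\<^sup>2)\<close> and summing over
  \<open>\<gamma>\<close> gives the Pohozaev identity
  \<open>\<integral> e ((n - 2) h + 2 |x|\<^sup>2 h') = 4 \<integral> h' \<Sum>\<^sub>k |x \<bullet> \<nabla>z\<^sup>k|\<^sup>2\<close>.
  If \<open>e\<close> is integrable and \<open>n \<noteq> 2\<close>, take \<open>h\<close> a cutoff at radius \<open>R\<close> and let \<open>R \<rightarrow> \<infinity>\<close>. Under the
  growth condition with \<open>n > 2\<close>, take \<open>h(s) = (1 + s) powr (- (n - 2) / 2)\<close>, cut off at \<open>R\<close>; for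
  \<open>n \<le> 2\<close> the condition already forces \<open>e = 0\<close>. If \<open>n = 2\<close>, \<open>m = 1\<close> and \<open>e\<close> is integrable, the real
  part of the system says that the Hopf differential of \<open>z\<close> is holomorphic, hence \<open>0\<close> because it is
  integrable, and the imaginary part that \<open>Im (\<partial>\<^sub>1z cnj \<partial>\<^sub>2z)\<close> is constant, hence \<open>0\<close>.

  That finite Korevaar--Schoen energy makes \<open>e\<close> integrable follows from
  \<open>heis_dist \<ge> |z(p) - z(q)|\<close> and Fatou's lemma: for almost every direction the difference quotients
  of \<open>z\<close> are bounded in \<open>L\<^sup>2\<close> along a sequence, so the derivative in that direction is in \<open>L\<^sup>2\<close>, and
  the set of such directions is a linear subspace.\<close>

section \<open>Calculus of smooth functions\<close>

text \<open>The system is stated with the Bochner integral, which is 0 on integrands that are not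
  integrable. It therefore carries information only once e is locally integrable, and
  \<open>weak_gradient\<close> alone does not provide that. Under the growth condition the limit of
  extended real quotients forces finite energy on balls; in (b) the Korevaar--Schoen argument
  supplies integrability on the whole space.

  The power profile h is a smooth substitute for the classical monotonicity in r of r^(2-n) times
  the energy of the ball of radius r, which comes from indicator profiles. With |x|^2 in place of 1
  + |x|^2 the terms (n - 2) h and 2 |x|^2 h' would cancel exactly; the added 1 removes the
  singularity at the origin and leaves a positive remainder.

  For n = 2 the factor n - 2 vanishes, radial cutoffs give only 0 = 0 in the limit, and all test
  functions have to be used. With one component these force both derivatives to vanish.\<close>

lemma pderivative_eqI:
  assumes "(u has_derivative D) (at x)"
  shows "pderivative i u x = D (axis i 1)"
  using frechet_derivative_at[OF assms] by (simp add: pderivative_def)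

lemma has_derivative_pderivative:
  fixes u :: "real ^ 'n::finite \<Rightarrow> real"
  assumes "u differentiable (at x)"
  shows "(u has_derivative (\<lambda>v. \<Sum>i\<in>UNIV. v $ i * pderivative i u x)) (at x)"
proof -
  let ?D = "frechet_derivative u (at x)"
  have D: "(u has_derivative ?D) (at x)"
    using assms frechet_derivative_works by blast
  then interpret linear ?D by (rule has_derivative_linear)
  have "?D v = (\<Sum>i\<in>UNIV. v $ i * pderivative i u x)" for v
  proof -
    have "v = (\<Sum>i\<in>UNIV. v $ i *\<^sub>R axis i 1)"
      by (simp add: vec_eq_iff axis_def if_distrib cong: if_cong)
    then have "?D v = ?D (\<Sum>i\<in>UNIV. v $ i *\<^sub>R axis i 1)" by (rule arg_cong)
    also have "\<dots> = (\<Sum>i\<in>UNIV. v $ i * pderivative i u x)"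
      by (simp add: sum scaleR pderivative_def)
    finally show ?thesis .
  qed
  then have "?D = (\<lambda>v. \<Sum>i\<in>UNIV. v $ i * pderivative i u x)" by auto
  then show ?thesis using D by simp
qed

lemma pderivative_add:
  assumes "u differentiable (at x)" "v differentiable (at x)"
  shows "pderivative i (\<lambda>x. u x + v x) x = pderivative i u x + pderivative i v x"
proof -
  have "((\<lambda>x. u x + v x) has_derivative
      (\<lambda>h. frechet_derivative u (at x) h + frechet_derivative v (at x) h)) (at x)"
    using assms by (intro has_derivative_add) (auto simp: frechet_derivative_works[symmetric])
  from pderivative_eqI[OF this] show ?thesis by (simp add: pderivative_def)
qed

lemma pderivative_mult:
  assumes "u differentiable (at x)" "v differentiable (at x)"
  shows "pderivative i (\<lambda>x. u x * v x) x = pderivative i u x * v x + u x * pderivative i v x"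
proof -
  have "((\<lambda>x. u x * v x) has_derivative
      (\<lambda>h. u x * frechet_derivative v (at x) h + frechet_derivative u (at x) h * v x)) (at x)"
    using assms by (intro has_derivative_mult) (auto simp: frechet_derivative_works[symmetric])
  from pderivative_eqI[OF this] show ?thesis by (simp add: pderivative_def)
qed

lemma pderivative_compose:
  assumes "u differentiable (at x)" "(h has_real_derivative d) (at (u x))"
  shows "pderivative i (\<lambda>x. h (u x)) x = d * pderivative i u x"
    and "(\<lambda>x. h (u x)) differentiable (at x)"
proof -
  have *: "((\<lambda>x. h (u x)) has_derivative (\<lambda>v. d * frechet_derivative u (at x) v)) (at x)"
    using has_derivative_compose[of u "frechet_derivative u (at x)" x UNIV h "(*) d"] assms
    by (auto simp: frechet_derivative_works[symmetric] has_field_derivative_def)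
  then show "(\<lambda>x. h (u x)) differentiable (at x)" by (auto simp: differentiable_def)
  from pderivative_eqI[OF *] show "pderivative i (\<lambda>x. h (u x)) x = d * pderivative i u x"
    by (simp add: pderivative_def)
qed

lemma pderivative_const: "pderivative i (\<lambda>x. c) = (\<lambda>x. 0)"
  by (rule ext) (auto intro!: pderivative_eqI[THEN trans] has_derivative_const)

lemma pderivative_nth: "pderivative i (\<lambda>x. x $ j) = (\<lambda>x. if i = j then 1 else 0)"
  by (rule ext, rule pderivative_eqI[THEN trans], rule bounded_linear_imp_has_derivative)
    (auto simp: axis_def bounded_linear_vec_nth)

lemma Ck_Suc_imp_Ck: "Ck (Suc k) u \<Longrightarrow> Ck k u"
proof (induction k arbitrary: u)
  case 0
  then show ?case
    by (auto simp: continuous_on_eq_continuous_at differentiable_imp_continuous_within)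
next
  case (Suc k)
  then show ?case by (metis Ck.simps(2))
qed

lemma Ck_add: "Ck k u \<Longrightarrow> Ck k v \<Longrightarrow> Ck k (\<lambda>x. u x + v x)"
proof (induction k arbitrary: u v)
  case (Suc k)
  then have "pderivative i (\<lambda>x. u x + v x) = (\<lambda>x. pderivative i u x + pderivative i v x)" for i
    by (auto intro!: pderivative_add)
  then show ?case using Suc by auto
qed (simp add: continuous_on_add)

lemma Ck_mult: "Ck k u \<Longrightarrow> Ck k v \<Longrightarrow> Ck k (\<lambda>x. u x * v x)"
proof (induction k arbitrary: u v)
  case (Suc k)
  then have *: "pderivative i (\<lambda>x. u x * v x)
      = (\<lambda>x. pderivative i u x * v x + u x * pderivative i v x)" for i
    by (auto intro!: pderivative_mult)
  have "Ck k u" "Ck k v" using Suc.prems by (auto intro: Ck_Suc_imp_Ck)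
  then show ?case using Suc unfolding Ck.simps * by (auto intro!: Ck_add)
qed (simp add: continuous_on_mult)

lemma Ck_const: "Ck k (\<lambda>x. c)"
  by (induction k arbitrary: c) (auto simp: pderivative_const)

lemma Ck_nth: "Ck k (\<lambda>x. x $ j)"
  by (cases k) (auto simp: pderivative_nth Ck_const 
      intro!: linear_continuous_on bounded_linear_imp_differentiable bounded_linear_vec_nth)

lemma smooth_const [simp]: "smooth (\<lambda>x. c)"
  by (simp add: smooth_def Ck_const)

lemma smooth_nth [simp]: "smooth (\<lambda>x. x $ j)"
  by (simp add: smooth_def Ck_nth)

lemma smooth_add: "smooth u \<Longrightarrow> smooth v \<Longrightarrow> smooth (\<lambda>x. u x + v x)"
  by (simp add: smooth_def Ck_add)

lemma smooth_mult: "smooth u \<Longrightarrow> smooth v \<Longrightarrow> smooth (\<lambda>x. u x * v x)"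
  by (simp add: smooth_def Ck_mult)

lemma smooth_sum: "(\<And>i. i \<in> I \<Longrightarrow> smooth (u i)) \<Longrightarrow> smooth (\<lambda>x. \<Sum>i\<in>I. u i x)"
  by (induction I rule: infinite_finite_induct) (auto intro: smooth_add)

lemma smooth_differentiable: "smooth u \<Longrightarrow> u differentiable (at x)"
  by (metis Ck.simps(2) smooth_def)

lemma smooth_pderivative: "smooth u \<Longrightarrow> smooth (pderivative i u)"
  by (metis Ck.simps(2) smooth_def)

lemma smooth_continuous: "smooth u \<Longrightarrow> continuous_on UNIV u"
  by (metis Ck.simps(1) smooth_def)

text \<open>The outer function is given as the sequence of its successive derivatives.
  Differentiating the composite raises the index and multiplies by a derivative of \<open>u\<close>,
  so induction on the order closes as long as \<open>j\<close> stays arbitrary. The set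
  \<open>S\<close> admits functions that are smooth only on a half-line, such as real
  powers.\<close>

lemma smooth_compose:
  assumes h: "\<And>k s. s \<in> S \<Longrightarrow> (h k has_real_derivative h (Suc k) s) (at s)"
    and u: "smooth u" "range u \<subseteq> S"
  shows "smooth (\<lambda>x. h j (u x))"
proof -
  have "Ck k (\<lambda>x. h j (u x))" for k j
  proof (induction k arbitrary: j)
    case 0
    have "isCont (\<lambda>x. h j (u x)) x" for x
      using pderivative_compose(2)[OF smooth_differentiable[OF u(1)] h] u(2)
      by (meson differentiable_imp_continuous_within range_subsetD)
    then show ?case by (simp add: continuous_on_eq_continuous_at)
  next
    case (Suc k)
    have "pderivative i (\<lambda>x. h j (u x)) = (\<lambda>x. h (Suc j) (u x) * pderivative i u x)" for i
      using pderivative_compose(1)[OF smooth_differentiable[OF u(1)] h] u(2)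
      by (intro ext) (meson range_subsetD)
    moreover have "(\<lambda>x. h j (u x)) differentiable (at x)" for x
      using pderivative_compose(2)[OF smooth_differentiable[OF u(1)] h] u(2)
      by (meson range_subsetD)
    ultimately show ?case
      using Suc smooth_pderivative[OF u(1)] by (auto intro!: Ck_mult simp: smooth_def)
  qed
  then show ?thesis by (simp add: smooth_def)
qed

lemma smooth_powr:
  assumes "smooth u" "\<And>x. u x > 0"
  shows "smooth (\<lambda>x. u x powr e)"
proof -
  let ?h = "\<lambda>k s. (\<Prod>i<k. e - real i) * s powr (e - real k)"
  have "(?h k has_real_derivative ?h (Suc k) s) (at s)" if "s \<in> {0<..}" for k s
  proof -
    have "((\<lambda>s. s powr (e - real k)) has_real_derivative
        (e - real k) * s powr (e - real (Suc k))) (at s)"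
      using has_real_derivative_powr[of s "e - real k"] that by (simp add: algebra_simps)
    from DERIV_cmult[OF this, of "\<Prod>i<k. e - real i"] show ?thesis by (simp add: mult.assoc)
  qed
  from smooth_compose[where h = ?h and j = 0, OF this assms(1)] assms(2) show ?thesis by auto
qed

text \<open>Lets the polynomials of the Stone--Weierstrass theorem serve as test functions after
  multiplication by a cutoff.\<close>

lemma smooth_polynomial: "real_polynomial_function p \<Longrightarrow> smooth p"
proof (induction p rule: real_polynomial_function.induct)
  case (linear f)
  then interpret bounded_linear f .
  have "f x = (\<Sum>i\<in>UNIV. f (axis i 1) * x $ i)" for x
  proof -
    have "x = (\<Sum>i\<in>UNIV. x $ i *\<^sub>R axis i 1)"
      by (simp add: vec_eq_iff axis_def if_distrib cong: if_cong)
    from arg_cong[OF this, of f] show ?thesis by (simp only: sum scaleR real_scaleR_def mult.commute)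
  qed
  then have "(\<lambda>x. \<Sum>i\<in>UNIV. f (axis i 1) * x $ i) = f" by (intro ext) (rule sym)
  moreover have "smooth (\<lambda>x. \<Sum>i\<in>UNIV. f (axis i 1) * x $ i)"
    by (intro smooth_sum smooth_mult smooth_const smooth_nth)
  ultimately show ?case by simp
qed (auto intro: smooth_add smooth_mult)

section \<open>Radial functions\<close>

lemma norm_sq_eq_sum: "(norm (x - a))\<^sup>2 = (\<Sum>i\<in>UNIV. (x $ i - a $ i) * (x $ i - a $ i))"
  for x a :: "real ^ 'n::finite"
  by (simp add: power2_norm_eq_inner inner_vec_def)

lemma smooth_norm_sq: "smooth (\<lambda>x. (norm (x - a))\<^sup>2)" for a :: "real ^ 'n::finite"
proof -
  have "smooth (\<lambda>x. x $ i - a $ i)" for i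
    using smooth_add[OF smooth_nth[of i] smooth_const[of "- a $ i"]] by simp
  then show ?thesis
    unfolding norm_sq_eq_sum by (intro smooth_sum smooth_mult)
qed

lemma pderivative_norm_sq:
  fixes a :: "real ^ 'n::finite"
  shows "pderivative i (\<lambda>x. (norm (x - a))\<^sup>2) x = 2 * (x $ i - a $ i)"
proof -
  have "((\<lambda>x. (norm (x - a))\<^sup>2) has_derivative (\<lambda>v. 2 * ((x - a) \<bullet> v))) (at x)"
  proof -
    have "((\<lambda>x. x - a) has_derivative (\<lambda>v. v)) (at x)"
      by (auto intro!: derivative_eq_intros)
    from has_derivative_inner[OF this this] show ?thesis
      by (simp add: power2_norm_eq_inner inner_commute)
  qed
  from pderivative_eqI[OF this] show ?thesis by (simp add: inner_axis)
qed

lemma pderivative_radial: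
  fixes x :: "real ^ 'n::finite"
  assumes "(h has_real_derivative d) (at ((norm x)\<^sup>2))"
  shows "pderivative i (\<lambda>x. h ((norm x)\<^sup>2)) x = d * (2 * x $ i)"
proof -
  have "(\<lambda>x :: real ^ 'n. (norm x)\<^sup>2) differentiable (at x)"
    using smooth_differentiable[OF smooth_norm_sq[of 0]] by simp
  from pderivative_compose(1)[OF this assms] show ?thesis
    using pderivative_norm_sq[of i 0 x] by simp
qed

section \<open>A smooth cutoff\<close>

text \<open>The polynomial is carried along because functions of this form are closed under
  differentiation: with t = 1/x, the derivative of p(t) exp(-t) in x is t^2 (p - p')(t) exp(-t). All
  derivatives of exp(-1/x) are thus treated at once.\<close>

definition flat_fn :: "real poly \<Rightarrow> real \<Rightarrow> real" where
  "flat_fn p x = (if x > 0 then poly p (inverse x) * exp (- inverse x) else 0)"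

lemma tendsto_poly_exp: "((\<lambda>t. poly p t * exp (- t)) \<longlongrightarrow> 0) at_top" for p :: "real poly"
proof -
  have "((\<lambda>t. \<Sum>i\<le>degree p. coeff p i * (t ^ i / exp t)) \<longlongrightarrow> (\<Sum>i\<le>degree p. coeff p i * 0)) at_top"
    by (intro tendsto_intros tendsto_power_div_exp_0)
  then show ?thesis
    by (simp add: poly_altdef exp_minus sum_distrib_right divide_inverse mult.assoc)
qed

lemma flat_fn_deriv:
  "(flat_fn p has_real_derivative flat_fn ([:0, 0, 1:] * (p - pderiv p)) x) (at x)"
proof -
  consider "x > 0" | "x < 0" | "x = 0" by linarith
  then show ?thesis
  proof cases
    case 1
    have "((\<lambda>x. poly p (inverse x) * exp (- inverse x)) has_real_derivative
        flat_fn ([:0, 0, 1:] * (p - pderiv p)) x) (at x)"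
      using 1 by (auto intro!: derivative_eq_intros poly_DERIV[THEN DERIV_chain2]
          simp: flat_fn_def field_simps power2_eq_square)
    from has_field_derivative_transform_within_open[OF this open_greaterThan[of 0], of "flat_fn p"]
    show ?thesis using 1 by (auto simp: flat_fn_def)
  next
    case 2
    have "((\<lambda>x. 0) has_real_derivative flat_fn ([:0, 0, 1:] * (p - pderiv p)) x) (at x)"
      using 2 by (auto simp: flat_fn_def)
    from has_field_derivative_transform_within_open[OF this open_lessThan[of 0], of "flat_fn p"]
    show ?thesis using 2 by (auto simp: flat_fn_def)
  next
    case 3
    \<comment> \<open>Dividing by y multiplies the polynomial by t = 1/y, so the difference quotient
      at 0 is again a polynomial in t times exp(-t), which vanishes as t tends to infinity.\<close>
    have "((\<lambda>y. poly ([:0, 1:] * p) (inverse y) * exp (- inverse y)) \<longlongrightarrow> 0) (at_right 0)"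
      using tendsto_poly_exp filterlim_inverse_at_top_right
      by (rule filterlim_compose)
    then have r: "((\<lambda>y. flat_fn p y / y) \<longlongrightarrow> 0) (at_right 0)"
      by (rule Lim_transform_eventually)
        (auto simp: eventually_at_right_less flat_fn_def divide_inverse mult_ac
            intro!: eventually_mono[OF eventually_at_right_less[of 0]])
    have l: "((\<lambda>y. flat_fn p y / y) \<longlongrightarrow> 0) (at_left 0)"
      by (rule Lim_transform_eventually[OF tendsto_const])
        (auto simp: flat_fn_def eventually_at_filter)
    have "((\<lambda>y. flat_fn p y / y) \<longlongrightarrow> 0) (at 0)"
      using r l by (simp add: filterlim_split_at)
    then show ?thesis
      using 3 by (simp add: has_field_derivative_iff flat_fn_def)
  qed
qed

lemma smooth_flat_fn:
  assumes "smooth u"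
  shows "smooth (\<lambda>x. flat_fn p (u x))"
proof -
  let ?h = "\<lambda>k. flat_fn (((\<lambda>p. [:0, 0, 1:] * (p - pderiv p)) ^^ k) p)"
  have "(?h k has_real_derivative ?h (Suc k) s) (at s)" for k s
    using flat_fn_deriv[of "((\<lambda>p. [:0, 0, 1:] * (p - pderiv p)) ^^ k) p" s] by simp
  from smooth_compose[where h = ?h and S = UNIV and j = 0, OF this assms] show ?thesis by simp
qed

definition bump :: "real \<Rightarrow> real" where
  "bump = flat_fn 1"

text \<open>The derivative formula for \<open>flat_fn\<close> at the constant polynomial 1, whose
  own derivative is 0: only the factor t^2 remains.\<close>

definition bump' :: "real \<Rightarrow> real" where
  "bump' = flat_fn [:0, 0, 1:]"

lemma bump_deriv: "(bump has_real_derivative bump' x) (at x)"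
  using flat_fn_deriv[of 1 x] by (simp add: bump_def bump'_def)

lemma bump_pos: "x > 0 \<Longrightarrow> bump x > 0"
  and bump_zero: "x \<le> 0 \<Longrightarrow> bump x = 0"
  and bump_nonneg: "bump x \<ge> 0"
  by (auto simp: bump_def flat_fn_def)

lemma bump'_zero: "x \<le> 0 \<Longrightarrow> bump' x = 0"
  and bump'_nonneg: "bump' x \<ge> 0"
  by (auto simp: bump'_def flat_fn_def)

lemma bump'_le: "bump' x \<le> 2"
proof (cases "x > 0")
  case True
  define t where "t = inverse x"
  have t: "t > 0" using True by (simp add: t_def)
  have "t * t \<le> 2 * exp t"
    using exp_lower_Taylor_quadratic[of t] t by (simp add: power2_eq_square)
  then have "t * t * exp (- t) \<le> 2"
    by (simp add: exp_minus divide_inverse[symmetric] divide_le_eq)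
  then show ?thesis
    using True by (simp add: bump'_def flat_fn_def t_def[symmetric])
qed (simp add: bump'_zero)

lemma bump_mono: "x \<le> y \<Longrightarrow> bump x \<le> bump y"
  by (rule DERIV_nonneg_imp_nondecreasing) (auto intro: bump_deriv bump'_nonneg)

text \<open>The constant \<open>bump 3\<close> is the value of \<open>bump (s - 1)\<close> at \<open>s = 4\<close>, where \<open>cutoff\<close> is to vanish.\<close>

definition cutoff :: "real \<Rightarrow> real" where
  "cutoff s = bump (bump 3 - bump (s - 1)) / bump (bump 3)"

definition cutoff' :: "real \<Rightarrow> real" where
  "cutoff' s = - bump' (bump 3 - bump (s - 1)) * bump' (s - 1) / bump (bump 3)"

text \<open>The 4 is 2 * 2, one factor from \<open>bump'_le\<close> for each of the two nested
  bumps. The constant is explicit because it reappears in later estimates that must be uniform in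
  the radius.\<close>

definition cutoff_bound :: real where
  "cutoff_bound = 4 / bump (bump 3)"

lemma bump3: "bump (bump 3) > 0"
  by (simp add: bump_pos)

lemma cutoff_deriv: "(cutoff has_real_derivative cutoff' s) (at s)"
proof -
  have "((\<lambda>s. bump (bump 3 - bump (s - 1)) / bump (bump 3)) has_real_derivative cutoff' s) (at s)"
    using bump3 by (auto intro!: derivative_eq_intros bump_deriv[THEN DERIV_chain2] simp: cutoff'_def)
  then show ?thesis unfolding cutoff_def[abs_def] .
qed

lemma cutoff_one: "s \<le> 1 \<Longrightarrow> cutoff s = 1"
  using bump3 by (simp add: cutoff_def bump_zero)

lemma cutoff_zero: "s \<ge> 4 \<Longrightarrow> cutoff s = 0"
  using bump_mono[of 3 "s - 1"] by (simp add: cutoff_def bump_zero)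

lemma cutoff'_zero: "s \<le> 1 \<or> s \<ge> 4 \<Longrightarrow> cutoff' s = 0"
  using bump_mono[of 3 "s - 1"] by (auto simp: cutoff'_def bump'_zero)

lemma cutoff_nonneg: "cutoff s \<ge> 0"
  using bump3 by (simp add: cutoff_def bump_nonneg)

lemma cutoff_le: "cutoff s \<le> 1"
  using bump3 bump_mono[of "bump 3 - bump (s - 1)" "bump 3"] bump_nonneg[of "s - 1"]
  by (simp add: cutoff_def)

lemma cutoff'_nonpos: "cutoff' s \<le> 0"
  using bump3 by (simp add: cutoff'_def bump'_nonneg divide_nonpos_pos)

lemma cutoff_bound_pos: "cutoff_bound > 0"
  using bump3 by (simp add: cutoff_bound_def)

lemma cutoff'_ge: "- cutoff_bound \<le> cutoff' s"
proof -
  have "bump' (bump 3 - bump (s - 1)) * bump' (s - 1) \<le> 2 * 2"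
    by (intro mult_mono bump'_le bump'_nonneg) auto
  then show ?thesis using bump3 by (simp add: cutoff'_def cutoff_bound_def divide_right_mono)
qed

lemma smooth_cutoff: "smooth u \<Longrightarrow> smooth (\<lambda>x. cutoff (u x))"
proof -
  assume u: "smooth u"
  have eq: "(\<lambda>x. cutoff (u x)) = (\<lambda>x. inverse (bump (bump 3)) *
      flat_fn 1 (bump 3 + (-1) * flat_fn 1 (u x + (-1))))"
    by (auto simp: cutoff_def bump_def field_simps)
  show ?thesis unfolding eq
    by (intro smooth_mult smooth_flat_fn smooth_add smooth_const u)
qed

text \<open>The thresholds 1 and 4 of \<open>cutoff\<close> become the radii R and 2 * R. Using the
  square of the norm keeps the function smooth at the origin.\<close>

definition ballcut :: "real \<Rightarrow> real ^ 'n::finite \<Rightarrow> real" where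
  "ballcut R x = cutoff ((norm x)\<^sup>2 / R\<^sup>2)"

lemma smooth_ballcut: "smooth (ballcut R :: real ^ 'n::finite \<Rightarrow> real)"
proof -
  have "ballcut R = (\<lambda>x :: real ^ 'n. cutoff (inverse (R\<^sup>2) * (norm (x - 0))\<^sup>2))"
    by (auto simp: ballcut_def divide_inverse mult.commute)
  moreover have "smooth (\<lambda>x :: real ^ 'n. cutoff (inverse (R\<^sup>2) * (norm (x - 0))\<^sup>2))"
    by (intro smooth_cutoff smooth_mult smooth_const smooth_norm_sq)
  ultimately show ?thesis by (simp only:)
qed

lemma ballcut_one: "R > 0 \<Longrightarrow> norm x \<le> R \<Longrightarrow> ballcut R x = 1"
  unfolding ballcut_def by (rule cutoff_one) (simp add: divide_le_eq power_mono)

lemma ballcut_zero: "R > 0 \<Longrightarrow> norm x \<ge> 2 * R \<Longrightarrow> ballcut R x = 0"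
  unfolding ballcut_def
  by (rule cutoff_zero) (use power_mono[of "2 * R" "norm x" 2] in \<open>simp add: le_divide_eq\<close>)

lemma ballcut_nonneg: "ballcut R x \<ge> 0" and ballcut_le: "ballcut R x \<le> 1"
  by (auto simp: ballcut_def cutoff_nonneg cutoff_le)

lemma pderivative_ballcut:
  "pderivative i (ballcut R) x = cutoff' ((norm x)\<^sup>2 / R\<^sup>2) * (2 * x $ i / R\<^sup>2)"
proof -
  have "((\<lambda>s. cutoff (s / R\<^sup>2)) has_real_derivative cutoff' ((norm x)\<^sup>2 / R\<^sup>2) * (1 / R\<^sup>2)) (at ((norm x)\<^sup>2))"
    by (intro DERIV_chain2[OF cutoff_deriv] DERIV_cdivide DERIV_ident)
  from pderivative_radial[OF this] show ?thesis
    by (simp add: ballcut_def[abs_def])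
qed

lemma test_functionI:
  assumes "smooth u" "\<And>x. norm x \<ge> R \<Longrightarrow> u x = 0"
  shows "test_function u"
proof -
  have "{x. u x \<noteq> 0} \<subseteq> cball 0 R" using assms(2) by force
  then have "bounded {x. u x \<noteq> 0}" using bounded_cball bounded_subset by blast
  then show ?thesis using assms(1) by (simp add: test_function_def compact_closure)
qed

lemma test_function_ballcut_mult:
  assumes "smooth u" "R > 0"
  shows "test_function (\<lambda>x. ballcut R x * u x)"
  using assms by (intro test_functionI[where R = "2 * R"]) (auto intro: smooth_mult smooth_ballcut simp: ballcut_zero)

lemma test_function_bounded_support:
  assumes "test_function u"
  obtains R where "R > 0" "\<And>x. norm x \<ge> R \<Longrightarrow> u x = 0"
    "\<And>i x. norm x \<ge> R \<Longrightarrow> pderivative i u x = 0"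
proof -
  let ?K = "closure {x. u x \<noteq> 0}"
  have "bounded ?K" using assms by (auto simp: test_function_def compact_imp_bounded)
  then obtain R where R: "R > 0" "\<And>x. x \<in> ?K \<Longrightarrow> norm x \<le> R"
    using bounded_pos by blast
  \<comment> \<open>\<open>R + 1\<close> instead of \<open>R\<close>, since a point of norm exactly
    R may belong to the closed support. Off the closed support u vanishes on a whole neighbourhood,
    which also kills the derivatives.\<close>
  have *: "u x = 0 \<and> pderivative i u x = 0" if "norm x \<ge> R + 1" for x i
  proof -
    have x: "x \<in> - ?K" using R(2)[of x] that by auto
    have "(u has_derivative (\<lambda>v. 0)) (at x)"
      by (rule has_derivative_transform_within_open[where f = "\<lambda>x. 0" and s = "- ?K"])
        (use x closure_subset[of "{x. u x \<noteq> 0}"] in auto)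
    from pderivative_eqI[OF this] show ?thesis
      using x closure_subset[of "{x. u x \<noteq> 0}"] by auto
  qed
  show ?thesis
    by (rule that[of "R + 1"]) (use R * in auto)
qed

section \<open>Local integrability and duality with test functions\<close>

lemma continuous_zero_outside_bounded:
  fixes u :: "real ^ 'n::finite \<Rightarrow> real"
  assumes "continuous_on UNIV u" "\<And>x. norm x \<ge> R \<Longrightarrow> u x = 0"
  shows "\<exists>M. \<forall>x. \<bar>u x\<bar> \<le> M"
proof -
  have "compact (u ` cball 0 R)"
    using assms(1) by (intro compact_continuous_image) (auto intro: continuous_on_subset)
  then obtain M where M: "\<And>x. x \<in> cball 0 R \<Longrightarrow> \<bar>u x\<bar> \<le> M"
    using compact_imp_bounded bounded_pos by (metis imageI real_norm_def)
  have "\<bar>u x\<bar> \<le> max M 0" for x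
    using M[of x] assms(2)[of x] by (cases "norm x \<ge> R") (auto simp: le_max_iff_disj)
  then show ?thesis by blast
qed

lemma test_function_smooth: "test_function u \<Longrightarrow> smooth u"
  by (simp add: test_function_def)

lemma test_function_bounds:
  assumes "test_function (u :: real ^ 'n::finite \<Rightarrow> real)"
  obtains R M where "R > 0" "M > 0" "\<And>x. norm x \<ge> R \<Longrightarrow> u x = 0"
    "\<And>i x. norm x \<ge> R \<Longrightarrow> pderivative i u x = 0"
    "\<And>x. \<bar>u x\<bar> \<le> M" "\<And>i x. \<bar>pderivative i u x\<bar> \<le> M"
proof -
  obtain R where R: "R > 0" "\<And>x. norm x \<ge> R \<Longrightarrow> u x = 0"
    "\<And>i x. norm x \<ge> R \<Longrightarrow> pderivative i u x = 0"
    using test_function_bounded_support[OF assms] by blast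
  have s: "smooth u" using assms by (rule test_function_smooth)
  obtain M0 where M0: "\<And>x. \<bar>u x\<bar> \<le> M0"
    using continuous_zero_outside_bounded[OF smooth_continuous[OF s]] R(2) by metis
  have "\<exists>M. \<forall>x. \<bar>pderivative i u x\<bar> \<le> M" for i
    using continuous_zero_outside_bounded[OF smooth_continuous[OF smooth_pderivative[OF s]]] R(3) by metis
  then obtain M where M: "\<And>i x. \<bar>pderivative i u x\<bar> \<le> M i" by metis
  have M_nn: "M i \<ge> 0" for i using order_trans[OF abs_ge_zero M] .
  have M0_nn: "M0 \<ge> 0" using order_trans[OF abs_ge_zero M0] .
  let ?M = "1 + M0 + (\<Sum>i\<in>UNIV. M i)"
  have le: "M i \<le> (\<Sum>i\<in>UNIV. M i)" for i by (rule member_le_sum) (auto simp: M_nn)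
  have s0: "0 \<le> (\<Sum>i\<in>UNIV. M i)" by (simp add: M_nn sum_nonneg)
  show ?thesis
  proof (rule that[of R ?M])
    show "\<bar>u x\<bar> \<le> ?M" for x using M0[of x] s0 by linarith
    show "\<bar>pderivative i u x\<bar> \<le> ?M" for i x using M[of i x] le[of i] M0_nn by linarith
  qed (use R s0 M0_nn in auto)
qed

text \<open>Closed balls about 0 exhaust the space and stand for all compact sets. The general
  codomain covers the real energy density as well as the complex derivatives.\<close>

definition loc_integrable :: "(real ^ 'n::finite \<Rightarrow> 'b::{banach, second_countable_topology}) \<Rightarrow> bool" where
  "loc_integrable u \<longleftrightarrow> (\<forall>R. set_integrable lborel (cball 0 R) u)"

lemma locally_integrable_imp: "locally_integrable u \<Longrightarrow> loc_integrable u"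
  by (auto simp: locally_integrable_def loc_integrable_def)

lemma loc_integrable_measurable:
  assumes "loc_integrable u"
  shows "u \<in> borel_measurable borel"
proof (rule borel_measurable_LIMSEQ_metric)
  show "(\<lambda>x. indicator (cball 0 (real n)) x *\<^sub>R u x) \<in> borel_measurable borel" for n
  proof -
    have "integrable lborel (\<lambda>x. indicator (cball 0 (real n)) x *\<^sub>R u x)"
      using assms by (simp add: loc_integrable_def set_integrable_def)
    from borel_measurable_integrable[OF this] show ?thesis by simp
  qed
  show "(\<lambda>n. indicator (cball 0 (real n)) x *\<^sub>R u x) \<longlonglongrightarrow> u x" for x
  proof (rule tendsto_eventually)
    obtain N :: nat where "norm x \<le> real N" using real_arch_simple by blast
    then show "\<forall>\<^sub>F n in sequentially. indicator (cball 0 (real n)) x *\<^sub>R u x = u x"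
      by (intro eventually_sequentiallyI[of N]) (auto simp: indicator_def)
  qed
qed

lemma integrable_bounded_support_mult:
  fixes c :: "real ^ 'n::finite \<Rightarrow> real"
  assumes u: "loc_integrable u" and [measurable]: "c \<in> borel_measurable borel"
    and M: "\<And>x. \<bar>c x\<bar> \<le> M" and R: "\<And>x. norm x \<ge> R \<Longrightarrow> c x = 0"
  shows "integrable lborel (\<lambda>x. c x *\<^sub>R u x)"
proof (rule Bochner_Integration.integrable_bound)
  note [measurable] = loc_integrable_measurable[OF u]
  show "integrable lborel (\<lambda>x. M * norm (indicator (cball 0 R) x *\<^sub>R u x))"
    using u by (intro integrable_mult_right integrable_norm) (simp add: loc_integrable_def set_integrable_def)
  show "(\<lambda>x. c x *\<^sub>R u x) \<in> borel_measurable lborel" by measurable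
  show "AE x in lborel. norm (c x *\<^sub>R u x) \<le> norm (M * norm (indicator (cball 0 R) x *\<^sub>R u x))"
  proof (rule AE_I2)
    fix x
    have "M \<ge> 0" using order_trans[OF abs_ge_zero M] .
    then show "norm (c x *\<^sub>R u x) \<le> norm (M * norm (indicator (cball 0 R) x *\<^sub>R u x))"
    proof (cases "norm x \<le> R")
      case True
      then show ?thesis using mult_right_mono[OF M[of x] norm_ge_zero[of "u x"]] \<open>M \<ge> 0\<close>
        by (simp add: abs_mult)
    qed (simp add: R)
  qed
qed

lemma integrable_test_mult:
  assumes "loc_integrable u" "test_function \<psi>"
  shows "integrable lborel (\<lambda>x. \<psi> x *\<^sub>R u x)" "integrable lborel (\<lambda>x. pderivative i \<psi> x *\<^sub>R u x)"
proof -
  obtain R M where "R > 0" "M > 0" "\<And>x. norm x \<ge> R \<Longrightarrow> \<psi> x = 0"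
    "\<And>i x. norm x \<ge> R \<Longrightarrow> pderivative i \<psi> x = 0"
    "\<And>x. \<bar>\<psi> x\<bar> \<le> M" "\<And>i x. \<bar>pderivative i \<psi> x\<bar> \<le> M"
    using test_function_bounds[OF assms(2)] by blast
  moreover have "\<psi> \<in> borel_measurable borel" "pderivative i \<psi> \<in> borel_measurable borel"
    using test_function_smooth[OF assms(2)]
    by (auto intro: borel_measurable_continuous_onI smooth_continuous smooth_pderivative)
  ultimately show "integrable lborel (\<lambda>x. \<psi> x *\<^sub>R u x)" "integrable lborel (\<lambda>x. pderivative i \<psi> x *\<^sub>R u x)"
    using integrable_bounded_support_mult[OF assms(1), of \<psi> M R]
      integrable_bounded_support_mult[OF assms(1), of "pderivative i \<psi>" M R] by simp_all
qed

text \<open>A measurable function is an almost everywhere limit of continuous ones. Clipping these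
  to [-M, M] preserves the limit, polynomials approximate them uniformly on the ball of radius 2 *
  R, and the factor \<open>ballcut R\<close> turns the polynomials into test functions. That factor
  is 1 wherever h is nonzero, so the limit is unchanged.\<close>

lemma test_function_approximation:
  fixes h :: "real ^ 'n::finite \<Rightarrow> real"
  assumes h: "h \<in> borel_measurable borel" and M: "\<And>x. \<bar>h x\<bar> \<le> M"
    and R: "R > 0" "\<And>x. norm x \<ge> R \<Longrightarrow> h x = 0"
  obtains \<psi> where "\<And>j. test_function (\<psi> j)" "\<And>j x. \<bar>\<psi> j x\<bar> \<le> M + 1"
    "\<And>j x. norm x \<ge> 2 * R \<Longrightarrow> \<psi> j x = 0" "AE x in lborel. (\<lambda>j. \<psi> j x) \<longlonglongrightarrow> h x"
proof -
  have "h \<in> borel_measurable lebesgue" using h by (simp add: measurable_completion)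
  then have "h measurable_on UNIV" by (rule lebesgue_measurable_imp_measurable_on) simp
  then obtain N g where N: "negligible N" and g: "\<And>n::nat. continuous_on UNIV (g n)"
    and lim: "\<And>x. x \<notin> N \<Longrightarrow> (\<lambda>n. g n x) \<longlonglongrightarrow> h x"
    by (auto simp: measurable_on_def)
  define G where "G n x = max (- M) (min M (g n x))" for n x
  \<comment> \<open>The error 1 / (n + 1) tends to 0 and never exceeds 1, whence the uniform bound
    \<open>M + 1\<close>.\<close>
  have "\<exists>p. real_polynomial_function p \<and> (\<forall>x\<in>cball 0 (2 * R). \<bar>G n x - p x\<bar> < inverse (real (Suc n)))" for n
  proof -
    have "continuous_on (cball 0 (2 * R)) (G n)"
      unfolding G_def by (intro continuous_intros continuous_on_subset[OF g]) auto
    from Stone_Weierstrass_real_polynomial_function[OF compact_cball this, of "inverse (real (Suc n))"]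
    show ?thesis by (metis inverse_positive_iff_positive of_nat_0_less_iff zero_less_Suc)
  qed
  then obtain p where p: "\<And>n. real_polynomial_function (p n)"
    "\<And>n x. norm x \<le> 2 * R \<Longrightarrow> \<bar>G n x - p n x\<bar> < inverse (real (Suc n))"
    by (metis mem_cball_0)
  have M0: "M \<ge> 0" using order_trans[OF abs_ge_zero M] .
  have GM: "\<bar>G n x\<bar> \<le> M" for n x using M0 by (auto simp: G_def)
  let ?\<psi> = "\<lambda>n x. ballcut R x * p n x"
  show ?thesis
  proof (rule that)
    show "test_function (?\<psi> n)" for n
      by (intro test_function_ballcut_mult smooth_polynomial p R)
    show "\<bar>?\<psi> n x\<bar> \<le> M + 1" for n x
    proof (cases "norm x \<le> 2 * R")
      case True
      have "inverse (real (Suc n)) \<le> 1" by (simp add: inverse_le_1_iff)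
      then have "\<bar>p n x\<bar> \<le> M + 1" using p(2)[OF True, of n] GM[of n x] by linarith
      then have "\<bar>ballcut R x\<bar> * \<bar>p n x\<bar> \<le> 1 * (M + 1)"
        by (intro mult_mono) (auto simp: ballcut_le ballcut_nonneg)
      then show ?thesis by (simp add: abs_mult)
    qed (use M0 ballcut_zero[OF R(1), of x] in auto)
    show "?\<psi> n x = 0" if "norm x \<ge> 2 * R" for n x
      using ballcut_zero[OF R(1) that] by simp
    have "(\<lambda>j. ?\<psi> j x) \<longlonglongrightarrow> h x" if x: "x \<notin> N" for x
    proof (cases "norm x \<le> 2 * R")
      case True
      have "(\<lambda>n. G n x) \<longlonglongrightarrow> max (- M) (min M (h x))"
        unfolding G_def by (intro tendsto_intros lim x)
      moreover have "max (- M) (min M (h x)) = h x" using M[of x] by (auto simp: abs_le_iff)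
      moreover have "(\<lambda>n. p n x - G n x) \<longlonglongrightarrow> 0"
        by (rule Lim_null_comparison[OF _ LIMSEQ_inverse_real_of_nat])
          (use p(2)[OF True] in \<open>auto simp: abs_minus_commute less_imp_le\<close>)
      ultimately have "(\<lambda>n. (p n x - G n x) + G n x) \<longlonglongrightarrow> 0 + h x"
        by (intro tendsto_add) auto
      then have "(\<lambda>n. ballcut R x * p n x) \<longlonglongrightarrow> ballcut R x * h x"
        by (intro tendsto_mult_left) simp
      moreover have "ballcut R x * h x = h x"
        using ballcut_one[OF R(1), of x] R(2)[of x] by (cases "norm x \<le> R") auto
      ultimately show ?thesis by simp
    next
      case False
      then show ?thesis using ballcut_zero[OF R(1), of x] R by auto
    qed
    then have *: "{x. \<not> (\<lambda>j. ?\<psi> j x) \<longlonglongrightarrow> h x} \<subseteq> N" by blast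
    have "N \<in> null_sets lebesgue" using N by (simp add: negligible_iff_null_sets)
    then have "AE x in lebesgue. (\<lambda>j. ?\<psi> j x) \<longlonglongrightarrow> h x"
      using * by (intro AE_I'[of N]) auto
    then show "AE x in lborel. (\<lambda>j. ?\<psi> j x) \<longlonglongrightarrow> h x" by (simp add: AE_completion_iff)
  qed
qed

text \<open>Testing against \<open>t\<close> times a truncation of \<open>g\<close> and optimising in \<open>t\<close>; the affine bound
  in the hypothesis spares the Cauchy--Schwarz inequality.\<close>

lemma square_integrable_dual:
  fixes g :: "real ^ 'n::finite \<Rightarrow> real"
  assumes g: "loc_integrable g" and C: "C > 0"
    and dual: "\<And>\<psi>. test_function \<psi> \<Longrightarrow>
      \<bar>\<integral>x. \<psi> x * g x \<partial>lborel\<bar> \<le> C * (1 + (\<integral>x. (\<psi> x)\<^sup>2 \<partial>lborel))"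
  shows "(\<integral>\<^sup>+x. ennreal ((g x)\<^sup>2) \<partial>lborel) \<le> ennreal (4 * C\<^sup>2)"
proof -
  note [measurable] = loc_integrable_measurable[OF g]
  define h where "h m x = (if \<bar>g x\<bar> \<le> real m \<and> norm x < real m + 1 then g x else 0)" for m :: nat and x
  have [measurable]: "h m \<in> borel_measurable borel" for m unfolding h_def by measurable
  have hm: "\<bar>h m x\<bar> \<le> real m" for m x by (auto simp: h_def)
  have h0: "h m x = 0" if "norm x \<ge> real m + 1" for m x using that by (simp add: h_def)
  have hg: "h m x * g x = (h m x)\<^sup>2" for m x by (simp add: h_def power2_eq_square)
  have bd: "(\<integral>\<^sup>+x. ennreal ((h m x)\<^sup>2) \<partial>lborel) \<le> ennreal (4 * C\<^sup>2)" for m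
  proof -
    \<comment> \<open>With S the integral of the square of \<open>h m\<close>, testing gives t * S
      \<le> C * (1 + t^2 * S). This t maximises t - C * t^2; the maximum is 1 / (4 * C), hence S
      \<le> 4 * C^2.\<close>
    define t where "t = 1 / (2 * C)"
    define R where "R = real m + 1"
    define M where "M = t * real m"
    have t: "t > 0" using C by (simp add: t_def)
    have R: "R > 0" by (simp add: R_def)
    have "\<bar>t * h m x\<bar> \<le> M" for x using hm[of m x] t by (simp add: M_def abs_mult)
    moreover have "t * h m x = 0" if "norm x \<ge> R" for x
      using h0[of m x] that by (simp add: R_def)
    moreover have "(\<lambda>x. t * h m x) \<in> borel_measurable borel" by measurable
    ultimately obtain \<psi> where \<psi>: "\<And>j. test_function (\<psi> j)" "\<And>j x. \<bar>\<psi> j x\<bar> \<le> M + 1"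
      "\<And>j x. norm x \<ge> 2 * R \<Longrightarrow> \<psi> j x = 0"
      and lim: "AE x in lborel. (\<lambda>j. \<psi> j x) \<longlonglongrightarrow> t * h m x"
      using test_function_approximation[of "\<lambda>x. t * h m x" M R] R by blast
    have M1: "0 \<le> M + 1" using order_trans[OF abs_ge_zero \<psi>(2)] .
    have [measurable]: "\<psi> j \<in> borel_measurable borel" for j
      using \<psi>(1) by (auto intro: borel_measurable_continuous_onI smooth_continuous test_function_smooth)
    have "integrable lborel (\<lambda>x. indicator (cball 0 (2 * R)) x *\<^sub>R g x)"
      using g by (simp add: loc_integrable_def set_integrable_def)
    then have i1: "integrable lborel (\<lambda>x. (M + 1) * \<bar>indicator (cball 0 (2 * R)) x *\<^sub>R g x\<bar>)"
      by (intro integrable_mult_right integrable_abs)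
    have l1: "(\<lambda>j. \<integral>x. \<psi> j x * g x \<partial>lborel) \<longlonglongrightarrow> (\<integral>x. t * h m x * g x \<partial>lborel)"
    proof (rule integral_dominated_convergence[OF _ _ i1])
      show "AE x in lborel. (\<lambda>j. \<psi> j x * g x) \<longlonglongrightarrow> t * h m x * g x"
        using lim by eventually_elim (intro tendsto_intros)
      show "AE x in lborel. norm (\<psi> j x * g x) \<le> (M + 1) * \<bar>indicator (cball 0 (2 * R)) x *\<^sub>R g x\<bar>" for j
      proof (rule AE_I2)
        fix x show "norm (\<psi> j x * g x) \<le> (M + 1) * \<bar>indicator (cball 0 (2 * R)) x *\<^sub>R g x\<bar>"
          using \<psi>(2)[of j x] \<psi>(3)[of x j] by (cases "norm x \<le> 2 * R") (auto simp: abs_mult mult_right_mono)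
      qed
    qed measurable
    have i2: "integrable lborel (\<lambda>x :: real ^ 'n. (M + 1)\<^sup>2 * indicator (cball 0 (2 * R)) x)"
      using emeasure_lborel_cball_finite[of "0 :: real ^ 'n" "2 * R"]
      by (intro integrable_mult_right integrable_real_indicator) (simp_all add: less_top)
    have sq: "(\<psi> j x)\<^sup>2 \<le> (M + 1)\<^sup>2 * indicator (cball 0 (2 * R)) x" for j x
      using power_mono[OF \<psi>(2)[of j x], of 2] \<psi>(3)[of x j] by (cases "norm x \<le> 2 * R") auto
    have l2: "(\<lambda>j. \<integral>x. (\<psi> j x)\<^sup>2 \<partial>lborel) \<longlonglongrightarrow> (\<integral>x. (t * h m x)\<^sup>2 \<partial>lborel)"
    proof (rule integral_dominated_convergence[OF _ _ i2])
      show "AE x in lborel. (\<lambda>j. (\<psi> j x)\<^sup>2) \<longlonglongrightarrow> (t * h m x)\<^sup>2"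
        using lim by eventually_elim (intro tendsto_intros)
    qed (auto simp: sq)
    have le: "\<bar>\<integral>x. t * h m x * g x \<partial>lborel\<bar> \<le> C * (1 + (\<integral>x. (t * h m x)\<^sup>2 \<partial>lborel))"
      by (rule LIMSEQ_le[OF tendsto_rabs[OF l1] tendsto_mult_left[OF tendsto_add[OF tendsto_const l2]]])
        (use dual[OF \<psi>(1)] in auto)
    define S where "S = (\<integral>x. (h m x)\<^sup>2 \<partial>lborel)"
    have i3: "integrable lborel (\<lambda>x. (h m x)\<^sup>2)"
      unfolding hg[symmetric]
      using integrable_bounded_support_mult[OF g _ hm h0, of m] by simp
    have "t * S \<le> C * (1 + t\<^sup>2 * S)"
      using le by (simp add: S_def mult.assoc hg power_mult_distrib)
    then have "4 * C * (t * S) \<le> 4 * C * (C * (1 + t\<^sup>2 * S))"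
      using C by (intro mult_left_mono) auto
    also have "\<dots> = 4 * C\<^sup>2 + 4 * (C * t)\<^sup>2 * S"
      by (simp add: power2_eq_square algebra_simps)
    also have "(C * t)\<^sup>2 = 1 / 4" using C by (simp add: t_def power2_eq_square)
    also have "4 * C * (t * S) = 2 * S" using C by (simp add: t_def)
    finally have "S \<le> 4 * C\<^sup>2" by simp
    then show ?thesis
      using nn_integral_eq_integral[OF i3] by (simp add: S_def[symmetric] ennreal_leI)
  qed
  have "(\<integral>\<^sup>+x. ennreal ((g x)\<^sup>2) \<partial>lborel) \<le> (\<integral>\<^sup>+x. liminf (\<lambda>m. ennreal ((h m x)\<^sup>2)) \<partial>lborel)"
  proof (rule nn_integral_mono)
    fix x
    obtain N :: nat where N: "max \<bar>g x\<bar> (norm x) \<le> real N" using real_arch_simple by blast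
    have "(\<lambda>m. ennreal ((h m x)\<^sup>2)) \<longlonglongrightarrow> ennreal ((g x)\<^sup>2)"
      by (rule tendsto_eventually, rule eventually_sequentiallyI[of N]) (use N in \<open>auto simp: h_def\<close>)
    from lim_imp_Liminf[OF sequentially_bot this]
    show "ennreal ((g x)\<^sup>2) \<le> liminf (\<lambda>m. ennreal ((h m x)\<^sup>2))" by (rule eq_refl[OF sym])
  qed
  also have "\<dots> \<le> liminf (\<lambda>m. \<integral>\<^sup>+x. ennreal ((h m x)\<^sup>2) \<partial>lborel)"
    by (rule nn_integral_liminf) measurable
  also have "\<dots> \<le> ennreal (4 * C\<^sup>2)"
    using bd by (intro Liminf_le) auto
  finally show ?thesis .
qed

text \<open>Vanishing test integrals satisfy the bound of \<open>square_integrable_dual\<close> for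
  every C > 0, so the integral of the square is at most 4 * C^2 for arbitrarily small C. The choice
  C = sqrt e / 2 makes this equal to e.\<close>

lemma AE_zero_test:
  fixes g :: "real ^ 'n::finite \<Rightarrow> real"
  assumes g: "loc_integrable g"
    and zero: "\<And>\<psi>. test_function \<psi> \<Longrightarrow> (\<integral>x. \<psi> x * g x \<partial>lborel) = 0"
  shows "AE x in lborel. g x = 0"
proof -
  note [measurable] = loc_integrable_measurable[OF g]
  have le: "(\<integral>\<^sup>+x. ennreal ((g x)\<^sup>2) \<partial>lborel) \<le> ennreal e" if "e > 0" for e :: real
  proof -
    have "(\<integral>\<^sup>+x. ennreal ((g x)\<^sup>2) \<partial>lborel) \<le> ennreal (4 * (sqrt e / 2)\<^sup>2)"
      using that by (intro square_integrable_dual g) (auto simp: zero)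
    then show ?thesis using that by (simp add: power_divide)
  qed
  have "(\<integral>\<^sup>+x. ennreal ((g x)\<^sup>2) \<partial>lborel) \<le> 0"
    by (rule ennreal_le_epsilon) (simp only: le add_0)
  then have "(\<integral>\<^sup>+x. ennreal ((g x)\<^sup>2) \<partial>lborel) = 0" by simp
  moreover have "(\<lambda>x. ennreal ((g x)\<^sup>2)) \<in> borel_measurable lborel" by measurable
  ultimately have "AE x in lborel. ennreal ((g x)\<^sup>2) = 0"
    using nn_integral_0_iff_AE by blast
  then show ?thesis by eventually_elim simp
qed

section \<open>Finite Korevaar--Schoen energy gives square integrable weak derivatives\<close>

text \<open>The group law is plain addition on the z coordinates, so the horizontal part of the
  group difference is the ordinary difference, and the squared vertical part only increases the
  expression under the fourth root.\<close>

lemma cmod_zcomp_le_heis_dist: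
  "cmod (zcomp f k q - zcomp f k p) \<le> heis_dist (f p) (f q)"
proof -
  obtain x y t where fp: "f p = (x, y, t)" by (cases "f p")
  obtain x' y' t' where fq: "f q = (x', y', t')" by (cases "f q")
  let ?A = "(norm (x' - x))\<^sup>2 + (norm (y' - y))\<^sup>2"
  let ?c = "cmod (zcomp f k q - zcomp f k p)"
  have c: "?c\<^sup>2 = ((x' - x) $ k)\<^sup>2 + ((y' - y) $ k)\<^sup>2"
    by (simp add: cmod_def zcomp_def fp fq)
  have "((x' - x) $ k)\<^sup>2 \<le> (norm (x' - x))\<^sup>2" "((y' - y) $ k)\<^sup>2 \<le> (norm (y' - y))\<^sup>2"
    using power_mono[OF component_le_norm_cart[of "x' - x" k] abs_ge_zero, of 2]
      power_mono[OF component_le_norm_cart[of "y' - y" k] abs_ge_zero, of 2] by simp_all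
  then have "?c\<^sup>2 \<le> ?A" unfolding c by (rule add_mono)
  then have "(?c\<^sup>2)\<^sup>2 \<le> ?A\<^sup>2" by (rule power_mono) simp
  moreover have "(?c\<^sup>2)\<^sup>2 = ?c ^ 4" by (simp only: power_mult[symmetric]) simp
  ultimately have "?c ^ 4 \<le> ?A\<^sup>2 + s\<^sup>2" for s :: real
    by (metis add_increasing2 zero_le_power2)
  then have "root 4 (?c ^ 4) \<le> root 4 (?A\<^sup>2 + s\<^sup>2)" for s :: real
    by (simp only: real_root_le_iff)
  then show ?thesis
    by (simp add: heis_dist_def fp fq heis_inv_def heis_mult_def heis_norm_def real_root_power_cancel)
qed

text \<open>\<open>sphere_measure\<close> is a pushforward from the unit ball, so a sphere integral
  becomes an integral over the ball through the direction \<open>sgn x\<close>. The powers of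
  \<epsilon> cancel and leave a factor n, which is at least 1 and is discarded. The change of
  variables comes after the passage to the z coordinates, whose measurability is at hand.\<close>

lemma ks_density_ge:
  fixes f :: "real ^ 'n::finite \<Rightarrow> 'm::finite heis"
  assumes [measurable]: "zcomp f k \<in> borel_measurable borel" and \<epsilon>: "\<epsilon> > 0"
  shows "(\<integral>\<^sup>+x\<in>ball 0 1. ennreal ((cmod (zcomp f k (p + \<epsilon> *\<^sub>R sgn x) - zcomp f k p) / \<epsilon>)\<^sup>2) \<partial>lborel)
    \<le> ks_density UNIV f \<epsilon> p"
proof -
  let ?n = "CARD('n)"
  let ?h = "\<lambda>q. ennreal ((cmod (zcomp f k q - zcomp f k p) / \<epsilon>)\<^sup>2)"
  let ?c = "real ?n * \<epsilon> ^ (?n - 1)"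
  let ?D = "distr (restrict_space lborel (ball 0 1)) borel (\<lambda>x. p + \<epsilon> *\<^sub>R sgn x)"
  have [measurable]: "(\<lambda>x :: real ^ 'n. p + \<epsilon> *\<^sub>R sgn x) \<in> borel_measurable borel"
    unfolding sgn_div_norm by measurable
  have *: "(\<lambda>x. p + \<epsilon> *\<^sub>R sgn x) \<in> measurable (restrict_space lborel (ball 0 1)) borel"
    by (intro measurable_restrict_space1) measurable
  have "(\<integral>\<^sup>+x\<in>ball 0 1. ?h (p + \<epsilon> *\<^sub>R sgn x) \<partial>lborel) = (\<integral>\<^sup>+q. ?h q \<partial>?D)"
    using * by (simp add: nn_integral_distr nn_integral_restrict_space)
  moreover have "ennreal ?c * (\<integral>\<^sup>+q. ?h q \<partial>?D) = (\<integral>\<^sup>+q. ?h q \<partial>sphere_measure p \<epsilon>)"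
    by (simp add: sphere_measure_def nn_integral_scale_measure)
  moreover have "(\<integral>\<^sup>+q. ?h q \<partial>sphere_measure p \<epsilon>)
      \<le> (\<integral>\<^sup>+q\<in>UNIV. ennreal ((heis_dist (f p) (f q) / \<epsilon>)\<^sup>2) \<partial>sphere_measure p \<epsilon>)"
    using \<epsilon> by (intro nn_integral_mono)
      (auto intro!: ennreal_leI power_mono divide_right_mono cmod_zcomp_le_heis_dist)
  ultimately have A: "ennreal ?c * (\<integral>\<^sup>+x\<in>ball 0 1. ?h (p + \<epsilon> *\<^sub>R sgn x) \<partial>lborel) / ennreal (\<epsilon> ^ (?n - 1))
      \<le> ks_density UNIV f \<epsilon> p"
    unfolding ks_density_def by (intro divide_right_mono_ennreal) simp
  have B: "1 * X \<le> ennreal ?c * X / ennreal (\<epsilon> ^ (?n - 1))" for X :: ennreal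
  proof -
    have "ennreal ?c * X / ennreal (\<epsilon> ^ (?n - 1)) = (ennreal ?c / ennreal (\<epsilon> ^ (?n - 1))) * X"
      by (simp add: ennreal_times_divide mult.commute)
    also have "ennreal ?c / ennreal (\<epsilon> ^ (?n - 1)) = ennreal (real ?n)"
      using \<epsilon> by (simp add: divide_ennreal)
    finally show ?thesis
      by (simp only:) (intro mult_right_mono, simp_all add: Suc_leI)
  qed
  show ?thesis using order_trans[OF B A] by (simp only: mult_1)
qed

lemma ballcut_in_cutoffs: "R > 0 \<Longrightarrow> ballcut R \<in> cutoffs UNIV"
  unfolding cutoffs_def
  by (auto simp: smooth_continuous smooth_ballcut ballcut_nonneg ballcut_le
      intro!: exI[of _ "cball 0 (2 * R)"] ballcut_zero)

lemma norm_sgn_le_1: "norm (sgn x) \<le> 1"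
  by (simp add: norm_sgn)

text \<open>Fatou's lemma and dominated convergence act along sequences, so the radius runs through
  1 / (j + 1). Values at most 1 displace a support by at most 1 when multiplied by a vector of norm
  at most 1.\<close>

definition energy_step :: "nat \<Rightarrow> real" where
  "energy_step j = inverse (real (Suc j))"

lemma energy_step: "energy_step j > 0" "energy_step j \<le> 1" "energy_step \<longlonglongrightarrow> 0"
  using LIMSEQ_inverse_real_of_nat by (auto simp: energy_step_def[abs_def] inverse_le_1_iff)

text \<open>The radius \<open>m + 1\<close> is positive even for \<open>m = 0\<close>, so
  \<open>ballcut\<close> at this radius is an admissible cutoff that equals 1 on the ball of
  integration.\<close>

definition diff_quotient_energy ::
    "(real ^ 'n::finite \<Rightarrow> complex) \<Rightarrow> nat \<Rightarrow> real ^ 'n \<Rightarrow> nat \<Rightarrow> ennreal" where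
  "diff_quotient_energy w m v j =
     (\<integral>\<^sup>+p\<in>cball 0 (real m + 1). ennreal ((cmod (w (p + energy_step j *\<^sub>R v) - w p) / energy_step j)\<^sup>2) \<partial>lborel)"

text \<open>Tonelli: averaging over directions at each point p and then integrating in p equals
  averaging, over directions, the energy of the difference quotient in a fixed direction. The bound
  C does not depend on m because every \<open>ballcut\<close> competes in the same supremum.\<close>

lemma diff_quotient_energy_eventually_bounded:
  fixes f :: "real ^ 'n::finite \<Rightarrow> 'm::finite heis"
  assumes [measurable]: "zcomp f k \<in> borel_measurable borel" and C: "ks_energy UNIV f < C"
  shows "\<forall>\<^sub>F j in sequentially.
    (\<integral>\<^sup>+x\<in>ball 0 1. diff_quotient_energy (zcomp f k) m (sgn x) j \<partial>lborel) \<le> C"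
proof -
  let ?w = "zcomp f k"
  let ?R = "real m + 1"
  have [measurable]: "(sgn :: real ^ 'n \<Rightarrow> _) \<in> borel_measurable borel"
    unfolding sgn_div_norm by measurable
  have [measurable]: "ball (0 :: real ^ 'n) r \<in> sets borel" "cball (0 :: real ^ 'n) r \<in> sets borel" for r
    by simp_all
  let ?E = "\<lambda>\<epsilon>. \<integral>\<^sup>+p\<in>UNIV. ennreal (ballcut ?R p) * ks_density UNIV f \<epsilon> p \<partial>lborel"
  have "Limsup (at_right 0) ?E \<le> ks_energy UNIV f"
    unfolding ks_energy_def by (rule SUP_upper) (simp add: ballcut_in_cutoffs)
  then have "\<forall>\<^sub>F \<epsilon> in at_right 0. ?E \<epsilon> < C"
    using C by (intro Limsup_lessD) simp
  moreover have "filterlim energy_step (at_right 0) sequentially"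
    using energy_step less_imp_neq[OF energy_step(1), symmetric] by (auto simp: filterlim_at)
  ultimately have "\<forall>\<^sub>F j in sequentially. ?E (energy_step j) < C"
    by (rule eventually_compose_filterlim)
  then show ?thesis
  proof eventually_elim
    case (elim j)
    let ?e = "energy_step j"
    let ?q = "\<lambda>p x. ennreal ((cmod (?w (p + ?e *\<^sub>R sgn x) - ?w p) / ?e)\<^sup>2)"
    have "(\<integral>\<^sup>+x\<in>ball 0 1. diff_quotient_energy ?w m (sgn x) j \<partial>lborel)
        = (\<integral>\<^sup>+x. (\<integral>\<^sup>+p. ?q p x * indicator (cball 0 ?R) p * indicator (ball 0 1) x \<partial>lborel) \<partial>lborel)"
      unfolding diff_quotient_energy_def by (intro nn_integral_cong nn_integral_multc[symmetric]) measurable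
    also have "\<dots> = (\<integral>\<^sup>+p. (\<integral>\<^sup>+x. ?q p x * indicator (cball 0 ?R) p * indicator (ball 0 1) x \<partial>lborel) \<partial>lborel)"
      by (rule lborel_pair.Fubini') measurable
    also have "\<dots> = (\<integral>\<^sup>+p. indicator (cball 0 ?R) p * (\<integral>\<^sup>+x\<in>ball 0 1. ?q p x \<partial>lborel) \<partial>lborel)"
      by (subst nn_integral_cmult[symmetric]) (simp_all add: mult_ac)
    also have "\<dots> \<le> ?E ?e"
    proof (rule nn_integral_mono)
      fix p :: "real ^ 'n"
      have "indicator (cball 0 ?R) p \<le> ennreal (ballcut ?R p)"
        by (auto simp: indicator_def ballcut_one)
      then show "indicator (cball 0 ?R) p * (\<integral>\<^sup>+x\<in>ball 0 1. ?q p x \<partial>lborel)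
          \<le> ennreal (ballcut ?R p) * ks_density UNIV f ?e p * indicator UNIV p"
        using mult_mono[OF _ ks_density_ge[OF assms(1) energy_step(1)]] by simp
    qed
    finally show ?case using elim by simp
  qed
qed

text \<open>Fatou's lemma in the direction variable, then monotone convergence in m, possible
  because C is the same for all m. The supremum over m gives each good direction a single bound that
  serves test functions of arbitrarily large support.\<close>

lemma liminf_diff_quotient_energy_finite:
  fixes f :: "real ^ 'n::finite \<Rightarrow> 'm::finite heis"
  assumes w[measurable]: "zcomp f k \<in> borel_measurable borel" and fin: "ks_energy UNIV f < \<infinity>"
  shows "AE x in lborel. x \<in> ball 0 1 \<longrightarrow>
    (SUP m. liminf (diff_quotient_energy (zcomp f k) m (sgn x))) < \<infinity>"
proof -
  obtain C where C: "ks_energy UNIV f < C" "C < \<infinity>" using fin dense by blast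
  let ?w = "zcomp f k"
  have [measurable]: "(sgn :: real ^ 'n \<Rightarrow> _) \<in> borel_measurable borel"
    unfolding sgn_div_norm by measurable
  have [measurable]: "cball (0 :: real ^ 'n) r \<in> sets borel" for r by simp
  have [measurable]: "(\<lambda>x. diff_quotient_energy ?w m (sgn x) j) \<in> borel_measurable lborel" for m j
    unfolding diff_quotient_energy_def by measurable
  let ?g = "\<lambda>m x. liminf (diff_quotient_energy ?w m (sgn x)) * indicator (ball 0 1) x"
  have mono: "diff_quotient_energy ?w m v j \<le> diff_quotient_energy ?w m' v j" if "m \<le> m'" for m m' v j
    unfolding diff_quotient_energy_def using that
    by (intro nn_integral_mono mult_left_mono) (auto simp: indicator_def)
  have "incseq ?g"
    using mono by (auto simp: incseq_def le_fun_def intro!: mult_right_mono Liminf_mono always_eventually)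
  have [measurable]: "ball (0 :: real ^ 'n) r \<in> sets borel" for r by simp
  from \<open>incseq ?g\<close> have "(\<integral>\<^sup>+x. (SUP m. ?g m x) \<partial>lborel) = (SUP m. \<integral>\<^sup>+x. ?g m x \<partial>lborel)"
    by (intro nn_integral_monotone_convergence_SUP) measurable
  also have "\<dots> \<le> C"
  proof (rule SUP_least)
    fix m
    have "(\<integral>\<^sup>+x. ?g m x \<partial>lborel)
        \<le> (\<integral>\<^sup>+x. liminf (\<lambda>j. diff_quotient_energy ?w m (sgn x) j * indicator (ball 0 1) x) \<partial>lborel)"
      by (intro nn_integral_mono) (auto simp: indicator_def)
    also have "\<dots> \<le> liminf (\<lambda>j. \<integral>\<^sup>+x\<in>ball 0 1. diff_quotient_energy ?w m (sgn x) j \<partial>lborel)"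
      by (rule nn_integral_liminf) measurable
    also have "\<dots> \<le> C"
      using diff_quotient_energy_eventually_bounded[OF w C(1)] by (rule Liminf_le[OF sequentially_bot])
    finally show "(\<integral>\<^sup>+x. ?g m x \<partial>lborel) \<le> C" .
  qed
  finally have "(\<integral>\<^sup>+x. (SUP m. ?g m x) \<partial>lborel) \<noteq> \<infinity>" using C(2) by auto
  then have "AE x in lborel. (SUP m. ?g m x) \<noteq> \<infinity>"
    by (intro nn_integral_PInf_AE) measurable
  then show ?thesis
  proof eventually_elim
    case (elim x)
    show ?case
    proof
      assume "x \<in> ball 0 1"
      then have "(SUP m. ?g m x) = (SUP m. liminf (diff_quotient_energy ?w m (sgn x)))" by simp
      then show "(SUP m. liminf (diff_quotient_energy ?w m (sgn x))) < \<infinity>"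
        using elim by (simp only: less_top infinity_ennreal_def)
    qed
  qed
qed

section \<open>Weak limits of difference quotients\<close>

lemma integral_translate:
  fixes F :: "real ^ 'n::finite \<Rightarrow> complex"
  assumes [measurable]: "F \<in> borel_measurable borel"
  shows "(\<integral>x. F (x + c) \<partial>lborel) = (\<integral>x. F x \<partial>lborel)"
    and "integrable lborel F \<Longrightarrow> integrable lborel (\<lambda>x. F (x + c))"
proof -
  have d: "distr lborel borel (\<lambda>x. x + c) = lborel"
    using lborel_distr_plus[of c] by (simp add: add.commute[of _ c])
  show "(\<integral>x. F (x + c) \<partial>lborel) = (\<integral>x. F x \<partial>lborel)"
    by (subst (2) d[symmetric], subst integral_distr) auto
  assume "integrable lborel F"
  then have "integrable (distr lborel borel (\<lambda>x. x + c)) F" by (simp add: d)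
  then show "integrable lborel (\<lambda>x. F (x + c))" by (subst (asm) integrable_distr_eq) auto
qed

lemma test_function_lipschitz:
  fixes \<psi> :: "real ^ 'n::finite \<Rightarrow> real"
  assumes "test_function \<psi>" "\<And>i x. \<bar>pderivative i \<psi> x\<bar> \<le> M"
  shows "\<bar>\<psi> y - \<psi> x\<bar> \<le> real CARD('n) * M * norm (y - x)"
proof -
  have "norm (\<psi> y - \<psi> x) \<le> real CARD('n) * M * norm (y - x)"
  proof (rule differentiable_bound[OF convex_UNIV])
    fix x :: "real ^ 'n"
    show "(\<psi> has_derivative (\<lambda>v. \<Sum>i\<in>UNIV. v $ i * pderivative i \<psi> x)) (at x within UNIV)"
      using has_derivative_pderivative[OF smooth_differentiable[OF test_function_smooth[OF assms(1)]]]
      by simp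
    show "onorm (\<lambda>v. \<Sum>i\<in>UNIV. v $ i * pderivative i \<psi> x) \<le> real CARD('n) * M"
    proof (rule onorm_le)
      fix v :: "real ^ 'n"
      have "\<bar>\<Sum>i\<in>UNIV. v $ i * pderivative i \<psi> x\<bar> \<le> (\<Sum>i\<in>(UNIV :: 'n set). norm v * M)"
        by (rule order_trans[OF sum_abs sum_mono])
          (auto simp: abs_mult intro!: mult_mono component_le_norm_cart assms(2))
      then show "norm (\<Sum>i\<in>UNIV. v $ i * pderivative i \<psi> x) \<le> real CARD('n) * M * norm v"
        by (simp add: mult_ac)
    qed
  qed auto
  then show ?thesis by simp
qed

lemma diff_quotient_limit:
  fixes \<psi> :: "real ^ 'n::finite \<Rightarrow> real"
  assumes "\<psi> differentiable (at p)"
  shows "(\<lambda>j. (\<psi> (p - energy_step j *\<^sub>R v) - \<psi> p) / energy_step j)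
    \<longlonglongrightarrow> - (\<Sum>i\<in>UNIV. v $ i * pderivative i \<psi> p)"
proof -
  let ?D = "\<lambda>v. \<Sum>i\<in>UNIV. v $ i * pderivative i \<psi> p"
  have "((\<lambda>s. p - s *\<^sub>R v) has_derivative (\<lambda>s. - (s *\<^sub>R v))) (at 0)"
    by (auto intro!: derivative_eq_intros)
  moreover have "(\<psi> has_derivative ?D) (at (p - 0 *\<^sub>R v))"
    using has_derivative_pderivative[OF assms] by simp
  ultimately have "((\<lambda>s. \<psi> (p - s *\<^sub>R v)) has_derivative (\<lambda>s. ?D (- (s *\<^sub>R v)))) (at 0)"
    by (rule has_derivative_compose)
  moreover have "(\<lambda>s. ?D (- (s *\<^sub>R v))) = (*) (- ?D v)"
    by (auto simp: sum_distrib_left sum_negf mult_ac)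
  ultimately have "((\<lambda>s. \<psi> (p - s *\<^sub>R v)) has_field_derivative - ?D v) (at 0)"
    by (simp add: has_field_derivative_def)
  then have "((\<lambda>s. (\<psi> (p - s *\<^sub>R v) - \<psi> p) / s) \<longlongrightarrow> - ?D v) (at 0)"
    by (simp add: has_field_derivative_iff)
  moreover have "filterlim energy_step (at 0) sequentially"
    using energy_step(3) less_imp_neq[OF energy_step(1), symmetric] by (auto simp: filterlim_at)
  ultimately show ?thesis by (rule filterlim_compose)
qed

text \<open>Discrete integration by parts: a translation moves the difference quotient from w to the
  test function, where it converges to minus a directional derivative and is dominated by the
  Lipschitz bound on a fixed ball. The definition of the weak derivative then moves the derivative
  back.\<close>

lemma diff_quotient_weak_limit:
  fixes w :: "real ^ 'n::finite \<Rightarrow> complex"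
  assumes g: "\<And>i. weak_pderivative i w (g i)" and \<psi>: "test_function \<psi>" and v: "norm v \<le> 1"
  shows "(\<lambda>j. \<integral>p. \<psi> p *\<^sub>R ((w (p + energy_step j *\<^sub>R v) - w p) /\<^sub>R energy_step j) \<partial>lborel)
    \<longlonglongrightarrow> (\<Sum>i\<in>UNIV. v $ i *\<^sub>R (\<integral>p. \<psi> p *\<^sub>R g i p \<partial>lborel))"
    and "integrable lborel (\<lambda>p. \<psi> p *\<^sub>R ((w (p + energy_step j *\<^sub>R v) - w p) /\<^sub>R energy_step j))"
proof -
  have w: "loc_integrable w" using g by (auto simp: weak_pderivative_def intro: locally_integrable_imp)
  note [measurable] = loc_integrable_measurable[OF w]
  obtain R M where R: "R > 0" "M > 0" "\<And>x. norm x \<ge> R \<Longrightarrow> \<psi> x = 0"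
    "\<And>i x. norm x \<ge> R \<Longrightarrow> pderivative i \<psi> x = 0"
    "\<And>x. \<bar>\<psi> x\<bar> \<le> M" "\<And>i x. \<bar>pderivative i \<psi> x\<bar> \<le> M"
    using test_function_bounds[OF \<psi>] by blast
  have [measurable]: "\<psi> \<in> borel_measurable borel"
    using \<psi> by (auto intro: borel_measurable_continuous_onI smooth_continuous test_function_smooth)
  let ?e = energy_step
  let ?q = "\<lambda>j p. (\<psi> (p - ?e j *\<^sub>R v) - \<psi> p) / ?e j"
  have shift: "norm (x - ?e j *\<^sub>R v) \<ge> R" if "norm x \<ge> R + 1" for x j
  proof -
    have "norm (?e j *\<^sub>R v) \<le> 1 * 1"
      unfolding norm_scaleR using energy_step(1,2)[of j] v by (intro mult_mono) auto
    then show ?thesis using that norm_triangle_ineq2[of x "?e j *\<^sub>R v"] by linarith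
  qed
  have i1: "integrable lborel (\<lambda>p. \<psi> p *\<^sub>R w p)" by (rule integrable_test_mult[OF w \<psi>])
  have i2: "integrable lborel (\<lambda>p. \<psi> (p - ?e j *\<^sub>R v) *\<^sub>R w p)" for j
    by (rule integrable_bounded_support_mult[OF w, where M = M and R = "R + 1"])
      (use R shift in auto)
  have i3: "integrable lborel (\<lambda>p. \<psi> p *\<^sub>R w (p + ?e j *\<^sub>R v))" for j
    using integral_translate(2)[OF _ i2[of j], of "?e j *\<^sub>R v"] by simp
  have split: "\<psi> p *\<^sub>R ((w (p + ?e j *\<^sub>R v) - w p) /\<^sub>R ?e j)
      = (\<psi> p *\<^sub>R w (p + ?e j *\<^sub>R v) - \<psi> p *\<^sub>R w p) /\<^sub>R ?e j" for p j
    by (simp add: scaleR_diff_right mult.commute)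
  show "integrable lborel (\<lambda>p. \<psi> p *\<^sub>R ((w (p + ?e j *\<^sub>R v) - w p) /\<^sub>R ?e j))"
    unfolding split using i1 i3 by (intro integrable_scaleR_right Bochner_Integration.integrable_diff)
  have eq: "(\<integral>p. \<psi> p *\<^sub>R ((w (p + ?e j *\<^sub>R v) - w p) /\<^sub>R ?e j) \<partial>lborel)
      = (\<integral>p. ?q j p *\<^sub>R w p \<partial>lborel)" for j
  proof -
    have "(\<integral>p. \<psi> p *\<^sub>R w (p + ?e j *\<^sub>R v) \<partial>lborel) = (\<integral>p. \<psi> (p - ?e j *\<^sub>R v) *\<^sub>R w p \<partial>lborel)"
      using integral_translate(1)[of "\<lambda>p. \<psi> (p - ?e j *\<^sub>R v) *\<^sub>R w p" "?e j *\<^sub>R v"] by simp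
    then have "(\<integral>p. \<psi> p *\<^sub>R ((w (p + ?e j *\<^sub>R v) - w p) /\<^sub>R ?e j) \<partial>lborel)
      = (\<integral>p. (\<psi> (p - ?e j *\<^sub>R v) *\<^sub>R w p - \<psi> p *\<^sub>R w p) /\<^sub>R ?e j \<partial>lborel)"
      unfolding split using i1 i2 i3 by (simp add: Bochner_Integration.integral_diff)
    also have "\<dots> = (\<integral>p. ?q j p *\<^sub>R w p \<partial>lborel)"
      by (rule Bochner_Integration.integral_cong) (simp_all add: divide_inverse scaleR_diff_left[symmetric] mult.commute)
    finally show ?thesis .
  qed
  let ?K = "real CARD('n) * M"
  have "integrable lborel (\<lambda>x. indicator (cball 0 (R + 1)) x *\<^sub>R w x)"
    using w by (simp add: loc_integrable_def set_integrable_def)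
  then have dom: "integrable lborel (\<lambda>x. ?K * norm (indicator (cball 0 (R + 1)) x *\<^sub>R w x))"
    by (intro integrable_mult_right integrable_norm)
  have "(\<lambda>j. \<integral>p. ?q j p *\<^sub>R w p \<partial>lborel)
      \<longlonglongrightarrow> (\<integral>p. (- (\<Sum>i\<in>UNIV. v $ i * pderivative i \<psi> p)) *\<^sub>R w p \<partial>lborel)"
  proof (rule integral_dominated_convergence[OF _ _ dom])
    have [measurable]: "pderivative i \<psi> \<in> borel_measurable borel" for i
      using \<psi> by (auto intro: borel_measurable_continuous_onI smooth_continuous test_function_smooth
          smooth_pderivative)
    show "(\<lambda>p. (- (\<Sum>i\<in>UNIV. v $ i * pderivative i \<psi> p)) *\<^sub>R w p) \<in> borel_measurable lborel"
      by measurable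
    show "(\<lambda>p. ?q j p *\<^sub>R w p) \<in> borel_measurable lborel" for j by measurable
    show "AE p in lborel. (\<lambda>j. ?q j p *\<^sub>R w p)
        \<longlonglongrightarrow> (- (\<Sum>i\<in>UNIV. v $ i * pderivative i \<psi> p)) *\<^sub>R w p"
      using \<psi> by (intro AE_I2 tendsto_scaleR tendsto_const diff_quotient_limit smooth_differentiable
          test_function_smooth)
    show "AE p in lborel. norm (?q j p *\<^sub>R w p) \<le> ?K * norm (indicator (cball 0 (R + 1)) p *\<^sub>R w p)" for j
    proof (rule AE_I2)
      fix p
      show "norm (?q j p *\<^sub>R w p) \<le> ?K * norm (indicator (cball 0 (R + 1)) p *\<^sub>R w p)"
      proof (cases "norm p \<le> R + 1")
        case True
        have "\<bar>\<psi> (p - ?e j *\<^sub>R v) - \<psi> p\<bar> \<le> ?K * norm ((p - ?e j *\<^sub>R v) - p)"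
          by (rule test_function_lipschitz[OF \<psi> R(6)])
        also have "\<dots> = ?K * (?e j * norm v)" using energy_step(1)[of j] by simp
        also have "\<dots> \<le> ?K * (?e j * 1)"
          using energy_step(1)[of j] v R(2) by (intro mult_left_mono) auto
        finally have "\<bar>?q j p\<bar> \<le> ?K"
          using energy_step(1)[of j] by (simp add: abs_divide divide_le_eq)
        from mult_right_mono[OF this norm_ge_zero[of "w p"]] show ?thesis using True by simp
      next
        case False
        then have "\<psi> (p - ?e j *\<^sub>R v) = 0" "\<psi> p = 0" using R(3) shift[of p j] by auto
        then show ?thesis using R(2) by simp
      qed
    qed
  qed
  also have "(\<integral>p. (- (\<Sum>i\<in>UNIV. v $ i * pderivative i \<psi> p)) *\<^sub>R w p \<partial>lborel)
      = (\<integral>p. - (\<Sum>i\<in>UNIV. v $ i *\<^sub>R (pderivative i \<psi> p *\<^sub>R w p)) \<partial>lborel)"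
    by (simp add: scaleR_sum_left)
  also have "\<dots> = - (\<Sum>i\<in>UNIV. v $ i *\<^sub>R (\<integral>p. pderivative i \<psi> p *\<^sub>R w p \<partial>lborel))"
    using integrable_test_mult(2)[OF w \<psi>]
    by (simp add: Bochner_Integration.integral_sum integrable_scaleR_right del: scaleR_scaleR)
  also have "\<dots> = (\<Sum>i\<in>UNIV. v $ i *\<^sub>R (\<integral>p. \<psi> p *\<^sub>R g i p \<partial>lborel))"
    using g \<psi> by (simp add: weak_pderivative_def sum_negf)
  finally show "(\<lambda>j. \<integral>p. \<psi> p *\<^sub>R ((w (p + energy_step j *\<^sub>R v) - w p) /\<^sub>R energy_step j) \<partial>lborel)
    \<longlonglongrightarrow> (\<Sum>i\<in>UNIV. v $ i *\<^sub>R (\<integral>p. \<psi> p *\<^sub>R g i p \<partial>lborel))"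
    unfolding eq .
qed


text \<open>Only a lower limit is finite, so no bound holds for all j. If the estimate failed, the
  integrals converging to its left side would eventually exceed the right side, and a * b \<le> a^2
  + b^2 would put every late energy at \<open>c + 1\<close> or above, against a lower limit of at
  most c. The extra 1 makes the contradiction strict.\<close>

lemma diff_quotient_energy_dual:
  fixes w :: "real ^ 'n::finite \<Rightarrow> complex"
  assumes g: "\<And>i. weak_pderivative i w (g i)" and v: "norm v \<le> 1"
    and fin: "(SUP m. liminf (diff_quotient_energy w m v)) < \<infinity>"
  shows "\<exists>C\<ge>0. \<forall>\<psi>. test_function \<psi> \<longrightarrow> cmod (\<Sum>i\<in>UNIV. v $ i *\<^sub>R (\<integral>p. \<psi> p *\<^sub>R g i p \<partial>lborel))
    \<le> C * (1 + (\<integral>p. (\<psi> p)\<^sup>2 \<partial>lborel))"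
proof -
  have w: "loc_integrable w" using g by (auto simp: weak_pderivative_def intro: locally_integrable_imp)
  note [measurable] = loc_integrable_measurable[OF w]
  have [measurable]: "cball (0 :: real ^ 'n) r \<in> sets borel" for r by simp
  define c where "c = enn2real (SUP m. liminf (diff_quotient_energy w m v))"
  have c: "c \<ge> 0" "(SUP m. liminf (diff_quotient_energy w m v)) = ennreal c"
    using fin by (simp_all only: c_def enn2real_nonneg ennreal_enn2real infinity_ennreal_def)
  have "cmod (\<Sum>i\<in>UNIV. v $ i *\<^sub>R (\<integral>p. \<psi> p *\<^sub>R g i p \<partial>lborel))
    \<le> (c + 1) * (1 + (\<integral>p. (\<psi> p)\<^sup>2 \<partial>lborel))" (is "cmod ?L \<le> ?B") if \<psi>: "test_function \<psi>" for \<psi>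
  proof (rule ccontr)
    assume "\<not> cmod ?L \<le> ?B"
    let ?D = "\<lambda>j p. (w (p + energy_step j *\<^sub>R v) - w p) /\<^sub>R energy_step j"
    let ?a = "\<lambda>j. \<integral>p. \<psi> p *\<^sub>R ?D j p \<partial>lborel"
    have "(\<lambda>j. cmod (?a j)) \<longlonglongrightarrow> cmod ?L"
      by (intro tendsto_norm diff_quotient_weak_limit(1) g \<psi> v)
    moreover have "?B < cmod ?L" using \<open>\<not> cmod ?L \<le> ?B\<close> by (simp only: not_le)
    ultimately have ev: "\<forall>\<^sub>F j in sequentially. cmod (?a j) > ?B" by (rule order_tendstoD(1))
    obtain R where R: "R > 0" "\<And>x. norm x \<ge> R \<Longrightarrow> \<psi> x = 0"
      by (rule test_function_bounded_support[OF \<psi>]) (rule that)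
    have [measurable]: "\<psi> \<in> borel_measurable borel"
      using \<psi> by (auto intro: borel_measurable_continuous_onI smooth_continuous test_function_smooth)
    have "set_integrable lborel (cball 0 r) \<psi>" for r
      unfolding set_integrable_def
      by (intro borel_integrable_compact compact_cball continuous_on_subset[OF smooth_continuous]
          test_function_smooth \<psi> subset_UNIV)
    then have "loc_integrable \<psi>" by (simp add: loc_integrable_def)
    from integrable_test_mult(1)[OF this \<psi>] have i2: "integrable lborel (\<lambda>p. (\<psi> p)\<^sup>2)"
      by (simp add: power2_eq_square)
    obtain m :: nat where m: "R \<le> real m" using real_arch_simple by blast
    have "\<forall>\<^sub>F j in sequentially. ennreal (c + 1) \<le> diff_quotient_energy w m v j"
      using ev
    proof eventually_elim
      case (elim j)
      show ?case
      proof (rule ccontr)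
        assume "\<not> ennreal (c + 1) \<le> diff_quotient_energy w m v j"
        then have le: "diff_quotient_energy w m v j \<le> ennreal (c + 1)" by simp
        have nD: "cmod (?D j p) = cmod (w (p + energy_step j *\<^sub>R v) - w p) / energy_step j" for p
          using energy_step(1)[of j] by (simp add: divide_inverse mult.commute)
        have "ennreal (cmod (?a j)) \<le> (\<integral>\<^sup>+p. ennreal (norm (\<psi> p *\<^sub>R ?D j p)) \<partial>lborel)"
          by (intro integral_norm_bound_ennreal diff_quotient_weak_limit(2)[where g = g] g \<psi> v)
        also have "\<dots> \<le> (\<integral>\<^sup>+p. ennreal ((\<psi> p)\<^sup>2)
            + ennreal ((cmod (?D j p))\<^sup>2) * indicator (cball 0 (real m + 1)) p \<partial>lborel)"
        proof (rule nn_integral_mono)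
          fix p
          show "ennreal (norm (\<psi> p *\<^sub>R ?D j p)) \<le> ennreal ((\<psi> p)\<^sup>2)
            + ennreal ((cmod (?D j p))\<^sup>2) * indicator (cball 0 (real m + 1)) p"
          proof (cases "norm p \<le> R")
            case True
            have "2 * (\<bar>\<psi> p\<bar> * cmod (?D j p)) \<le> \<bar>\<psi> p\<bar>\<^sup>2 + (cmod (?D j p))\<^sup>2"
              using sum_squares_bound[of "\<bar>\<psi> p\<bar>" "cmod (?D j p)"] by simp
            moreover have "0 \<le> \<bar>\<psi> p\<bar> * cmod (?D j p)" by simp
            ultimately have "norm (\<psi> p *\<^sub>R ?D j p) \<le> (\<psi> p)\<^sup>2 + (cmod (?D j p))\<^sup>2"
              unfolding norm_scaleR power2_abs by linarith
            then show ?thesis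
              using True m by (simp add: ennreal_leI flip: ennreal_plus)
          qed (simp add: R)
        qed
        also have "\<dots> = (\<integral>\<^sup>+p. ennreal ((\<psi> p)\<^sup>2) \<partial>lborel) + diff_quotient_energy w m v j"
          unfolding diff_quotient_energy_def nD by (rule nn_integral_add) measurable
        also have "\<dots> \<le> ennreal (\<integral>p. (\<psi> p)\<^sup>2 \<partial>lborel) + ennreal (c + 1)"
          by (intro add_mono le eq_refl nn_integral_eq_integral[OF i2]) simp
        also have "\<dots> = ennreal ((\<integral>p. (\<psi> p)\<^sup>2 \<partial>lborel) + (c + 1))"
          using c by simp
        finally have "cmod (?a j) \<le> (\<integral>p. (\<psi> p)\<^sup>2 \<partial>lborel) + (c + 1)"
          using c by (subst (asm) ennreal_le_iff) auto
        also have "\<dots> \<le> ?B"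
          using c mult_nonneg_nonneg[of c "\<integral>p. (\<psi> p)\<^sup>2 \<partial>lborel"] by (simp add: algebra_simps)
        finally show False using elim by simp
      qed
    qed
    then have "ennreal (c + 1) \<le> liminf (diff_quotient_energy w m v)" by (rule Liminf_bounded)
    also have "\<dots> \<le> ennreal c" unfolding c(2)[symmetric] by (rule SUP_upper) simp
    finally show False using c by simp
  qed
  then show ?thesis using c(1) by (intro exI[of _ "c + 1"]) auto
qed

text \<open>A proper subspace has smaller dimension and is a null set, which cannot contain almost
  all of a ball.\<close>

lemma subspace_contains_AE_ball:
  fixes V :: "(real ^ 'n::finite) set"
  assumes "subspace V" "AE x in lborel. x \<in> ball 0 1 \<longrightarrow> x \<in> V"
  shows "V = UNIV"
proof (rule ccontr)
  assume "V \<noteq> UNIV"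
  moreover have "span V = V" using assms(1) by (simp only: span_eq_iff)
  ultimately have "dim V < DIM(real ^ 'n)"
    using dim_eq_full[of V] dim_subset_UNIV[of V] by (metis nat_less_le)
  then have "negligible V" by (rule negligible_lowdim)
  then have "AE x in lebesgue. x \<notin> V"
    by (intro AE_not_in) (simp add: negligible_iff_null_sets)
  with AE_completion[OF assms(2)] have "AE x in lebesgue. x \<notin> (ball 0 1 :: (real ^ 'n) set)"
    by eventually_elim blast
  then have "ball 0 1 \<in> null_sets (lebesgue :: (real ^ 'n) measure)"
    by (subst AE_iff_null_sets) auto
  then have "negligible (ball 0 1 :: (real ^ 'n) set)" by (simp add: negligible_iff_null_sets)
  then show False using open_not_negligible[of "ball 0 1 :: (real ^ 'n) set"] by simp
qed

text \<open>\<open>V\<close> collects the directions whose weak derivative, as a functional on test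
  functions, obeys the affine L^2 bound; linearity makes it a subspace. Almost every x in the ball
  gives \<open>sgn x \<in> V\<close>, hence x itself after scaling, and the coordinate axes
  follow.\<close>

lemma weak_derivative_square_integrable:
  fixes f :: "real ^ 'n::finite \<Rightarrow> 'm::finite heis"
  assumes g: "\<And>i. weak_pderivative i (zcomp f k) (g i)" and fin: "ks_energy UNIV f < \<infinity>"
  shows "(\<integral>\<^sup>+x. ennreal ((cmod (g \<beta> x))\<^sup>2) \<partial>lborel) < \<infinity>"
proof -
  let ?w = "zcomp f k"
  have w: "loc_integrable ?w" using g by (auto simp: weak_pderivative_def intro: locally_integrable_imp)
  have gi: "loc_integrable (g i)" for i
    using g by (auto simp: weak_pderivative_def intro: locally_integrable_imp)
  note [measurable] = loc_integrable_measurable[OF w] loc_integrable_measurable[OF gi]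
  let ?l = "\<lambda>\<psi> i. \<integral>p. \<psi> p *\<^sub>R g i p \<partial>lborel"
  let ?N = "\<lambda>\<psi> :: real ^ 'n \<Rightarrow> real. 1 + (\<integral>p. (\<psi> p)\<^sup>2 \<partial>lborel)"
  let ?P = "\<lambda>v C. C \<ge> 0 \<and> (\<forall>\<psi>. test_function \<psi> \<longrightarrow> cmod (\<Sum>i\<in>UNIV. v $ i *\<^sub>R ?l \<psi> i) \<le> C * ?N \<psi>)"
  define V where "V = {v. \<exists>C. ?P v C}"
  have VD: "\<exists>C. ?P v C" if "v \<in> V" for v using that by (simp add: V_def)
  have VI: "v \<in> V" if "?P v C" for v C unfolding V_def mem_Collect_eq using that by (rule exI)
  have N: "?N \<psi> \<ge> 0" for \<psi> by (simp add: add_nonneg_nonneg)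
  have scale: "c *\<^sub>R v \<in> V" if v: "v \<in> V" for c v
  proof -
    obtain C where C: "?P v C" using VD[OF v] by (rule exE)
    have "(\<Sum>i\<in>UNIV. (c *\<^sub>R v) $ i *\<^sub>R ?l \<psi> i) = c *\<^sub>R (\<Sum>i\<in>UNIV. v $ i *\<^sub>R ?l \<psi> i)" for \<psi>
      by (simp add: scaleR_sum_right)
    then have "?P (c *\<^sub>R v) (\<bar>c\<bar> * C)"
      using C by (simp only: norm_scaleR) (auto simp: mult.assoc intro!: mult_left_mono)
    then show ?thesis by (rule VI)
  qed
  have "subspace V"
  proof (rule subspaceI)
    have "?P 0 0" by simp
    then show "0 \<in> V" by (rule VI)
    fix u v assume uv: "u \<in> V" "v \<in> V"
    obtain C where C1: "?P u C" using VD[OF uv(1)] by (rule exE)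
    obtain C' where C2: "?P v C'" using VD[OF uv(2)] by (rule exE)
    note C = C1 C2
    have "cmod (\<Sum>i\<in>UNIV. (u + v) $ i *\<^sub>R ?l \<psi> i) \<le> (C + C') * ?N \<psi>" if \<psi>: "test_function \<psi>" for \<psi>
    proof -
      have "(\<Sum>i\<in>UNIV. (u + v) $ i *\<^sub>R ?l \<psi> i)
          = (\<Sum>i\<in>UNIV. u $ i *\<^sub>R ?l \<psi> i) + (\<Sum>i\<in>UNIV. v $ i *\<^sub>R ?l \<psi> i)"
        by (simp add: scaleR_add_left sum.distrib)
      also have "cmod \<dots> \<le> C * ?N \<psi> + C' * ?N \<psi>"
        using C \<psi> by (intro norm_triangle_le add_mono) auto
      finally show ?thesis by (simp only: distrib_right)
    qed
    then have "?P (u + v) (C + C')" using C by auto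
    then show "u + v \<in> V" by (rule VI)
  qed (rule scale)
  moreover have "AE x in lborel. x \<in> ball 0 1 \<longrightarrow> x \<in> V"
    using liminf_diff_quotient_energy_finite[OF loc_integrable_measurable[OF w] fin]
  proof eventually_elim
    case (elim x)
    show ?case
    proof
      assume "x \<in> ball 0 1"
      then have "sgn x \<in> V"
        using diff_quotient_energy_dual[OF g norm_sgn_le_1, of x] elim by (simp add: V_def)
      from scale[OF this, of "norm x"] show "x \<in> V" by (cases "x = 0") (auto simp: sgn_div_norm)
    qed
  qed
  ultimately have "axis \<beta> 1 \<in> V" using subspace_contains_AE_ball by blast
  from VD[OF this] obtain C where C: "?P (axis \<beta> 1) C" by (rule exE)
  have "(\<Sum>i\<in>UNIV. (axis \<beta> 1 :: real ^ 'n) $ i *\<^sub>R ?l \<psi> i) = ?l \<psi> \<beta>" for \<psi>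
    by (simp add: axis_def if_distrib[of "\<lambda>c. c *\<^sub>R _"] cong: if_cong)
  \<comment> \<open>\<open>C\<close> may be 0, while \<open>square_integrable_dual\<close> asks for
    a positive constant.\<close>
  then have bd: "cmod (?l \<psi> \<beta>) \<le> (C + 1) * ?N \<psi>" if "test_function \<psi>" for \<psi>
    using C that N[of \<psi>] by (auto simp: distrib_right intro: order_trans)
  have part: "(\<integral>\<^sup>+x. ennreal ((T (g \<beta> x))\<^sup>2) \<partial>lborel) \<le> ennreal (4 * (C + 1)\<^sup>2)"
    if T: "bounded_linear T" "\<And>z. \<bar>T z\<bar> \<le> cmod z" for T :: "complex \<Rightarrow> real"
  proof (rule square_integrable_dual)
    interpret bounded_linear T by (rule T)
    have "set_integrable lborel (cball 0 R) (\<lambda>x. T (g \<beta> x))" for R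
      using gi[of \<beta>] integrable_bounded_linear[OF T(1), of lborel "\<lambda>x. indicator (cball 0 R) x *\<^sub>R g \<beta> x"]
      by (simp add: loc_integrable_def set_integrable_def scaleR)
    then show "loc_integrable (\<lambda>x. T (g \<beta> x))" by (simp add: loc_integrable_def)
    show "C + 1 > 0" using C by simp
    fix \<psi> :: "real ^ 'n \<Rightarrow> real" assume \<psi>: "test_function \<psi>"
    have "(\<integral>x. \<psi> x * T (g \<beta> x) \<partial>lborel) = T (?l \<psi> \<beta>)"
      using integral_bounded_linear[OF T(1) integrable_test_mult(1)[OF gi[of \<beta>] \<psi>]]
      by (simp add: scaleR)
    then show "\<bar>\<integral>x. \<psi> x * T (g \<beta> x) \<partial>lborel\<bar> \<le> (C + 1) * ?N \<psi>"
      using T(2)[of "?l \<psi> \<beta>"] bd[OF \<psi>] by simp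
  qed
  have "(\<integral>\<^sup>+x. ennreal ((cmod (g \<beta> x))\<^sup>2) \<partial>lborel)
      = (\<integral>\<^sup>+x. ennreal ((Re (g \<beta> x))\<^sup>2) + ennreal ((Im (g \<beta> x))\<^sup>2) \<partial>lborel)"
    by (simp add: cmod_power2)
  also have "\<dots> = (\<integral>\<^sup>+x. ennreal ((Re (g \<beta> x))\<^sup>2) \<partial>lborel) + (\<integral>\<^sup>+x. ennreal ((Im (g \<beta> x))\<^sup>2) \<partial>lborel)"
    by (rule nn_integral_add) measurable
  also have "\<dots> \<le> ennreal (4 * (C + 1)\<^sup>2) + ennreal (4 * (C + 1)\<^sup>2)"
    by (intro add_mono part bounded_linear_Re bounded_linear_Im abs_Re_le_cmod abs_Im_le_cmod)
  also have "\<dots> < \<infinity>" by simp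
  finally show ?thesis .
qed

lemma grad_norm_sq: "(grad_norm Dz x)\<^sup>2 = (\<Sum>k\<in>UNIV. \<Sum>\<beta>\<in>UNIV. (cmod (Dz k \<beta> x))\<^sup>2)"
  by (simp add: grad_norm_def comp_grad_sq_def sum_nonneg)

lemma finite_energy_gradient:
  fixes f :: "real ^ 'n::finite \<Rightarrow> 'm::finite heis"
  assumes "weak_gradient f Dz" "W12 UNIV f"
  shows "(\<integral>\<^sup>+x. ennreal ((grad_norm Dz x)\<^sup>2) \<partial>lborel) < \<infinity>"
proof -
  have g: "weak_pderivative \<beta> (zcomp f k) (Dz k \<beta>)" for k \<beta>
    using assms(1) by (simp add: weak_gradient_def)
  have [measurable]: "Dz k \<beta> \<in> borel_measurable borel" for k \<beta>
    using g[of \<beta> k] by (auto simp: weak_pderivative_def intro: loc_integrable_measurable locally_integrable_imp)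
  have "(\<integral>\<^sup>+x. ennreal ((grad_norm Dz x)\<^sup>2) \<partial>lborel)
      = (\<integral>\<^sup>+x. (\<Sum>k\<in>UNIV. \<Sum>\<beta>\<in>UNIV. ennreal ((cmod (Dz k \<beta> x))\<^sup>2)) \<partial>lborel)"
    by (simp add: grad_norm_sq sum_nonneg)
  also have "\<dots> = (\<Sum>k\<in>UNIV. \<Sum>\<beta>\<in>UNIV. \<integral>\<^sup>+x. ennreal ((cmod (Dz k \<beta> x))\<^sup>2) \<partial>lborel)"
    by (subst nn_integral_sum, measurable, intro sum.cong refl nn_integral_sum) measurable
  also have "\<dots> < \<infinity>"
    using weak_derivative_square_integrable[OF g] assms(2) by (auto simp: W12_def less_top)
  finally show ?thesis .
qed

section \<open>The radial domain variation\<close>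

text \<open>The derivative is taken along x and not along x / |x|, so nothing is singular at the
  origin.\<close>

definition radial_part :: "('m::finite \<Rightarrow> 'n::finite \<Rightarrow> real ^ 'n \<Rightarrow> complex) \<Rightarrow> real ^ 'n \<Rightarrow> real" where
  "radial_part Dz x = (\<Sum>k\<in>UNIV. (cmod (\<Sum>\<beta>\<in>UNIV. of_real (x $ \<beta>) * Dz k \<beta> x))\<^sup>2)"

lemma radial_part_nonneg: "radial_part Dz x \<ge> 0"
  by (simp add: radial_part_def sum_nonneg)

lemma radial_part_le: "radial_part Dz x \<le> (norm x)\<^sup>2 * (grad_norm Dz x)\<^sup>2"
proof -
  have nx: "(norm x)\<^sup>2 = (\<Sum>\<beta>\<in>UNIV. \<bar>x $ \<beta>\<bar>\<^sup>2)"
    using norm_sq_eq_sum[of x 0] by (simp add: power2_eq_square)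
  have "(cmod (\<Sum>\<beta>\<in>UNIV. of_real (x $ \<beta>) * Dz k \<beta> x))\<^sup>2
      \<le> (norm x)\<^sup>2 * (\<Sum>\<beta>\<in>UNIV. (cmod (Dz k \<beta> x))\<^sup>2)" for k
  proof -
    have "cmod (\<Sum>\<beta>\<in>UNIV. of_real (x $ \<beta>) * Dz k \<beta> x) \<le> (\<Sum>\<beta>\<in>UNIV. \<bar>x $ \<beta>\<bar> * cmod (Dz k \<beta> x))"
      by (rule order_trans[OF norm_sum]) (simp add: norm_mult)
    then have "(cmod (\<Sum>\<beta>\<in>UNIV. of_real (x $ \<beta>) * Dz k \<beta> x))\<^sup>2
        \<le> (\<Sum>\<beta>\<in>UNIV. \<bar>x $ \<beta>\<bar> * cmod (Dz k \<beta> x))\<^sup>2"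
      by (rule power_mono) simp
    also have "\<dots> \<le> (\<Sum>\<beta>\<in>UNIV. \<bar>x $ \<beta>\<bar>\<^sup>2) * (\<Sum>\<beta>\<in>UNIV. (cmod (Dz k \<beta> x))\<^sup>2)"
      by (rule Cauchy_Schwarz_ineq_sum)
    finally show ?thesis by (simp only: nx)
  qed
  then have "radial_part Dz x \<le> (\<Sum>k\<in>UNIV. (norm x)\<^sup>2 * (\<Sum>\<beta>\<in>UNIV. (cmod (Dz k \<beta> x))\<^sup>2))"
    unfolding radial_part_def by (rule sum_mono)
  then show ?thesis by (simp only: grad_norm_sq sum_distrib_left)
qed

section \<open>Measurability and local integrability of the quadratic terms\<close>

lemma measurable_cnj [measurable]: "cnj \<in> borel_measurable borel"
  by (intro borel_measurable_continuous_onI continuous_intros)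

lemma sets_borel_balls [measurable]: "ball a r \<in> sets borel" "cball a r \<in> sets borel"
  by simp_all

lemma loc_integrable_bound:
  assumes e: "loc_integrable e" and [measurable]: "u \<in> borel_measurable borel"
    and le: "\<And>x. norm (u x) \<le> norm (e x)"
  shows "loc_integrable u"
  unfolding loc_integrable_def
proof
  fix R
  show "set_integrable lborel (cball 0 R) u"
    unfolding set_integrable_def
  proof (rule Bochner_Integration.integrable_bound)
    show "integrable lborel (\<lambda>x. indicator (cball 0 R) x *\<^sub>R e x)"
      using e by (simp add: loc_integrable_def set_integrable_def)
    show "(\<lambda>x. indicator (cball 0 R) x *\<^sub>R u x) \<in> borel_measurable lborel" by measurable
    show "AE x in lborel. norm (indicator (cball 0 R) x *\<^sub>R u x) \<le> norm (indicator (cball 0 R) x *\<^sub>R e x)"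
      by (rule AE_I2) (simp add: le mult_left_mono)
  qed
qed

lemma comp_le_grad_norm_sq:
  shows "(cmod (Dz k \<beta> x))\<^sup>2 \<le> (grad_norm Dz x)\<^sup>2"
    and "comp_grad_sq Dz k x \<le> (grad_norm Dz x)\<^sup>2"
    and "cmod (Dz k \<beta> x * cnj (Dz k \<gamma> x)) \<le> (grad_norm Dz x)\<^sup>2"
proof -
  have c: "comp_grad_sq Dz k x \<le> (grad_norm Dz x)\<^sup>2" for k
    unfolding grad_norm_sq comp_grad_sq_def
    by (rule member_le_sum[of k UNIV "\<lambda>k. \<Sum>\<beta>\<in>UNIV. (cmod (Dz k \<beta> x))\<^sup>2"]) (auto simp: sum_nonneg)
  have d: "(cmod (Dz k \<beta> x))\<^sup>2 \<le> comp_grad_sq Dz k x" for k \<beta>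
    unfolding comp_grad_sq_def
    by (rule member_le_sum[of \<beta> UNIV "\<lambda>\<beta>. (cmod (Dz k \<beta> x))\<^sup>2"]) auto
  show "comp_grad_sq Dz k x \<le> (grad_norm Dz x)\<^sup>2" by (rule c)
  show *: "(cmod (Dz k \<beta> x))\<^sup>2 \<le> (grad_norm Dz x)\<^sup>2" for \<beta> by (rule order_trans[OF d c])
  have "2 * (cmod (Dz k \<beta> x) * cmod (Dz k \<gamma> x)) \<le> (cmod (Dz k \<beta> x))\<^sup>2 + (cmod (Dz k \<gamma> x))\<^sup>2"
    using sum_squares_bound[of "cmod (Dz k \<beta> x)" "cmod (Dz k \<gamma> x)"] by simp
  also have "\<dots> \<le> (grad_norm Dz x)\<^sup>2 + (grad_norm Dz x)\<^sup>2" by (intro add_mono *)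
  finally show "cmod (Dz k \<beta> x * cnj (Dz k \<gamma> x)) \<le> (grad_norm Dz x)\<^sup>2" by (simp add: norm_mult)
qed

locale weak_solution_gradient =
  fixes Dz :: "'m::finite \<Rightarrow> 'n::finite \<Rightarrow> real ^ 'n \<Rightarrow> complex"
  assumes measurable_Dz [measurable]: "\<And>k \<beta>. Dz k \<beta> \<in> borel_measurable borel"
    and energy_loc: "loc_integrable (\<lambda>x. (grad_norm Dz x)\<^sup>2)"
    and sol: "weak_solution Dz"
begin

lemma measurable_grad_norm [measurable]: "grad_norm Dz \<in> borel_measurable borel"
  unfolding grad_norm_def[abs_def] comp_grad_sq_def by measurable

lemma loc_integrable_products:
  "loc_integrable (\<lambda>x. Dz k \<beta> x * cnj (Dz k \<gamma> x))"
  "loc_integrable (\<lambda>x. complex_of_real (comp_grad_sq Dz k x))"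
proof -
  show "loc_integrable (\<lambda>x. Dz k \<beta> x * cnj (Dz k \<gamma> x))"
  proof (rule loc_integrable_bound[OF energy_loc])
    show "norm (Dz k \<beta> x * cnj (Dz k \<gamma> x)) \<le> norm ((grad_norm Dz x)\<^sup>2)" for x
      using comp_le_grad_norm_sq(3)[of Dz k \<beta> x \<gamma>] by (simp only: real_norm_def abs_power2)
  qed measurable
  have "\<bar>comp_grad_sq Dz k x\<bar> \<le> (grad_norm Dz x)\<^sup>2" for x
    using comp_le_grad_norm_sq(2)[of Dz k x] by (simp add: comp_grad_sq_def sum_nonneg)
  then show "loc_integrable (\<lambda>x. complex_of_real (comp_grad_sq Dz k x))"
    by (intro loc_integrable_bound[OF energy_loc])
      (simp_all only: norm_of_real real_norm_def abs_power2, simp add: comp_grad_sq_def[abs_def])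
qed

definition variation_density :: "'n \<Rightarrow> (real ^ 'n \<Rightarrow> real) \<Rightarrow> real ^ 'n \<Rightarrow> complex" where
  "variation_density \<gamma> \<phi> x = (\<Sum>k\<in>UNIV. of_real (comp_grad_sq Dz k x) * of_real (pderivative \<gamma> \<phi> x)
            - 2 * (\<Sum>\<beta>\<in>UNIV. Dz k \<beta> x * cnj (Dz k \<gamma> x) * of_real (pderivative \<beta> \<phi> x)))"

text \<open>Integrability is what permits adding the equations for different \<gamma> and splitting
  them into real and imaginary parts; the value 0 of the integral alone would not.\<close>

lemma variation_density:
  assumes "test_function \<phi>"
  shows "integrable lborel (variation_density \<gamma> \<phi>)" "(\<integral>x. variation_density \<gamma> \<phi> x \<partial>lborel) = 0"
proof -
  have "integrable lborel (\<lambda>x. of_real (comp_grad_sq Dz k x) * complex_of_real (pderivative \<gamma> \<phi> x))" for k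
    using integrable_test_mult(2)[OF loc_integrable_products(2) assms, of \<gamma>]
    by (simp add: scaleR_conv_of_real mult.commute)
  moreover have "integrable lborel (\<lambda>x. Dz k \<beta> x * cnj (Dz k \<gamma> x) * complex_of_real (pderivative \<beta> \<phi> x))" for k \<beta>
    using integrable_test_mult(2)[OF loc_integrable_products(1) assms, of \<beta>]
    by (simp add: scaleR_conv_of_real mult.commute)
  ultimately show "integrable lborel (variation_density \<gamma> \<phi>)"
    unfolding variation_density_def[abs_def]
    by (intro Bochner_Integration.integrable_sum Bochner_Integration.integrable_diff integrable_mult_right)
  show "(\<integral>x. variation_density \<gamma> \<phi> x \<partial>lborel) = 0"
    using sol assms by (simp add: weak_solution_def variation_density_def)
qed

text \<open>The Pohozaev identity: the variation field is \<open>\<xi>(x) = h(|x|\<^sup>2) x\<close>.\<close>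

lemma radial_identity:
  fixes h h' :: "real \<Rightarrow> real"
  assumes h: "\<And>s. s \<ge> 0 \<Longrightarrow> (h has_real_derivative h' s) (at s)"
    and sm: "smooth (\<lambda>x :: real ^ 'n. h ((norm x)\<^sup>2))"
    and R: "\<And>x :: real ^ 'n. norm x \<ge> R \<Longrightarrow> h ((norm x)\<^sup>2) = 0"
  defines "G \<equiv> \<lambda>x. (grad_norm Dz x)\<^sup>2 * ((real CARD('n) - 2) * h ((norm x)\<^sup>2)
      + 2 * ((norm x)\<^sup>2 * h' ((norm x)\<^sup>2))) - 4 * (h' ((norm x)\<^sup>2) * radial_part Dz x)"
  shows "integrable lborel G" "(\<integral>x. G x \<partial>lborel) = 0"
proof -
  define \<phi> where "\<phi> \<gamma> x = x $ \<gamma> * h ((norm x)\<^sup>2)" for \<gamma> and x :: "real ^ 'n"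
  have test: "test_function (\<phi> \<gamma>)" for \<gamma>
    unfolding \<phi>_def
    by (rule test_functionI[where R = R]) (auto intro: smooth_mult smooth_nth sm simp: R)
  have pd: "pderivative \<beta> (\<phi> \<gamma>) x
      = (if \<beta> = \<gamma> then h ((norm x)\<^sup>2) else 0) + 2 * h' ((norm x)\<^sup>2) * (x $ \<beta> * x $ \<gamma>)" for \<beta> \<gamma> x
  proof -
    have "pderivative \<beta> (\<phi> \<gamma>) x = pderivative \<beta> (\<lambda>x. x $ \<gamma>) x * h ((norm x)\<^sup>2)
        + x $ \<gamma> * pderivative \<beta> (\<lambda>x. h ((norm x)\<^sup>2)) x"
      unfolding \<phi>_def[abs_def]
      by (rule pderivative_mult[OF smooth_differentiable[OF smooth_nth] smooth_differentiable[OF sm]])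
    then show ?thesis
      using pderivative_radial[OF h, of x \<beta>] by (simp add: pderivative_nth)
  qed
  have sum_eq: "(\<Sum>\<gamma>\<in>UNIV. variation_density \<gamma> (\<phi> \<gamma>) x) = of_real (G x)" for x
  proof -
    let ?h = "complex_of_real (h ((norm x)\<^sup>2))" and ?h' = "complex_of_real (h' ((norm x)\<^sup>2))"
    let ?X = "\<lambda>\<beta>. complex_of_real (x $ \<beta>)"
    have nx: "(\<Sum>\<gamma>\<in>UNIV. ?X \<gamma> * ?X \<gamma>) = of_real ((norm x)\<^sup>2)"
      by (simp add: power2_norm_eq_inner inner_vec_def)
    have sq: "(\<Sum>\<gamma>\<in>UNIV. Dz k \<gamma> x * cnj (Dz k \<gamma> x)) = of_real (comp_grad_sq Dz k x)" for k
      by (simp only: comp_grad_sq_def of_real_sum complex_norm_square)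
    \<comment> \<open>The double sum is a linear form in the \<open>Dz k \<beta> x\<close> times its
      conjugate, hence real. Thus the complex system yields a real identity.\<close>
    have rad: "(\<Sum>\<gamma>\<in>UNIV. \<Sum>\<beta>\<in>UNIV. Dz k \<beta> x * cnj (Dz k \<gamma> x) * (?X \<beta> * ?X \<gamma>))
        = of_real ((cmod (\<Sum>\<beta>\<in>UNIV. ?X \<beta> * Dz k \<beta> x))\<^sup>2)" for k
      unfolding complex_norm_square cnj_sum sum_product
      by (subst sum.swap) (simp add: mult_ac)
    have diag: "(\<Sum>\<gamma>\<in>UNIV. \<Sum>\<beta>\<in>UNIV. Dz k \<beta> x * cnj (Dz k \<gamma> x) * (if \<beta> = \<gamma> then ?h else 0))
        = of_real (comp_grad_sq Dz k x) * ?h" for k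
      by (simp add: if_distrib[of "(*) _"] sq[symmetric] sum_distrib_right cong: if_cong)
    have cp: "complex_of_real (pderivative \<beta> (\<phi> \<gamma>) x)
        = (if \<beta> = \<gamma> then ?h else 0) + 2 * ?h' * (?X \<beta> * ?X \<gamma>)" for \<beta> \<gamma>
      by (simp add: pd)
    have "(\<Sum>\<gamma>\<in>UNIV. variation_density \<gamma> (\<phi> \<gamma>) x)
      = (\<Sum>k\<in>UNIV. \<Sum>\<gamma>\<in>UNIV. of_real (comp_grad_sq Dz k x) * (?h + 2 * ?h' * (?X \<gamma> * ?X \<gamma>))
          - 2 * (\<Sum>\<beta>\<in>UNIV. Dz k \<beta> x * cnj (Dz k \<gamma> x) * ((if \<beta> = \<gamma> then ?h else 0) + 2 * ?h' * (?X \<beta> * ?X \<gamma>))))"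
      unfolding variation_density_def cp by (subst sum.swap) simp
    also have "\<dots> = (\<Sum>k\<in>UNIV. of_real (comp_grad_sq Dz k x) * (of_nat CARD('n) * ?h + 2 * ?h' * of_real ((norm x)\<^sup>2))
        - 2 * (of_real (comp_grad_sq Dz k x) * ?h + 2 * ?h' * of_real ((cmod (\<Sum>\<beta>\<in>UNIV. ?X \<beta> * Dz k \<beta> x))\<^sup>2)))"
    proof (rule sum.cong[OF refl])
      fix k
      have a: "(\<Sum>\<gamma>\<in>(UNIV :: 'n set). of_real (comp_grad_sq Dz k x) * (?h + 2 * ?h' * (?X \<gamma> * ?X \<gamma>)))
          = of_real (comp_grad_sq Dz k x) * (of_nat CARD('n) * ?h + 2 * ?h' * of_real ((norm x)\<^sup>2))"
        unfolding nx[symmetric] sum_distrib_left[symmetric] sum.distrib by simp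
      have b: "(\<Sum>\<gamma>\<in>UNIV. 2 * (\<Sum>\<beta>\<in>UNIV. Dz k \<beta> x * cnj (Dz k \<gamma> x) * ((if \<beta> = \<gamma> then ?h else 0) + 2 * ?h' * (?X \<beta> * ?X \<gamma>))))
          = 2 * (of_real (comp_grad_sq Dz k x) * ?h + 2 * ?h' * of_real ((cmod (\<Sum>\<beta>\<in>UNIV. ?X \<beta> * Dz k \<beta> x))\<^sup>2))"
        unfolding rad[symmetric] diag[symmetric]
      proof -
        have "c * (d + 2 * ?h' * y) = c * d + 2 * ?h' * (c * y)" for c d y by (simp add: algebra_simps)
        then show "(\<Sum>\<gamma>\<in>UNIV. 2 * (\<Sum>\<beta>\<in>UNIV. Dz k \<beta> x * cnj (Dz k \<gamma> x) * ((if \<beta> = \<gamma> then ?h else 0) + 2 * ?h' * (?X \<beta> * ?X \<gamma>))))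
          = 2 * ((\<Sum>\<gamma>\<in>UNIV. \<Sum>\<beta>\<in>UNIV. Dz k \<beta> x * cnj (Dz k \<gamma> x) * (if \<beta> = \<gamma> then ?h else 0))
            + 2 * ?h' * (\<Sum>\<gamma>\<in>UNIV. \<Sum>\<beta>\<in>UNIV. Dz k \<beta> x * cnj (Dz k \<gamma> x) * (?X \<beta> * ?X \<gamma>)))"
          by (simp only: sum.distrib sum_distrib_left[symmetric])
      qed
      show "(\<Sum>\<gamma>\<in>UNIV. of_real (comp_grad_sq Dz k x) * (?h + 2 * ?h' * (?X \<gamma> * ?X \<gamma>))
          - 2 * (\<Sum>\<beta>\<in>UNIV. Dz k \<beta> x * cnj (Dz k \<gamma> x) * ((if \<beta> = \<gamma> then ?h else 0) + 2 * ?h' * (?X \<beta> * ?X \<gamma>))))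
        = of_real (comp_grad_sq Dz k x) * (of_nat CARD('n) * ?h + 2 * ?h' * of_real ((norm x)\<^sup>2))
        - 2 * (of_real (comp_grad_sq Dz k x) * ?h + 2 * ?h' * of_real ((cmod (\<Sum>\<beta>\<in>UNIV. ?X \<beta> * Dz k \<beta> x))\<^sup>2))"
        unfolding sum_subtractf a b ..
    qed
    also have "\<dots> = of_real (\<Sum>k\<in>UNIV. comp_grad_sq Dz k x * (real CARD('n) * h ((norm x)\<^sup>2) + 2 * h' ((norm x)\<^sup>2) * (norm x)\<^sup>2)
        - 2 * (comp_grad_sq Dz k x * h ((norm x)\<^sup>2) + 2 * h' ((norm x)\<^sup>2) * (cmod (\<Sum>\<beta>\<in>UNIV. ?X \<beta> * Dz k \<beta> x))\<^sup>2))"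
      by (simp only: of_real_sum of_real_diff of_real_mult of_real_add of_real_of_nat_eq of_real_numeral)
    also have "(\<Sum>k\<in>UNIV. comp_grad_sq Dz k x * (real CARD('n) * h ((norm x)\<^sup>2) + 2 * h' ((norm x)\<^sup>2) * (norm x)\<^sup>2)
        - 2 * (comp_grad_sq Dz k x * h ((norm x)\<^sup>2) + 2 * h' ((norm x)\<^sup>2) * (cmod (\<Sum>\<beta>\<in>UNIV. ?X \<beta> * Dz k \<beta> x))\<^sup>2))
      = (\<Sum>k\<in>UNIV. comp_grad_sq Dz k x * ((real CARD('n) - 2) * h ((norm x)\<^sup>2) + 2 * ((norm x)\<^sup>2 * h' ((norm x)\<^sup>2)))
        - 4 * (h' ((norm x)\<^sup>2) * (cmod (\<Sum>\<beta>\<in>UNIV. ?X \<beta> * Dz k \<beta> x))\<^sup>2))"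
      by (rule sum.cong) (simp_all add: algebra_simps)
    also have "\<dots> = G x"
      by (simp add: G_def radial_part_def grad_norm_sq comp_grad_sq_def sum_subtractf
          sum_distrib_left sum_distrib_right)
    finally show ?thesis .
  qed
  have i: "integrable lborel (\<lambda>x. \<Sum>\<gamma>\<in>UNIV. variation_density \<gamma> (\<phi> \<gamma>) x)"
    by (intro Bochner_Integration.integrable_sum variation_density(1) test)
  then have "integrable lborel (\<lambda>x. complex_of_real (G x))" by (simp only: sum_eq)
  then show "integrable lborel G" by (simp only: complex_of_real_integrable_eq)
  have "(\<integral>x. (\<Sum>\<gamma>\<in>UNIV. variation_density \<gamma> (\<phi> \<gamma>) x) \<partial>lborel) = 0"
    by (subst Bochner_Integration.integral_sum) (simp_all add: variation_density test)
  then have "(\<integral>x. complex_of_real (G x) \<partial>lborel) = 0" by (simp only: sum_eq)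
  then show "(\<integral>x. G x \<partial>lborel) = 0" by simp
qed

lemma AE_zero_of_ball_integrals:
  assumes "\<And>r. (\<integral>\<^sup>+x\<in>ball 0 r. ennreal ((grad_norm Dz x)\<^sup>2) \<partial>lborel) = 0"
  shows "AE x in lborel. grad_norm Dz x = 0"
proof -
  have "AE x in lborel. \<forall>n::nat. ennreal ((grad_norm Dz x)\<^sup>2) * indicator (ball 0 (real n)) x = 0"
    unfolding AE_all_countable
  proof
    fix n :: nat
    have "(\<lambda>x. ennreal ((grad_norm Dz x)\<^sup>2) * indicator (ball 0 (real n)) x) \<in> borel_measurable lborel"
      by measurable
    then show "AE x in lborel. ennreal ((grad_norm Dz x)\<^sup>2) * indicator (ball 0 (real n)) x = 0"
      using assms[of "real n"] nn_integral_0_iff_AE by blast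
  qed
  then show ?thesis
  proof eventually_elim
    case (elim x)
    obtain n :: nat where "norm x < real n" using reals_Archimedean2 by blast
    then show ?case using elim[rule_format, of n] by simp
  qed
qed

section \<open>Finite energy in dimensions other than 2\<close>

lemma cutoff_deriv_scaled:
  "((\<lambda>s. cutoff (s / R\<^sup>2)) has_real_derivative cutoff' (s / R\<^sup>2) / R\<^sup>2) (at s)"
proof -
  have "((\<lambda>s. cutoff (s / R\<^sup>2)) has_real_derivative cutoff' (s / R\<^sup>2) * (1 / R\<^sup>2)) (at s)"
    by (intro DERIV_chain2[OF cutoff_deriv] DERIV_cdivide DERIV_ident)
  then show ?thesis by simp
qed

text \<open>For h(s) = cutoff(s / R^2) the product s * h'(s) is \<sigma> * cutoff'(\<sigma>) with
  \<sigma> = s / R^2, so this bound controls the derivative terms uniformly in R. The 4 is the right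
  end of the interval outside which \<open>cutoff'\<close> vanishes.\<close>

lemma scaled_cutoff'_bound: "\<bar>s * cutoff' s\<bar> \<le> 4 * cutoff_bound"
proof (cases "s \<le> 1 \<or> s \<ge> 4")
  case True
  then show ?thesis using cutoff_bound_pos by (simp add: cutoff'_zero)
next
  case False
  have "\<bar>cutoff' s\<bar> \<le> cutoff_bound" using cutoff'_ge[of s] cutoff'_nonpos[of s] by simp
  then show ?thesis using False by (simp add: abs_mult mult_mono)
qed

lemma finite_energy_vanishing:
  assumes fin: "integrable lborel (\<lambda>x. (grad_norm Dz x)\<^sup>2)" and n: "CARD('n) \<noteq> 2"
  shows "AE x in lborel. grad_norm Dz x = 0"
proof -
  let ?e = "\<lambda>x. (grad_norm Dz x)\<^sup>2"
  let ?n = "real CARD('n) - 2"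
  define G where "G j x = ?e x * (?n * cutoff ((norm x)\<^sup>2 / (real (Suc j))\<^sup>2)
      + 2 * ((norm x)\<^sup>2 * (cutoff' ((norm x)\<^sup>2 / (real (Suc j))\<^sup>2) / (real (Suc j))\<^sup>2)))
      - 4 * (cutoff' ((norm x)\<^sup>2 / (real (Suc j))\<^sup>2) / (real (Suc j))\<^sup>2 * radial_part Dz x)" for j x
  have G: "integrable lborel (G j)" "(\<integral>x. G j x \<partial>lborel) = 0" for j
    using radial_identity[of "\<lambda>s. cutoff (s / (real (Suc j))\<^sup>2)" "\<lambda>s. cutoff' (s / (real (Suc j))\<^sup>2) / (real (Suc j))\<^sup>2" "2 * real (Suc j)",
        OF cutoff_deriv_scaled] smooth_ballcut[of "real (Suc j)"] ballcut_zero[of "real (Suc j)"]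
    unfolding ballcut_def[abs_def] G_def[abs_def] by auto
  have lim: "(\<lambda>j. \<integral>x. G j x \<partial>lborel) \<longlonglongrightarrow> (\<integral>x. ?n * ?e x \<partial>lborel)"
  proof (rule integral_dominated_convergence)
    \<comment> \<open>24 = 2 * 4 + 4 * 4, from the term with |x|^2 * h' and the term with
      \<open>radial_part\<close>, each estimated by \<open>scaled_cutoff'_bound\<close>.\<close>
    show "integrable lborel (\<lambda>x. (\<bar>?n\<bar> + 24 * cutoff_bound) * ?e x)" using fin by simp
    show "AE x in lborel. (\<lambda>j. G j x) \<longlonglongrightarrow> ?n * ?e x"
    \<comment> \<open>For large j the point x lies where the cutoff is constantly 1; there the
      derivative terms are 0 and the integrand already equals its limit.\<close>
    proof (rule AE_I2, rule tendsto_eventually)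
      fix x :: "real ^ 'n"
      obtain N :: nat where N: "norm x \<le> real N" using real_arch_simple by blast
      show "\<forall>\<^sub>F j in sequentially. G j x = ?n * ?e x"
      proof (rule eventually_sequentiallyI[of N])
        fix j assume "N \<le> j"
        then have "norm x \<le> real (Suc j)" using N by linarith
        then have "(norm x)\<^sup>2 / (real (Suc j))\<^sup>2 \<le> 1" by (simp add: power_mono divide_le_eq)
        from cutoff_one[OF this] cutoff'_zero[OF disjI1[OF this]]
        show "G j x = ?n * ?e x" unfolding G_def by (simp only:) simp
      qed
    qed
    show "AE x in lborel. norm (G j x) \<le> (\<bar>?n\<bar> + 24 * cutoff_bound) * ?e x" for j
    proof (rule AE_I2)
      fix x :: "real ^ 'n"
      let ?r = "(real (Suc j))\<^sup>2"
      define s where "s = (norm x)\<^sup>2 / ?r"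
      have r: "?r > 0" by simp
      define q where "q = radial_part Dz x / ?r"
      have q: "0 \<le> q" "q \<le> s * ?e x"
        using radial_part_le[of Dz x] r by (simp_all add: q_def s_def radial_part_nonneg divide_right_mono)
      have Geq: "G j x = ?n * cutoff s * ?e x + 2 * (s * cutoff' s) * ?e x - 4 * (cutoff' s * q)"
        by (simp add: G_def s_def q_def algebra_simps)
      have "\<bar>?n * cutoff s * ?e x\<bar> \<le> \<bar>?n\<bar> * 1 * ?e x"
        unfolding abs_mult using cutoff_le[of s] cutoff_nonneg[of s]
        by (intro mult_mono) auto
      moreover have "\<bar>2 * (s * cutoff' s) * ?e x\<bar> \<le> 2 * (4 * cutoff_bound) * ?e x"
        unfolding abs_mult[of "2 * _"] abs_mult[of 2] using scaled_cutoff'_bound[of s]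
        by (intro mult_mono) (auto simp: cutoff_bound_pos less_imp_le)
      moreover have "\<bar>4 * (cutoff' s * q)\<bar> \<le> 16 * cutoff_bound * ?e x"
      proof -
        have "\<bar>cutoff' s * q\<bar> \<le> \<bar>cutoff' s\<bar> * (s * ?e x)"
          unfolding abs_mult using q by (intro mult_left_mono) auto
        also have "\<dots> \<le> \<bar>s * cutoff' s\<bar> * ?e x"
          unfolding abs_mult by (simp add: s_def mult_ac)
        also have "\<dots> \<le> 4 * cutoff_bound * ?e x"
          using scaled_cutoff'_bound[of s] by (intro mult_right_mono) auto
        finally show ?thesis by simp
      qed
      ultimately have "\<bar>G j x\<bar> \<le> \<bar>?n\<bar> * 1 * ?e x + 2 * (4 * cutoff_bound) * ?e x + 16 * cutoff_bound * ?e x"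
        unfolding Geq by linarith
      then show "norm (G j x) \<le> (\<bar>?n\<bar> + 24 * cutoff_bound) * ?e x" by (simp add: algebra_simps)
    qed
  qed (use G(1) in auto)
  then have "(\<integral>x. ?n * ?e x \<partial>lborel) = 0"
    using lim by (simp only: G(2) LIMSEQ_const_iff)
  \<comment> \<open>The coefficient n - 2 is -1 for n = 1; only its being nonzero counts.\<close>
  then have "(\<integral>x. ?e x \<partial>lborel) = 0" using n by simp
  then have "AE x in lborel. ?e x = 0"
    using integral_nonneg_eq_0_iff_AE[OF fin] by simp
  then show ?thesis by simp
qed

section \<open>Vanishing under the growth condition\<close>

definition ball_energy :: "real \<Rightarrow> real" where
  "ball_energy r = (\<integral>x. indicator (ball 0 r) x * (grad_norm Dz x)\<^sup>2 \<partial>lborel)"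

lemma ball_energy_integrable: "integrable lborel (\<lambda>x. indicator (ball 0 r) x * (grad_norm Dz x)\<^sup>2)"
proof (rule Bochner_Integration.integrable_bound)
  show "integrable lborel (\<lambda>x. indicator (cball 0 r) x *\<^sub>R (grad_norm Dz x)\<^sup>2)"
    using energy_loc by (simp add: loc_integrable_def set_integrable_def)
  show "AE x in lborel. norm (indicator (ball 0 r) x * (grad_norm Dz x)\<^sup>2)
      \<le> norm (indicator (cball 0 r) x *\<^sub>R (grad_norm Dz x)\<^sup>2)"
    by (rule AE_I2) (simp add: indicator_def)
qed measurable

lemma ball_energy_eq: "(\<integral>\<^sup>+x\<in>ball 0 r. ennreal ((grad_norm Dz x)\<^sup>2) \<partial>lborel) = ennreal (ball_energy r)"
proof -
  have "(\<integral>\<^sup>+x\<in>ball 0 r. ennreal ((grad_norm Dz x)\<^sup>2) \<partial>lborel)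
      = (\<integral>\<^sup>+x. ennreal (indicator (ball 0 r) x * (grad_norm Dz x)\<^sup>2) \<partial>lborel)"
    by (intro nn_integral_cong) (simp add: indicator_def)
  then show ?thesis
    unfolding ball_energy_def by (simp add: nn_integral_eq_integral[OF ball_energy_integrable])
qed

lemma ball_energy_nonneg: "ball_energy r \<ge> 0"
  by (simp add: ball_energy_def)

lemma ball_energy_mono: "r \<le> r' \<Longrightarrow> ball_energy r \<le> ball_energy r'"
  unfolding ball_energy_def
  by (intro integral_mono ball_energy_integrable) (auto simp: indicator_def)

text \<open>Here \<open>h(s) = (1 + s) powr (- a)\<close> with \<open>a = (n - 2) / 2\<close>, cut off at \<open>s = R\<^sup>2\<close>: the exponent makes
  \<open>(n - 2) h + 2 s h'\<close> equal to \<open>2 a (1 + s) powr (- a - 1)\<close> before the cutoff.\<close>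

lemma ball_energy_growth:
  assumes n: "CARD('n) > 2" and r: "0 < r" "r \<le> R" "1 \<le> R"
  defines "a \<equiv> (real CARD('n) - 2) / 2"
  shows "2 * a * (1 + r\<^sup>2) powr (- a - 1) * ball_energy r
    \<le> 8 * cutoff_bound * R powr (- (2 * a)) * ball_energy (2 * R)"
proof -
  have a: "a > 0" using n by (simp add: a_def)
  have R: "R > 0" using r by simp
  let ?e = "\<lambda>x. (grad_norm Dz x)\<^sup>2"
  define h where "h s = (1 + s) powr (- a) * cutoff (s / R\<^sup>2)" for s
  define h' where "h' s = - a * (1 + s) powr (- a - 1) * cutoff (s / R\<^sup>2)
      + (1 + s) powr (- a) * (cutoff' (s / R\<^sup>2) / R\<^sup>2)" for s
  have dh: "(h has_real_derivative h' s) (at s)" if "s \<ge> 0" for s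
  proof -
    have "((\<lambda>s. (1 + s) powr (- a)) has_real_derivative (- a) * (1 + s) powr (- a - 1) * 1) (at s)"
      using that by (intro DERIV_chain2[OF has_real_derivative_powr]) (auto intro!: derivative_eq_intros)
    from DERIV_mult[OF this cutoff_deriv_scaled[of R s]] show ?thesis
      unfolding h_def[abs_def] h'_def by (simp add: algebra_simps)
  qed
  have pos: "1 + (norm x)\<^sup>2 > 0" for x :: "real ^ 'n"
    by (simp add: add_pos_nonneg)
  have sm: "smooth (\<lambda>x :: real ^ 'n. h ((norm x)\<^sup>2))"
  proof -
    have "smooth (\<lambda>x :: real ^ 'n. (1 + (norm x)\<^sup>2) powr (- a))"
      using smooth_add[OF smooth_const[of 1] smooth_norm_sq[of "0 :: real ^ 'n"]] pos
      by (intro smooth_powr) auto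
    from smooth_mult[OF this smooth_ballcut[of R]] show ?thesis
      by (simp add: h_def ballcut_def)
  qed
  have supp: "h ((norm x)\<^sup>2) = 0" if "norm x \<ge> 2 * R" for x :: "real ^ 'n"
    using ballcut_zero[OF R that] by (simp add: h_def ballcut_def)
  define G where "G x = ?e x * ((real CARD('n) - 2) * h ((norm x)\<^sup>2)
      + 2 * ((norm x)\<^sup>2 * h' ((norm x)\<^sup>2))) - 4 * (h' ((norm x)\<^sup>2) * radial_part Dz x)" for x
  have G: "integrable lborel G" "(\<integral>x. G x \<partial>lborel) = 0"
    using radial_identity[of h h' "2 * R", OF dh sm supp] unfolding G_def[abs_def] by auto
  let ?c = "2 * a * (1 + r\<^sup>2) powr (- a - 1)" and ?d = "8 * cutoff_bound * R powr (- (2 * a))"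
  \<comment> \<open>A pointwise minorant of \<open>G\<close>: the main term on the small ball minus
    the error of the cutoff on the large one. As \<open>G\<close> has integral 0, integrating the
    minorant gives the claim.\<close>
  let ?L = "\<lambda>x. ?c * (indicator (ball 0 r) x * ?e x) - ?d * (indicator (ball 0 (2 * R)) x * ?e x)"
  have le: "?L x \<le> G x" for x :: "real ^ 'n"
  proof -
    define s where "s = (norm x)\<^sup>2"
    define \<sigma> where "\<sigma> = s / R\<^sup>2"
    have s: "s \<ge> 0" by (simp add: s_def)
    have h'_le: "h' s \<le> 0"
      unfolding h'_def using a cutoff_nonneg[of "s / R\<^sup>2"] cutoff'_nonpos[of "s / R\<^sup>2"]
      by (intro add_nonpos_nonpos) (simp_all add: mult_nonneg_nonpos mult_nonpos_nonneg divide_nonpos_nonneg)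
    have E: "(real CARD('n) - 2) * h s + 2 * (s * h' s)
        = 2 * a * (1 + s) powr (- a - 1) * cutoff \<sigma> + 2 * (1 + s) powr (- a) * (\<sigma> * cutoff' \<sigma>)"
    proof -
      \<comment> \<open>Splitting off one factor 1 + s exposes the cancellation 2 * a * ((1 + s) -
        s) = 2 * a.\<close>
      have p: "(1 + s) powr (- a) = (1 + s) * (1 + s) powr (- a - 1)"
        using s by (simp add: powr_mult_base)
      have "real CARD('n) - 2 = 2 * a" by (simp add: a_def)
      then show ?thesis
        unfolding h_def h'_def \<sigma>_def[symmetric] p by (simp add: \<sigma>_def algebra_simps)
    qed
    have B1: "?c * indicator (ball 0 r) x \<le> 2 * a * (1 + s) powr (- a - 1) * cutoff \<sigma>"
    proof (cases "norm x < r")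
      case True
      then have "s \<le> r\<^sup>2" "r\<^sup>2 \<le> R\<^sup>2" using r by (simp_all add: s_def power_mono)
      then have "\<sigma> \<le> 1" using R by (simp add: \<sigma>_def divide_le_eq)
      moreover have "(1 + r\<^sup>2) powr (- a - 1) \<le> (1 + s) powr (- a - 1)"
        using a s \<open>s \<le> r\<^sup>2\<close> by (intro powr_mono2') auto
      ultimately show ?thesis using True a by (simp add: cutoff_one)
    qed (use a cutoff_nonneg[of \<sigma>] in simp)
    \<comment> \<open>The derivative of the cutoff lives where R^2 < s < 4 * R^2, inside the ball of
      radius 2 * R. There (1 + s) powr (- a) is at most R powr (- (2 * a)), which is the weight of
      the growth condition. The 8 is 2 * 4, with the 4 from
      \<open>scaled_cutoff'_bound\<close>.\<close>
    have B2: "- (?d * indicator (ball 0 (2 * R)) x) \<le> 2 * (1 + s) powr (- a) * (\<sigma> * cutoff' \<sigma>)"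
    proof (cases "\<sigma> \<le> 1 \<or> \<sigma> \<ge> 4")
      case True
      then show ?thesis using cutoff_bound_pos by (simp add: cutoff'_zero indicator_def)
    next
      case False
      then have "s < 4 * R\<^sup>2" "R\<^sup>2 \<le> s" using R by (simp_all add: \<sigma>_def divide_less_eq le_divide_eq not_le)
      then have "(norm x)\<^sup>2 < (2 * R)\<^sup>2" by (simp add: s_def power_mult_distrib)
      then have x: "norm x < 2 * R" by (rule power2_less_imp_less) (use R in simp)
      have "(1 + s) powr (- a) \<le> (R\<^sup>2) powr (- a)"
        using a \<open>R\<^sup>2 \<le> s\<close> R by (intro powr_mono2') auto
      also have "(R\<^sup>2) powr (- a) = R powr (- (2 * a))"
        using R powr_powr[of R 2 "- a"] by simp
      finally have ub: "(1 + s) powr (- a) * \<bar>\<sigma> * cutoff' \<sigma>\<bar> \<le> R powr (- (2 * a)) * (4 * cutoff_bound)"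
        by (intro mult_mono scaled_cutoff'_bound) auto
      have neg_abs_le: "- \<bar>t\<bar> \<le> t" for t :: real by linarith
      have "- (R powr (- (2 * a)) * (4 * cutoff_bound)) \<le> - ((1 + s) powr (- a) * \<bar>\<sigma> * cutoff' \<sigma>\<bar>)"
        by (rule le_imp_neg_le[OF ub])
      also have "\<dots> = (1 + s) powr (- a) * (- \<bar>\<sigma> * cutoff' \<sigma>\<bar>)" by (rule mult_minus_right[symmetric])
      also have "\<dots> \<le> (1 + s) powr (- a) * (\<sigma> * cutoff' \<sigma>)"
        by (rule mult_left_mono[OF neg_abs_le powr_ge_zero])
      finally have "2 * (- (R powr (- (2 * a)) * (4 * cutoff_bound))) \<le> 2 * ((1 + s) powr (- a) * (\<sigma> * cutoff' \<sigma>))"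
        by (rule mult_left_mono) simp
      moreover have "2 * (- (R powr (- (2 * a)) * (4 * cutoff_bound))) = - (?d * indicator (ball 0 (2 * R)) x)"
        using x by simp
      ultimately show ?thesis by (simp only: mult.assoc)
    qed
    have "?c * indicator (ball 0 r) x - ?d * indicator (ball 0 (2 * R)) x
        \<le> (real CARD('n) - 2) * h s + 2 * (s * h' s)"
      unfolding E using add_mono[OF B1 B2] by (simp only: add_uminus_conv_diff)
    from mult_left_mono[OF this, of "?e x"]
    have "?L x \<le> ?e x * ((real CARD('n) - 2) * h s + 2 * (s * h' s))"
      by (simp add: right_diff_distrib mult_ac)
    moreover have "h' s * radial_part Dz x \<le> 0"
      using h'_le radial_part_nonneg[of Dz x] by (rule mult_nonpos_nonneg)
    ultimately show ?thesis unfolding G_def s_def[symmetric] by simp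
  qed
  have "(\<integral>x. ?L x \<partial>lborel) \<le> (\<integral>x. G x \<partial>lborel)"
    by (intro integral_mono G(1) Bochner_Integration.integrable_diff integrable_mult_right
        ball_energy_integrable le)
  moreover have "(\<integral>x. ?L x \<partial>lborel) = ?c * ball_energy r - ?d * ball_energy (2 * R)"
    unfolding ball_energy_def
    by (subst Bochner_Integration.integral_diff)
      (intro integrable_mult_right ball_energy_integrable, intro integrable_mult_right ball_energy_integrable, simp)
  ultimately show ?thesis using G(2) by simp
qed

text \<open>For n at most 2 the weight is at most 1 once the radius is at least 1, so the quotient
  dominates the ball energy, which is nondecreasing in the radius and must be 0. For n > 2 the right
  side of \<open>ball_energy_growth\<close> is a constant times the quotient at radius 2 * R and
  tends to 0, while the left side stays fixed.\<close>

lemma small_growth_vanishing: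
  assumes lim: "((\<lambda>r. (\<integral>\<^sup>+x\<in>ball 0 r. ennreal ((grad_norm Dz x)\<^sup>2) \<partial>lborel)
                  / ennreal (r powr (real CARD('n) - 2))) \<longlongrightarrow> 0) at_top"
  shows "AE x in lborel. grad_norm Dz x = 0"
proof (rule AE_zero_of_ball_integrals)
  let ?n = "real CARD('n) - 2"
  let ?F = "\<lambda>r. ball_energy r / r powr ?n"
  have "\<forall>\<^sub>F r in at_top. (\<integral>\<^sup>+x\<in>ball 0 r. ennreal ((grad_norm Dz x)\<^sup>2) \<partial>lborel)
                  / ennreal (r powr ?n) = ennreal (?F r)"
    using eventually_gt_at_top[of "0 :: real"]
    by eventually_elim (simp add: ball_energy_eq divide_ennreal ball_energy_nonneg)
  from tendsto_cong[THEN iffD1, OF this lim]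
  have F: "(?F \<longlongrightarrow> 0) at_top"
    by (subst tendsto_ennreal_iff[symmetric]) (auto simp: ball_energy_nonneg)
  fix r :: real
  define r' where "r' = max r 1"
  have r': "r' \<ge> 1" "r \<le> r'" by (auto simp: r'_def)
  have "ball_energy r' \<le> 0"
  proof (cases "CARD('n) > 2")
    case False
    have "\<forall>\<^sub>F s in at_top. ball_energy r' \<le> ?F s"
      using eventually_ge_at_top[of r']
    proof eventually_elim
      case (elim s)
      have "s powr ?n \<le> s powr 0" using elim r' False by (intro powr_mono) auto
      then have "s powr ?n \<le> 1" "s powr ?n > 0" using elim r' by auto
      then have "ball_energy s * s powr ?n \<le> ball_energy s"
        using ball_energy_nonneg[of s] by (simp add: mult_left_le)
      then have "ball_energy s \<le> ?F s" using \<open>s powr ?n > 0\<close> by (simp add: le_divide_eq)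
      then show ?case using ball_energy_mono[OF elim] by simp
    qed
    then show ?thesis by (rule tendsto_lowerbound[OF F]) simp
  next
    case True
    define a where "a = ?n / 2"
    have a: "a > 0" using True by (simp add: a_def)
    \<comment> \<open>The factor \<open>2 powr (2 * a)\<close> in \<open>?K\<close> converts R powr
      (- (2 * a)) into the weight at radius 2 * R.\<close>
    let ?c = "2 * a * (1 + r'\<^sup>2) powr (- a - 1)" and ?K = "8 * cutoff_bound * 2 powr (2 * a)"
    have "filterlim (\<lambda>R :: real. 2 * R) at_top at_top"
      by (rule filterlim_tendsto_pos_mult_at_top[OF tendsto_const _ filterlim_ident]) simp
    from tendsto_mult_left[OF filterlim_compose[OF F this], of ?K]
    have K: "((\<lambda>R. ?K * ?F (2 * R)) \<longlongrightarrow> 0) at_top" by simp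
    have "\<forall>\<^sub>F R in at_top. ?c * ball_energy r' \<le> ?K * ?F (2 * R)"
      using eventually_ge_at_top[of r']
    proof eventually_elim
      case (elim R)
      have "?c * ball_energy r' \<le> 8 * cutoff_bound * R powr (- (2 * a)) * ball_energy (2 * R)"
        by (rule ball_energy_growth[OF True, of r' R, folded a_def]) (use r' elim in linarith)+
      also have "\<dots> = ?K * ?F (2 * R)"
      proof -
        have "2 * a = ?n" by (simp add: a_def)
        then have "(2 * R) powr ?n = 2 powr (2 * a) * R powr (2 * a)"
          using elim r' by (simp only: powr_mult)
        then show ?thesis unfolding powr_minus_divide by simp
      qed
      finally show ?case .
    qed
    then have "?c * ball_energy r' \<le> 0" by (rule tendsto_lowerbound[OF K]) simp
    moreover have "1 + r'\<^sup>2 > 0" by (simp add: add_pos_nonneg)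
    then have "?c > 0" using a by simp
    ultimately show ?thesis by (meson mult_pos_pos not_le)
  qed
  then have "ball_energy r = 0"
    using ball_energy_nonneg[of r] ball_energy_mono[OF r'(2)] by simp
  then show "(\<integral>\<^sup>+x\<in>ball 0 r. ennreal ((grad_norm Dz x)\<^sup>2) \<partial>lborel) = 0"
    by (simp add: ball_energy_eq)
qed

end

section \<open>Integrable solutions of the Cauchy--Riemann system in the plane\<close>

text \<open>In the plane, \<delta>^2 times this kernel has a mass independent of \<delta> and
  concentrates at 0 as \<delta> tends to 0: an approximate identity up to a constant factor.\<close>

definition cr_kernel :: "real \<Rightarrow> real ^ 'n::finite \<Rightarrow> real" where
  "cr_kernel \<delta> y = 1 / (\<delta>\<^sup>2 + (norm y)\<^sup>2)\<^sup>2"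

lemma cr_kernel_measurable [measurable]: "cr_kernel \<delta> \<in> borel_measurable borel"
  unfolding cr_kernel_def[abs_def] by measurable

lemma cr_kernel_nonneg: "cr_kernel \<delta> y \<ge> 0"
  by (simp add: cr_kernel_def)

lemma cr_kernel_le: "\<delta> > 0 \<Longrightarrow> cr_kernel \<delta> y \<le> 1 / \<delta> ^ 4"
  unfolding cr_kernel_def
  using power_mono[of "\<delta>\<^sup>2" "\<delta>\<^sup>2 + (norm y)\<^sup>2" 2]
  by (intro divide_left_mono) (auto simp: power_mult[symmetric] add_pos_nonneg)

text \<open>Dyadic decomposition: for 2^(k-1) < |b| \<le> 2^k the kernel is at most (2^(k-1))^(-4) =
  16 / 16^k, while the disc of radius 2^k has area proportional to 4^k, so a geometric series of
  ratio 1/4 bounds the integral. Full discs in place of annuli only enlarge the sum.\<close>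

lemma integrable_cr_kernel:
  assumes "CARD('n::finite) = 2"
  shows "integrable lborel (cr_kernel 1 :: real ^ 'n \<Rightarrow> real)"
proof (rule integrableI_bounded)
  let ?V = "unit_ball_vol 2"
  let ?f = "\<lambda>k (b :: real ^ 'n). ennreal (16 / 16 ^ k) * indicator (cball 0 (2 ^ k)) b"
  have "ennreal (cr_kernel 1 b) \<le> (\<Sum>k. ?f k b)" for b :: "real ^ 'n"
  proof -
    define k where "k = (LEAST k. norm b \<le> 2 ^ k)"
    obtain k0 where "norm b < 2 ^ k0" using real_arch_pow[of 2 "norm b"] by auto
    then have "norm b \<le> 2 ^ k0" by (rule less_imp_le)
    then have k1: "norm b \<le> 2 ^ k" unfolding k_def by (rule LeastI)
    have k2: "2 ^ l < norm b" if "l < k" for l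
      using not_less_Least[OF that[unfolded k_def]] by (simp only: not_le)
    note k = k1 k2
    have "cr_kernel 1 b \<le> 16 / 16 ^ k"
    proof (cases k)
      case 0
      then show ?thesis using cr_kernel_le[of 1 b] by simp
    next
      case (Suc l)
      have "((2 ^ l)\<^sup>2)\<^sup>2 \<le> (1\<^sup>2 + (norm b)\<^sup>2)\<^sup>2"
      proof (rule power_mono)
        have "(2 ^ l)\<^sup>2 \<le> (norm b)\<^sup>2"
          by (intro power_mono less_imp_le[OF k(2)]) (simp_all add: Suc)
        then show "(2 ^ l)\<^sup>2 \<le> 1\<^sup>2 + (norm b)\<^sup>2" by (rule order_trans) simp
      qed simp
      moreover have "((2 ^ l)\<^sup>2)\<^sup>2 = (16 :: real) ^ l"
      proof -
        have "((2 ^ l)\<^sup>2)\<^sup>2 = ((2 :: real) ^ 4) ^ l" by (simp only: power_mult[symmetric] mult_ac) simp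
        then show ?thesis by simp
      qed
      ultimately show ?thesis
        unfolding cr_kernel_def Suc by (simp add: frac_le)
    qed
    then have "ennreal (cr_kernel 1 b) \<le> ?f k b" using k(1) by (simp add: ennreal_leI)
    also have "\<dots> \<le> (\<Sum>k. ?f k b)"
    proof -
      have "(\<Sum>k\<in>{k}. ?f k b) \<le> (\<Sum>k. ?f k b)" by (rule sum_le_suminf[OF summableI]) simp_all
      then show ?thesis by (simp only: sum.insert finite.emptyI empty_iff sum.empty not_False_eq_True add_0_right)
    qed
    finally show ?thesis .
  qed
  then have "(\<integral>\<^sup>+b. ennreal (norm (cr_kernel 1 (b :: real ^ 'n))) \<partial>lborel) \<le> (\<integral>\<^sup>+b. (\<Sum>k. ?f k b) \<partial>lborel)"
    by (intro nn_integral_mono) (simp add: cr_kernel_nonneg)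
  also have "\<dots> = (\<Sum>k. \<integral>\<^sup>+b. ?f k b \<partial>lborel)" by (rule nn_integral_suminf) measurable
  also have "\<dots> = (\<Sum>k. ennreal (16 * ?V * (1 / 4) ^ k))"
  proof (rule suminf_cong)
    fix k
    have "(\<integral>\<^sup>+b. ?f k b \<partial>lborel) = ennreal (16 / 16 ^ k) * ennreal (?V * (2 ^ k) ^ 2)"
      using assms by (simp add: nn_integral_cmult_indicator emeasure_cball)
    also have "\<dots> = ennreal (16 / 16 ^ k * (?V * (2 ^ k) ^ 2))"
      by (rule ennreal_mult[symmetric]) simp_all
    also have "16 / 16 ^ k * (?V * (2 ^ k) ^ 2) = 16 * ?V * (1 / 4) ^ k"
    proof -
      have "(16 :: real) ^ k = 4 ^ k * 4 ^ k" "((2 :: real) ^ k) ^ 2 = 4 ^ k"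
        by (simp_all add: power_mult_distrib[symmetric] power_mult[symmetric] mult.commute[of k]
            power_mult[of 2 2 k])
      then show ?thesis by (simp add: field_simps power_one_over)
    qed
    finally show "(\<integral>\<^sup>+b. ?f k b \<partial>lborel) = ennreal (16 * ?V * (1 / 4) ^ k)" .
  qed
  also have "\<dots> < \<infinity>"
  proof -
    have "summable (\<lambda>k. 16 * ?V * (1 / 4 :: real) ^ k)"
      by (intro summable_mult summable_geometric) simp
    then have "(\<Sum>k. ennreal (16 * ?V * (1 / 4) ^ k)) \<noteq> top"
      by (rule ennreal_suminf_neq_top) simp
    then show ?thesis by (simp only: less_top infinity_ennreal_def)
  qed
  finally show "(\<integral>\<^sup>+b. ennreal (norm (cr_kernel 1 (b :: real ^ 'n))) \<partial>lborel) < \<infinity>" .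
qed measurable

text \<open>\<open>eqn\<close> is the weak Cauchy--Riemann equation, with i as the real and j as the
  imaginary axis. Test functions are real, so a complex one is assembled from two real ones.\<close>

locale cauchy_riemann_L1 =
  fixes H :: "real ^ 'n::finite \<Rightarrow> complex" and i j :: 'n
  assumes univ: "UNIV = {i, j}" and neq: "i \<noteq> j"
    and H_int: "integrable lborel H"
    and eqn: "\<And>\<phi>. test_function \<phi> \<Longrightarrow>
      (\<integral>x. H x * (of_real (pderivative i \<phi> x) + \<i> * of_real (pderivative j \<phi> x)) \<partial>lborel) = 0"
begin

lemma H_measurable [measurable]: "H \<in> borel_measurable borel"
  using borel_measurable_integrable[OF H_int] by simp

lemma card_eq: "CARD('n) = 2"
  using neq by (simp add: univ)

abbreviation dbar :: "(real ^ 'n \<Rightarrow> real) \<Rightarrow> real ^ 'n \<Rightarrow> complex" where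
  "dbar \<phi> x \<equiv> of_real (pderivative i \<phi> x) + \<i> * of_real (pderivative j \<phi> x)"

lemma ballcut_pderivative_bound:
  assumes "R \<ge> 1"
  shows "\<bar>pderivative k (ballcut R) x\<bar> \<le> 4 * cutoff_bound"
proof (cases "norm x \<le> 2 * R")
  case True
  have "\<bar>cutoff' ((norm x)\<^sup>2 / R\<^sup>2)\<bar> \<le> cutoff_bound"
    using cutoff'_ge[of "(norm x)\<^sup>2 / R\<^sup>2"] cutoff'_nonpos[of "(norm x)\<^sup>2 / R\<^sup>2"] by simp
  moreover have "\<bar>2 * x $ k / R\<^sup>2\<bar> \<le> 4"
  proof -
    have "\<bar>2 * x $ k\<bar> \<le> 4 * R" using component_le_norm_cart[of x k] True by simp
    also have "\<dots> \<le> 4 * R\<^sup>2" using assms by (simp add: power2_eq_square)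
    finally show ?thesis using assms by (simp add: abs_divide divide_le_eq)
  qed
  ultimately have "\<bar>cutoff' ((norm x)\<^sup>2 / R\<^sup>2)\<bar> * \<bar>2 * x $ k / R\<^sup>2\<bar> \<le> cutoff_bound * 4"
    by (intro mult_mono) (auto simp: cutoff_bound_pos less_imp_le)
  then show ?thesis by (simp add: pderivative_ballcut abs_mult)
next
  case False
  have "(norm x)\<^sup>2 / R\<^sup>2 \<ge> 4"
    using False assms power_mono[of "2 * R" "norm x" 2] by (simp add: le_divide_eq power_mult_distrib)
  then show ?thesis using cutoff_bound_pos by (simp add: pderivative_ballcut cutoff'_zero)
qed

text \<open>Global integrability of \<open>H\<close> enters here. Multiplying by ever wider cutoffs
  keeps the derivatives bounded uniformly in the radius, so a multiple of |H| dominates and the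
  equation extends beyond compact supports.\<close>

lemma eqn_bounded:
  assumes u: "smooth u" and M: "\<And>x. \<bar>u x\<bar> \<le> M" "\<And>k x. \<bar>pderivative k u x\<bar> \<le> M"
  shows "(\<integral>x. H x * dbar u x \<partial>lborel) = 0" "integrable lborel (\<lambda>x. H x * dbar u x)"
proof -
  let ?\<phi> = "\<lambda>n x. ballcut (real (Suc n)) x * u x"
  let ?K = "4 * cutoff_bound * M + M"
  have M0: "M \<ge> 0" using order_trans[OF abs_ge_zero M(1)] .
  have pd: "pderivative k (?\<phi> n) x = pderivative k (ballcut (real (Suc n))) x * u x
      + ballcut (real (Suc n)) x * pderivative k u x" for k n x
    by (rule pderivative_mult[OF smooth_differentiable[OF smooth_ballcut] smooth_differentiable[OF u]])
  have sm: "smooth (?\<phi> n)" for n by (intro smooth_mult smooth_ballcut u)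
  have [measurable]: "pderivative k u \<in> borel_measurable borel" "pderivative k (?\<phi> n) \<in> borel_measurable borel" for k n
    by (intro borel_measurable_continuous_onI smooth_continuous smooth_pderivative u sm)+
  have bd: "\<bar>pderivative k (?\<phi> n) x\<bar> \<le> ?K" for k n x
  proof -
    have "\<bar>pderivative k (ballcut (real (Suc n))) x\<bar> * \<bar>u x\<bar> \<le> 4 * cutoff_bound * M"
      by (intro mult_mono ballcut_pderivative_bound M) (auto simp: cutoff_bound_pos less_imp_le)
    moreover have "\<bar>ballcut (real (Suc n)) x\<bar> * \<bar>pderivative k u x\<bar> \<le> 1 * M"
      by (intro mult_mono M) (auto simp: ballcut_nonneg ballcut_le)
    ultimately show ?thesis
      unfolding pd abs_mult[symmetric] by (intro order_trans[OF abs_triangle_ineq]) linarith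
  qed
  have dn: "cmod (of_real p + \<i> * of_real q) \<le> \<bar>p\<bar> + \<bar>q\<bar>" for p q :: real
    by (rule norm_triangle_le) (simp add: norm_mult)
  have i2: "integrable lborel (\<lambda>x. 2 * ?K * norm (H x))"
    by (intro integrable_mult_right integrable_norm H_int)
  have lim: "AE x in lborel. (\<lambda>n. H x * dbar (?\<phi> n) x) \<longlonglongrightarrow> H x * dbar u x"
  proof (rule AE_I2, rule tendsto_eventually)
    fix x :: "real ^ 'n"
    obtain N :: nat where N: "norm x \<le> real N" using real_arch_simple by blast
    show "\<forall>\<^sub>F n in sequentially. H x * dbar (?\<phi> n) x = H x * dbar u x"
    proof (rule eventually_sequentiallyI[of N])
      fix n assume "N \<le> n"
      then have x: "norm x \<le> real (Suc n)" using N by linarith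
      then have "(norm x)\<^sup>2 / (real (Suc n))\<^sup>2 \<le> 1" by (simp add: power_mono divide_le_eq)
      from cutoff'_zero[OF disjI1[OF this]]
      have "pderivative k (ballcut (real (Suc n))) x = 0" for k
        by (simp only: pderivative_ballcut mult_zero_left)
      moreover have "ballcut (real (Suc n)) x = 1" using x by (intro ballcut_one) auto
      ultimately show "H x * dbar (?\<phi> n) x = H x * dbar u x" by (simp only: pd) simp
    qed
  qed
  have dom: "AE x in lborel. norm (H x * dbar (?\<phi> n) x) \<le> 2 * ?K * norm (H x)" for n
  proof (rule AE_I2)
    fix x
    have "cmod (dbar (?\<phi> n) x) \<le> 2 * ?K"
      by (rule order_trans[OF dn]) (use add_mono[OF bd[of i n x] bd[of j n x]] in \<open>simp only: mult_2\<close>)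
    from mult_left_mono[OF this norm_ge_zero[of "H x"]]
    show "norm (H x * dbar (?\<phi> n) x) \<le> 2 * ?K * norm (H x)" by (simp only: norm_mult mult.commute)
  qed
  have m1: "(\<lambda>x. H x * dbar u x) \<in> borel_measurable lborel" by measurable
  have m2: "(\<lambda>x. H x * dbar (?\<phi> n) x) \<in> borel_measurable lborel" for n by measurable
  have "(\<lambda>n. \<integral>x. H x * dbar (?\<phi> n) x \<partial>lborel) \<longlonglongrightarrow> (\<integral>x. H x * dbar u x \<partial>lborel)"
    by (rule integral_dominated_convergence[OF m1 m2 i2 lim dom])
  moreover have "(\<integral>x. H x * dbar (?\<phi> n) x \<partial>lborel) = 0" for n
    by (intro eqn test_function_ballcut_mult u) simp
  ultimately show "(\<integral>x. H x * dbar u x \<partial>lborel) = 0" by (simp only: LIMSEQ_const_iff)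
  show "integrable lborel (\<lambda>x. H x * dbar u x)"
    by (rule integrable_dominated_convergence[OF m1 m2 i2 lim dom])
qed

text \<open>The test function is \<open>u(z) = cnj (z - a) / (\<delta>\<^sup>2 + |z - a|\<^sup>2)\<close>, whose \<open>\<partial>\<close>-bar derivative is a
  multiple of \<open>cr_kernel\<close>; no solution of an inhomogeneous Cauchy--Riemann equation is needed.\<close>

lemma kernel_orthogonal:
  assumes \<delta>: "\<delta> > 0"
  shows "(\<integral>x. H x * of_real (cr_kernel \<delta> (x - a)) \<partial>lborel) = 0"
proof -
  define D where "D x = \<delta>\<^sup>2 + (norm (x - a))\<^sup>2" for x
  have D_pos: "D x > 0" for x using \<delta> by (simp add: D_def add_pos_nonneg)
  have D_ge: "D x \<ge> \<delta>\<^sup>2" for x by (simp add: D_def)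
  have D_sum: "D x = \<delta>\<^sup>2 + ((x $ i - a $ i)\<^sup>2 + (x $ j - a $ j)\<^sup>2)" for x
  proof -
    have "(norm (x - a))\<^sup>2 = (x $ i - a $ i)\<^sup>2 + (x $ j - a $ j)\<^sup>2"
      unfolding norm_sq_eq_sum univ using neq by (simp add: power2_eq_square)
    then show ?thesis by (simp only: D_def)
  qed
  have smD: "smooth D" unfolding D_def[abs_def] by (intro smooth_add smooth_const smooth_norm_sq)
  \<comment> \<open>\<open>u i\<close> and \<open>- u j\<close> are the real and imaginary parts of
    the test function.\<close>
  define u where "u k x = (x $ k - a $ k) * D x powr (- 1)" for k x
  have sml: "smooth (\<lambda>x. x $ k - a $ k)" for k
    using smooth_add[OF smooth_nth[of k] smooth_const[of "- a $ k"]] by simp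
  have smp: "smooth (\<lambda>x. D x powr (- 1))" by (rule smooth_powr[OF smD D_pos])
  have smu: "smooth (u k)" for k unfolding u_def[abs_def] by (intro smooth_mult sml smp)
  have pdl: "pderivative l (\<lambda>x. x $ k - a $ k) x = (if l = k then 1 else 0)" for k l x
  proof -
    have "pderivative l (\<lambda>x. x $ k + (- a $ k)) x = (if l = k then 1 else 0)"
      by (subst pderivative_add) (simp_all add: smooth_differentiable smooth_nth smooth_const
          pderivative_nth pderivative_const)
    then show ?thesis by simp
  qed
  have pdD: "pderivative l D x = 2 * (x $ l - a $ l)" for l x
    unfolding D_def[abs_def]
    by (subst pderivative_add[OF smooth_differentiable[OF smooth_const] smooth_differentiable[OF smooth_norm_sq]])
      (simp only: pderivative_const pderivative_norm_sq add_0)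
  have pdp: "pderivative l (\<lambda>x. D x powr (- 1)) x = - 2 * (x $ l - a $ l) / (D x)\<^sup>2" for l x
  proof -
    have "((\<lambda>s. s powr (- 1)) has_real_derivative (- 1) * D x powr (- 1 - 1)) (at (D x))"
      by (rule has_real_derivative_powr[OF D_pos])
    from pderivative_compose(1)[OF smooth_differentiable[OF smD] this]
    have "pderivative l (\<lambda>x. D x powr (- 1)) x = (- 1) * D x powr (- 1 - 1) * (2 * (x $ l - a $ l))"
      by (simp only: pdD)
    moreover have "D x powr (- 1 - 1) = 1 / (D x)\<^sup>2"
      using D_pos[of x] powr_realpow[of "D x" 2] by (simp add: powr_minus_divide)
    ultimately show ?thesis by (simp only:) (simp add: divide_inverse algebra_simps)
  qed
  have p1: "D x powr (- 1) = 1 / D x" for x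
    using D_pos[of x] by (simp add: powr_minus_divide)
  have pdu: "pderivative l (u k) x = (if l = k then 1 / D x else 0)
      - 2 * ((x $ k - a $ k) * (x $ l - a $ l)) / (D x)\<^sup>2" for k l x
  proof -
    have "pderivative l (u k) x = pderivative l (\<lambda>x. x $ k - a $ k) x * D x powr (- 1)
        + (x $ k - a $ k) * pderivative l (\<lambda>x. D x powr (- 1)) x"
      unfolding u_def[abs_def]
      by (rule pderivative_mult[OF smooth_differentiable[OF sml] smooth_differentiable[OF smp]])
    then show ?thesis
      by (simp only: pdl pdp, simp only: p1, simp add: divide_inverse algebra_simps)
  qed
  have coord: "\<bar>x $ k - a $ k\<bar>\<^sup>2 \<le> D x" for k x
  proof -
    have "\<bar>(x - a) $ k\<bar>\<^sup>2 \<le> (norm (x - a))\<^sup>2"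
      by (intro power_mono component_le_norm_cart) simp
    then show ?thesis by (simp add: D_def add_increasing)
  qed
  have prod_le: "\<bar>(x $ k - a $ k) * (x $ l - a $ l)\<bar> \<le> D x" for k l x
    using sum_squares_bound[of "\<bar>x $ k - a $ k\<bar>" "\<bar>x $ l - a $ l\<bar>"] coord[of x k] coord[of x l]
    by (simp add: abs_mult)
  have inv_le: "1 / D x \<le> 1 / \<delta>\<^sup>2" for x
    using D_ge[of x] \<delta> by (intro divide_left_mono) (auto simp: D_pos)
  \<comment> \<open>The 1 comes from t \<le> 1 + t^2 in the bound for \<open>u\<close>; 3 = 1 + 2
    counts the two terms of \<open>pdu\<close>. One constant serves for the function and its
    derivatives, as \<open>eqn_bounded\<close> requires.\<close>
  let ?M = "1 + 3 / \<delta>\<^sup>2"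
  have b1: "\<bar>u k x\<bar> \<le> ?M" for k x
  proof -
    have t: "t \<le> 1 + t\<^sup>2" for t :: real
    proof -
      have "0 \<le> (t - 1)\<^sup>2 + t\<^sup>2 + 1" by simp
      then show ?thesis by (simp add: power2_eq_square algebra_simps)
    qed
    have "\<bar>u k x\<bar> = \<bar>x $ k - a $ k\<bar> / D x"
      using D_pos[of x] by (simp add: u_def p1 abs_mult)
    also have "\<dots> \<le> (1 + D x) / D x"
      using t[of "\<bar>x $ k - a $ k\<bar>"] coord[of x k] D_pos[of x] by (intro divide_right_mono) auto
    also have "\<dots> = 1 + 1 / D x" using D_pos[of x] by (simp add: field_simps)
    also have "\<dots> \<le> 1 + 1 / \<delta>\<^sup>2" using inv_le[of x] by simp
    also have "\<dots> \<le> ?M" by (simp add: divide_right_mono)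
    finally show ?thesis .
  qed
  have b2: "\<bar>pderivative l (u k) x\<bar> \<le> ?M" for k l x
  proof -
    have "\<bar>2 * ((x $ k - a $ k) * (x $ l - a $ l)) / (D x)\<^sup>2\<bar>
        = 2 * \<bar>(x $ k - a $ k) * (x $ l - a $ l)\<bar> / (D x)\<^sup>2"
      by (simp add: abs_divide abs_mult)
    also have "\<dots> \<le> 2 * D x / (D x)\<^sup>2"
      using prod_le[of x k l] by (intro divide_right_mono mult_left_mono) auto
    also have "\<dots> = 2 * (1 / D x)" using D_pos[of x] by (simp add: power2_eq_square)
    also have "\<dots> \<le> 2 * (1 / \<delta>\<^sup>2)" using inv_le[of x] by simp
    finally have X: "\<bar>2 * ((x $ k - a $ k) * (x $ l - a $ l)) / (D x)\<^sup>2\<bar> \<le> 2 * (1 / \<delta>\<^sup>2)" .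
    have Y: "\<bar>if l = k then 1 / D x else 0\<bar> \<le> 1 / \<delta>\<^sup>2"
      using inv_le[of x] D_pos[of x] by simp
    have "\<bar>pderivative l (u k) x\<bar> \<le> 1 / \<delta>\<^sup>2 + 2 * (1 / \<delta>\<^sup>2)"
      unfolding pdu by (rule order_trans[OF abs_triangle_ineq4 add_mono[OF Y X]])
    then show ?thesis by simp
  qed
  \<comment> \<open>The mixed derivatives agree and cancel. The trace is 2 / D - 2 * (D -
    \<delta>^2) / D^2 = 2 * \<delta>^2 / D^2, so only the regularisation survives, in keeping with 1
    / z being holomorphic off the origin.\<close>
  have E: "dbar (u i) x - \<i> * dbar (u j) x = of_real (2 * \<delta>\<^sup>2) * of_real (cr_kernel \<delta> (x - a))" for x
  proof -
    have K: "cr_kernel \<delta> (x - a) = 1 / (D x)\<^sup>2" by (simp add: cr_kernel_def D_def)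
    have r: "pderivative i (u i) x + pderivative j (u j) x = 2 * \<delta>\<^sup>2 * cr_kernel \<delta> (x - a)"
    proof -
      have "pderivative i (u i) x + pderivative j (u j) x
        = 2 / D x - 2 * ((x $ i - a $ i)\<^sup>2 + (x $ j - a $ j)\<^sup>2) / (D x)\<^sup>2"
        unfolding pdu by (simp add: power2_eq_square add_divide_distrib)
      also have "(x $ i - a $ i)\<^sup>2 + (x $ j - a $ j)\<^sup>2 = D x - \<delta>\<^sup>2" by (simp add: D_sum)
      also have "2 / D x - 2 * (D x - \<delta>\<^sup>2) / (D x)\<^sup>2 = 2 * \<delta>\<^sup>2 * (1 / (D x)\<^sup>2)"
        using D_pos[of x] by (simp add: field_simps power2_eq_square)
      finally show ?thesis by (simp only: K)
    qed
    have m: "pderivative j (u i) x = pderivative i (u j) x"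
      using neq by (simp add: pdu mult.commute)
    have "dbar (u i) x - \<i> * dbar (u j) x
      = of_real (pderivative i (u i) x + pderivative j (u j) x)
        + \<i> * of_real (pderivative j (u i) x - pderivative i (u j) x)"
      by (simp add: algebra_simps)
    also have "\<dots> = of_real (2 * \<delta>\<^sup>2 * cr_kernel \<delta> (x - a))" by (simp only: r m) simp
    finally show ?thesis by simp
  qed
  have "(\<integral>x. of_real (2 * \<delta>\<^sup>2) * (H x * of_real (cr_kernel \<delta> (x - a))) \<partial>lborel)
      = (\<integral>x. H x * dbar (u i) x - \<i> * (H x * dbar (u j) x) \<partial>lborel)"
  proof (intro Bochner_Integration.integral_cong refl)
    fix x
    have "of_real (2 * \<delta>\<^sup>2) * (H x * of_real (cr_kernel \<delta> (x - a))) = H x * (dbar (u i) x - \<i> * dbar (u j) x)"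
      unfolding E by (rule mult.left_commute)
    also have "\<dots> = H x * dbar (u i) x - \<i> * (H x * dbar (u j) x)"
      unfolding right_diff_distrib by (simp only: mult.left_commute)
    finally show "of_real (2 * \<delta>\<^sup>2) * (H x * of_real (cr_kernel \<delta> (x - a)))
      = H x * dbar (u i) x - \<i> * (H x * dbar (u j) x)" .
  qed
  also have "\<dots> = 0"
    using eqn_bounded[OF smu b1 b2] by (subst Bochner_Integration.integral_diff) simp_all
  finally show ?thesis using \<delta> by simp
qed

text \<open>Substituting x - \<delta> b for a, the Jacobian \<delta>^2 of the plane meets
  \<delta>^(-4) from the kernel. This freezes the kernel, so that a limit in \<delta> concerns only
  the argument of \<psi>.\<close>

lemma kernel_scaling:
  fixes \<psi> :: "real ^ 'n \<Rightarrow> real" and x :: "real ^ 'n"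
  assumes \<delta>: "\<delta> > 0" and [measurable]: "\<psi> \<in> borel_measurable borel"
  shows "(\<integral>a. \<psi> a * cr_kernel \<delta> (x - a) \<partial>lborel)
    = (1 / \<delta>\<^sup>2) * (\<integral>b. \<psi> (x - \<delta> *\<^sub>R b) * cr_kernel 1 b \<partial>lborel)"
proof -
  let ?g = "\<lambda>a. \<psi> a * cr_kernel \<delta> (x - a)"
  let ?T = "\<lambda>b :: real ^ 'n. x + (- \<delta>) *\<^sub>R b"
  have l: "lborel = density (distr lborel borel ?T) (\<lambda>_. ennreal (\<bar>- \<delta>\<bar> ^ DIM(real ^ 'n)))"
    using \<delta> by (intro lborel_affine) simp
  have "(\<integral>a. ?g a \<partial>lborel)
      = (\<integral>a. ?g a \<partial>density (distr lborel borel ?T) (\<lambda>_. ennreal (\<bar>- \<delta>\<bar> ^ DIM(real ^ 'n))))"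
    by (subst l) (rule refl)
  also have "\<dots> = (\<integral>a. \<bar>- \<delta>\<bar> ^ DIM(real ^ 'n) * ?g a \<partial>distr lborel borel ?T)"
    by (rule integral_real_density) auto
  also have "\<dots> = (\<integral>b. \<bar>- \<delta>\<bar> ^ DIM(real ^ 'n) * ?g (?T b) \<partial>lborel)"
    by (rule integral_distr) measurable
  also have "\<dots> = (\<integral>b. (1 / \<delta>\<^sup>2) * (\<psi> (x - \<delta> *\<^sub>R b) * cr_kernel 1 b) \<partial>lborel)"
  proof (rule Bochner_Integration.integral_cong[OF refl])
    fix b :: "real ^ 'n"
    have "\<delta>\<^sup>2 + (norm (\<delta> *\<^sub>R b))\<^sup>2 = \<delta>\<^sup>2 * (1\<^sup>2 + (norm b)\<^sup>2)"
      by (simp add: power_mult_distrib algebra_simps)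
    then have "cr_kernel \<delta> (x - ?T b) = cr_kernel 1 b / (\<delta>\<^sup>2)\<^sup>2"
      by (simp add: cr_kernel_def power_mult_distrib)
    then have "\<bar>- \<delta>\<bar> ^ DIM(real ^ 'n) * cr_kernel \<delta> (x - ?T b) = (1 / \<delta>\<^sup>2) * cr_kernel 1 b"
      using \<delta> by (simp add: card_eq power2_eq_square)
    then show "\<bar>- \<delta>\<bar> ^ DIM(real ^ 'n) * ?g (?T b) = (1 / \<delta>\<^sup>2) * (\<psi> (x - \<delta> *\<^sub>R b) * cr_kernel 1 b)"
      by (metis (no_types, lifting) mult.left_commute scaleR_minus_left add_uminus_conv_diff)
  qed
  also have "\<dots> = (1 / \<delta>\<^sup>2) * (\<integral>b. \<psi> (x - \<delta> *\<^sub>R b) * cr_kernel 1 b \<partial>lborel)" by simp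
  finally show ?thesis .
qed

text \<open>This is \<open>kernel_orthogonal\<close> integrated over the centre a with weight
  \<psi>(a). Fubini applies because the kernel is bounded by 1 / \<delta>^4 and both
  \<open>H\<close> and \<psi> are integrable.\<close>

lemma convolution_orthogonal:
  assumes \<delta>: "\<delta> > 0" and \<psi>: "integrable lborel \<psi>"
  shows "(\<integral>x. H x * of_real (\<integral>b. \<psi> (x - \<delta> *\<^sub>R b) * cr_kernel 1 b \<partial>lborel) \<partial>lborel) = 0"
proof -
  have [measurable]: "\<psi> \<in> borel_measurable borel" using borel_measurable_integrable[OF \<psi>] by simp
  let ?F = "\<lambda>x a. H x * of_real (\<psi> a * cr_kernel \<delta> (x - a))"
  let ?c = "1 / \<delta> ^ 4"
  have int: "integrable (lborel \<Otimes>\<^sub>M lborel) (case_prod ?F)"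
  proof (rule integrableI_bounded)
    show mF: "case_prod ?F \<in> borel_measurable (lborel \<Otimes>\<^sub>M lborel)" by measurable
    have "(\<lambda>z. ennreal (norm (case_prod ?F z))) \<in> borel_measurable (lborel \<Otimes>\<^sub>M lborel)"
      by (rule measurable_compose[OF measurable_compose[OF mF borel_measurable_norm] measurable_ennreal])
    from lborel.nn_integral_fst[OF this]
    have "(\<integral>\<^sup>+z. ennreal (norm (case_prod ?F z)) \<partial>(lborel \<Otimes>\<^sub>M lborel))
        = (\<integral>\<^sup>+x. (\<integral>\<^sup>+a. ennreal (norm (?F x a)) \<partial>lborel) \<partial>lborel)"
      by (simp only: prod.case)
    also have "\<dots> \<le> (\<integral>\<^sup>+x. (\<integral>\<^sup>+a. ennreal (norm (H x)) * ennreal (?c * \<bar>\<psi> a\<bar>) \<partial>lborel) \<partial>lborel)"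
    proof (intro nn_integral_mono)
      fix x a :: "real ^ 'n"
      have "norm (?F x a) = norm (H x) * (cr_kernel \<delta> (x - a) * \<bar>\<psi> a\<bar>)"
        by (simp add: norm_mult abs_mult cr_kernel_nonneg)
      also have "\<dots> \<le> norm (H x) * (?c * \<bar>\<psi> a\<bar>)"
        using cr_kernel_le[OF \<delta>] by (intro mult_left_mono mult_right_mono) auto
      finally show "ennreal (norm (?F x a)) \<le> ennreal (norm (H x)) * ennreal (?c * \<bar>\<psi> a\<bar>)"
        by (simp only: ennreal_mult'[symmetric] norm_ge_zero ennreal_leI)
    qed
    also have "\<dots> = (\<integral>\<^sup>+x. ennreal (norm (H x)) \<partial>lborel) * (\<integral>\<^sup>+a. ennreal (?c * \<bar>\<psi> a\<bar>) \<partial>lborel)"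
      by (subst nn_integral_cmult, measurable, rule nn_integral_multc) measurable
    also have "\<dots> < \<infinity>"
    proof -
      have "integrable lborel (\<lambda>a. ?c * \<bar>\<psi> a\<bar>)" by (intro integrable_mult_right integrable_abs \<psi>)
      from integrableD(2)[OF this] have "(\<integral>\<^sup>+a. ennreal (?c * \<bar>\<psi> a\<bar>) \<partial>lborel) < top"
        by (simp only: less_top infinity_ennreal_def)
      moreover have "(\<integral>\<^sup>+x. ennreal (norm (H x)) \<partial>lborel) < top"
        using H_int unfolding integrable_iff_bounded infinity_ennreal_def by (rule conjunct2)
      ultimately show ?thesis by (simp only: ennreal_mult_less_top infinity_ennreal_def simp_thms)
    qed
    finally show "(\<integral>\<^sup>+z. ennreal (norm (case_prod ?F z)) \<partial>(lborel \<Otimes>\<^sub>M lborel)) < \<infinity>" .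
  qed
  have "(\<integral>x. ?F x a \<partial>lborel) = 0" for a
  proof -
    have "(\<integral>x. ?F x a \<partial>lborel) = (\<integral>x. of_real (\<psi> a) * (H x * of_real (cr_kernel \<delta> (x - a))) \<partial>lborel)"
      by (intro Bochner_Integration.integral_cong refl) (simp only: of_real_mult mult.left_commute)
    also have "\<dots> = of_real (\<psi> a) * (\<integral>x. H x * of_real (cr_kernel \<delta> (x - a)) \<partial>lborel)"
      by (rule integral_mult_right_zero)
    finally show ?thesis by (simp only: kernel_orthogonal[OF \<delta>] mult_zero_right)
  qed
  then have "(\<integral>x. (\<integral>a. ?F x a \<partial>lborel) \<partial>lborel) = 0"
    using lborel_pair.Fubini_integral[OF int] by simp
  moreover have "(\<integral>a. ?F x a \<partial>lborel)
      = of_real (1 / \<delta>\<^sup>2) * (H x * of_real (\<integral>b. \<psi> (x - \<delta> *\<^sub>R b) * cr_kernel 1 b \<partial>lborel))" for x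
  proof -
    have "(\<integral>a. ?F x a \<partial>lborel) = H x * of_real (\<integral>a. \<psi> a * cr_kernel \<delta> (x - a) \<partial>lborel)"
      by (simp only: integral_mult_right_zero integral_complex_of_real)
    then show ?thesis
      unfolding kernel_scaling[OF \<delta> \<open>\<psi> \<in> borel_measurable borel\<close>] by (simp only: of_real_mult mult.left_commute)
  qed
  ultimately have "of_real (1 / \<delta>\<^sup>2) * (\<integral>x. H x * of_real (\<integral>b. \<psi> (x - \<delta> *\<^sub>R b) * cr_kernel 1 b \<partial>lborel) \<partial>lborel) = 0"
    by (simp only: integral_mult_right_zero)
  then show ?thesis using \<delta> by simp
qed

text \<open>Ensures that the factor left over when \<delta> tends to 0 can be divided out.\<close>

lemma cr_kernel_mass_pos: "(\<integral>b. cr_kernel 1 (b :: real ^ 'n) \<partial>lborel) > 0"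
proof -
  let ?m = "\<integral>b. cr_kernel 1 (b :: real ^ 'n) \<partial>lborel"
  have "?m \<noteq> 0"
  proof
    assume "?m = 0"
    then have "AE b :: real ^ 'n in lborel. cr_kernel 1 b = 0"
      using integral_nonneg_eq_0_iff_AE[OF integrable_cr_kernel[OF card_eq]] by (simp add: cr_kernel_nonneg)
    moreover have "cr_kernel 1 b \<noteq> 0" for b :: "real ^ 'n"
      using add_pos_nonneg[of 1 "(norm b)\<^sup>2"] by (simp add: cr_kernel_def)
    ultimately have "AE b :: real ^ 'n in lborel. False" by simp
    then have "emeasure lborel (space lborel :: (real ^ 'n) set) = 0"
      by (simp only: ae_filter_eq_bot_iff[symmetric] trivial_limit_def)
    then show False by simp
  qed
  moreover have "?m \<ge> 0" by (simp add: cr_kernel_nonneg)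
  ultimately show ?thesis by simp
qed

text \<open>As the step tends to 0, the convolution tends pointwise to \<psi> times the mass of the
  kernel and stays below M times that mass. Dominated convergence against |H| carries the
  orthogonality over to \<psi> itself.\<close>

lemma test_integral_zero:
  assumes \<psi>: "test_function \<psi>"
  shows "(\<integral>x. \<psi> x *\<^sub>R H x \<partial>lborel) = 0"
proof -
  obtain R M where M: "R > 0" "M > 0" "\<And>x. norm x \<ge> R \<Longrightarrow> \<psi> x = 0"
    "\<And>i x. norm x \<ge> R \<Longrightarrow> pderivative i \<psi> x = 0"
    "\<And>x. \<bar>\<psi> x\<bar> \<le> M" "\<And>i x. \<bar>pderivative i \<psi> x\<bar> \<le> M"
    using test_function_bounds[OF \<psi>] by blast
  have cont: "continuous_on UNIV \<psi>" by (intro smooth_continuous test_function_smooth \<psi>)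
  have [measurable]: "\<psi> \<in> borel_measurable borel" by (intro borel_measurable_continuous_onI cont)
  have "loc_integrable (\<lambda>x :: real ^ 'n. 1 :: real)"
    unfolding loc_integrable_def set_integrable_def
    using emeasure_lborel_cball_finite[of "0 :: real ^ 'n"] by (simp add: less_top)
  from integrable_test_mult(1)[OF this \<psi>] have \<psi>_int: "integrable lborel \<psi>" by simp
  note K_int = integrable_cr_kernel[OF card_eq]
  let ?m = "\<integral>b. cr_kernel 1 (b :: real ^ 'n) \<partial>lborel"
  let ?c = "\<lambda>n x. \<integral>b. \<psi> (x - energy_step n *\<^sub>R b) * cr_kernel 1 b \<partial>lborel"
  have bd: "norm (\<psi> y * cr_kernel 1 b) \<le> M * cr_kernel 1 b" for y b :: "real ^ 'n"
    using M(5)[of y] by (simp add: abs_mult cr_kernel_nonneg mult_right_mono)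
  have dom: "integrable lborel (\<lambda>b :: real ^ 'n. M * cr_kernel 1 b)"
    by (intro integrable_mult_right K_int)
  have c_lim: "(\<lambda>n. ?c n x) \<longlonglongrightarrow> \<psi> x * ?m" for x
  proof -
    have "(\<lambda>n. ?c n x) \<longlonglongrightarrow> (\<integral>b. \<psi> x * cr_kernel 1 (b :: real ^ 'n) \<partial>lborel)"
    proof (rule integral_dominated_convergence[OF _ _ dom])
      show "AE b in lborel. (\<lambda>n. \<psi> (x - energy_step n *\<^sub>R b) * cr_kernel 1 b) \<longlonglongrightarrow> \<psi> x * cr_kernel 1 b"
      proof (intro AE_I2 tendsto_mult tendsto_const)
        fix b
        have "(\<lambda>n. x - energy_step n *\<^sub>R b) \<longlonglongrightarrow> x - 0 *\<^sub>R b"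
          by (intro tendsto_intros energy_step(3))
        moreover have "isCont \<psi> x" using cont by (simp add: continuous_on_eq_continuous_at)
        ultimately show "(\<lambda>n. \<psi> (x - energy_step n *\<^sub>R b)) \<longlonglongrightarrow> \<psi> x"
          by (intro isCont_tendsto_compose[where g = \<psi>]) simp_all
      qed
      show "AE b in lborel. norm (\<psi> (x - energy_step n *\<^sub>R b) * cr_kernel 1 b) \<le> M * cr_kernel 1 b" for n
        by (intro AE_I2 bd)
    qed measurable
    then show ?thesis by simp
  qed
  have c_bd: "\<bar>?c n x\<bar> \<le> M * ?m" for n x
  proof -
    have "norm (?c n x) \<le> (\<integral>b. M * cr_kernel 1 (b :: real ^ 'n) \<partial>lborel)"
    proof (rule Bochner_Integration.integral_norm_bound_integral)
      show "integrable lborel (\<lambda>b. \<psi> (x - energy_step n *\<^sub>R b) * cr_kernel 1 b)"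
        by (rule Bochner_Integration.integrable_bound[OF dom])
          (measurable, intro AE_I2 order_trans[OF bd], simp)
    qed (intro dom bd)+
    then show ?thesis by simp
  qed
  have [measurable]: "?c n \<in> borel_measurable lborel" for n
    by (rule lborel.borel_measurable_lebesgue_integral) measurable
  have "(\<lambda>n. \<integral>x. H x * of_real (?c n x) \<partial>lborel) \<longlonglongrightarrow> (\<integral>x. H x * of_real (\<psi> x * ?m) \<partial>lborel)"
  proof (rule integral_dominated_convergence)
    show "integrable lborel (\<lambda>x. (M * ?m) * norm (H x))"
      by (intro integrable_mult_right integrable_norm H_int)
    show "AE x in lborel. (\<lambda>n. H x * of_real (?c n x)) \<longlonglongrightarrow> H x * of_real (\<psi> x * ?m)"
      by (intro AE_I2 tendsto_mult tendsto_const tendsto_of_real c_lim)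
    show "AE x in lborel. norm (H x * of_real (?c n x)) \<le> (M * ?m) * norm (H x)" for n
    proof (rule AE_I2)
      fix x
      show "norm (H x * of_real (?c n x)) \<le> (M * ?m) * norm (H x)"
        unfolding norm_mult norm_of_real using mult_left_mono[OF c_bd[of x n] norm_ge_zero[of "H x"]]
        by (simp only: mult.commute)
    qed
  qed measurable
  moreover have "(\<integral>x. H x * of_real (?c n x) \<partial>lborel) = 0" for n
    by (rule convolution_orthogonal[OF energy_step(1) \<psi>_int])
  ultimately have "(\<integral>x. H x * of_real (\<psi> x * ?m) \<partial>lborel) = 0" by (simp only: LIMSEQ_const_iff)
  moreover have "(\<integral>x. H x * of_real (\<psi> x * ?m) \<partial>lborel) = of_real ?m * (\<integral>x. \<psi> x *\<^sub>R H x \<partial>lborel)"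
    unfolding integral_mult_right_zero[symmetric]
    by (intro Bochner_Integration.integral_cong refl) (simp add: scaleR_conv_of_real mult_ac)
  ultimately show ?thesis using cr_kernel_mass_pos by simp
qed

lemma AE_zero: "AE x in lborel. H x = 0"
proof -
  have part: "AE x in lborel. T (H x) = 0" if T: "bounded_linear T" for T :: "complex \<Rightarrow> real"
  proof (rule AE_zero_test)
    interpret bounded_linear T by (rule T)
    have i: "integrable lborel (\<lambda>x. T (H x))" by (rule integrable_bounded_linear[OF T H_int])
    then show "loc_integrable (\<lambda>x. T (H x))"
      unfolding loc_integrable_def set_integrable_def
      by (intro allI integrable_mult_indicator) simp_all
    fix \<psi> :: "real ^ 'n \<Rightarrow> real" assume \<psi>: "test_function \<psi>"
    have "loc_integrable H"
      unfolding loc_integrable_def set_integrable_def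
      by (intro allI integrable_mult_indicator H_int) simp
    from integral_bounded_linear[OF T integrable_test_mult(1)[OF this \<psi>]]
    show "(\<integral>x. \<psi> x * T (H x) \<partial>lborel) = 0"
      by (simp add: test_integral_zero[OF \<psi>] scaleR zero)
  qed
  from part[OF bounded_linear_Re] part[OF bounded_linear_Im] show ?thesis
    by eventually_elim (simp add: complex_eq_iff)
qed

end

section \<open>The planar case with a single component\<close>

lemma (in weak_solution_gradient) planar_vanishing:
  assumes fin: "integrable lborel (\<lambda>x. (grad_norm Dz x)\<^sup>2)"
    and n: "CARD('n) = 2" and m: "CARD('m) = 1"
  shows "AE x in lborel. grad_norm Dz x = 0"
proof -
  obtain i j :: 'n where ij: "UNIV = {i, j}" "i \<noteq> j" using n by (auto simp: card_2_iff)
  obtain k :: 'm where k: "UNIV = {k}" using m by (auto simp: card_1_singleton_iff)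
  let ?e = "\<lambda>x. (grad_norm Dz x)\<^sup>2"
  let ?D1 = "Dz k i" and ?D2 = "Dz k j"
  let ?q = "\<lambda>x. ?D1 x * cnj (?D2 x)"
  let ?A = "\<lambda>x. (cmod (?D1 x))\<^sup>2 - (cmod (?D2 x))\<^sup>2"
  have e_eq: "?e x = (cmod (?D1 x))\<^sup>2 + (cmod (?D2 x))\<^sup>2" for x
    unfolding grad_norm_sq k ij(1) using ij(2) by simp
  have q_le: "cmod (?q x) \<le> ?e x" for x by (rule comp_le_grad_norm_sq(3))
  \<comment> \<open>For n = 2 the diagonal terms collapse to the difference of the squared moduli.
    Since that difference is real, the two equations decouple: their real parts involve it and the
    real part of \<open>?q\<close>, their imaginary parts only the imaginary part of
    \<open>?q\<close>.\<close>
  have Vi: "variation_density i \<phi> x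
      = of_real (- ?A x * pderivative i \<phi> x) - 2 * cnj (?q x) * of_real (pderivative j \<phi> x)"
    and Vj: "variation_density j \<phi> x
      = of_real (?A x * pderivative j \<phi> x) - 2 * ?q x * of_real (pderivative i \<phi> x)" for \<phi> x
    unfolding variation_density_def k comp_grad_sq_def ij(1) of_real_sum of_real_diff of_real_mult
      of_real_minus complex_norm_square
    using ij(2) by (simp_all add: algebra_simps)
  define H1 where "H1 x = of_real (?A x) - 2 * \<i> * of_real (Re (?q x))" for x
  \<comment> \<open>A real function that solves the Cauchy--Riemann system is constant; being
    integrable it is 0, so the same locale disposes of it.\<close>
  define H2 where "H2 x = complex_of_real (Im (?q x))" for x
  have H1_eq: "H1 x * (of_real (pderivative i \<phi> x) + \<i> * of_real (pderivative j \<phi> x))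
      = - of_real (Re (variation_density i \<phi> x)) + \<i> * of_real (Re (variation_density j \<phi> x))" for \<phi> x
    unfolding Vi Vj H1_def by (simp add: complex_eq_iff algebra_simps)
  have H2_eq: "H2 x * (of_real (pderivative i \<phi> x) + \<i> * of_real (pderivative j \<phi> x))
      = (\<i> * of_real (Im (variation_density i \<phi> x)) - of_real (Im (variation_density j \<phi> x))) / 2" for \<phi> x
    unfolding Vi Vj H2_def by (simp add: complex_eq_iff algebra_simps)
  have V: "integrable lborel (\<lambda>x. Re (variation_density \<gamma> \<phi> x))" "(\<integral>x. Re (variation_density \<gamma> \<phi> x) \<partial>lborel) = 0"
    "integrable lborel (\<lambda>x. Im (variation_density \<gamma> \<phi> x))" "(\<integral>x. Im (variation_density \<gamma> \<phi> x) \<partial>lborel) = 0"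
    if "test_function \<phi>" for \<phi> \<gamma>
    using variation_density[OF that, of \<gamma>] by (simp_all add: integral_Re integral_Im)
  have "cauchy_riemann_L1 H1 i j"
  proof
    show "integrable lborel H1"
    proof (rule Bochner_Integration.integrable_bound)
      show "integrable lborel (\<lambda>x. 3 * ?e x)" using fin by simp
      show "H1 \<in> borel_measurable lborel" unfolding H1_def[abs_def] by measurable
      show "AE x in lborel. norm (H1 x) \<le> norm (3 * ?e x)"
      proof (rule AE_I2)
        fix x
        have "\<bar>?A x\<bar> \<le> ?e x"
          unfolding e_eq
          by (intro abs_leI)
            (use zero_le_power2[of "cmod (?D1 x)"] zero_le_power2[of "cmod (?D2 x)"] in linarith)+
        moreover have "\<bar>Re (?q x)\<bar> \<le> ?e x" by (rule order_trans[OF abs_Re_le_cmod q_le])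
        moreover have "norm (H1 x) \<le> \<bar>?A x\<bar> + 2 * \<bar>Re (?q x)\<bar>"
          unfolding H1_def
          by (rule order_trans[OF norm_triangle_ineq4])
            (simp only: norm_mult norm_of_real norm_numeral norm_ii mult_1_right order_refl)
        ultimately have "norm (H1 x) \<le> 3 * ?e x" by linarith
        then show "norm (H1 x) \<le> norm (3 * ?e x)" by simp
      qed
    qed
    fix \<phi> :: "real ^ 'n \<Rightarrow> real" assume "test_function \<phi>"
    from V[OF this, of i] V[OF this, of j]
    show "(\<integral>x. H1 x * (of_real (pderivative i \<phi> x) + \<i> * of_real (pderivative j \<phi> x)) \<partial>lborel) = 0"
      unfolding H1_eq by (subst Bochner_Integration.integral_add) simp_all
  qed (use ij in auto)
  from cauchy_riemann_L1.AE_zero[OF this] have Z1: "AE x in lborel. H1 x = 0" .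
  have "cauchy_riemann_L1 H2 i j"
  proof
    show "integrable lborel H2"
    proof (rule Bochner_Integration.integrable_bound[OF fin])
      show "H2 \<in> borel_measurable lborel" unfolding H2_def[abs_def] by measurable
      show "AE x in lborel. norm (H2 x) \<le> norm (?e x)"
        by (rule AE_I2) (use order_trans[OF abs_Im_le_cmod q_le] in \<open>simp only: H2_def norm_of_real real_norm_def abs_power2\<close>)
    qed
    fix \<phi> :: "real ^ 'n \<Rightarrow> real" assume "test_function \<phi>"
    from V[OF this, of i] V[OF this, of j]
    show "(\<integral>x. H2 x * (of_real (pderivative i \<phi> x) + \<i> * of_real (pderivative j \<phi> x)) \<partial>lborel) = 0"
      unfolding H2_eq by (subst integral_divide_zero, subst Bochner_Integration.integral_diff) simp_all
  qed (use ij in auto)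
  from cauchy_riemann_L1.AE_zero[OF this] have Z2: "AE x in lborel. H2 x = 0" .
  from Z1 Z2 show ?thesis
  proof eventually_elim
    case (elim x)
    have A: "?A x = 0" and q: "Re (?q x) = 0"
      using arg_cong[OF elim(1), of Re] arg_cong[OF elim(1), of Im] by (simp_all add: H1_def)
    have "?q x = 0" using q elim(2) by (simp add: H2_def complex_eq_iff)
    \<comment> \<open>The single component enters here: one product vanishes, so one factor does,
      and equality of the moduli kills the other.\<close>
    then have "?D1 x = 0 \<or> ?D2 x = 0" by simp
    with A have "?D1 x = 0" "?D2 x = 0" by auto
    then show "grad_norm Dz x = 0" using e_eq[of x] by simp
  qed
qed

section \<open>Liouville theorems\<close>

text \<open>In \<open>ennreal\<close>, infinity divided by a finite number is infinity, even when
  that number is 0. A quotient below 1 therefore means finite energy on that ball, and such radii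
  are arbitrarily large.\<close>

lemma loc_integrable_energy:
  fixes Dz :: "'m::finite \<Rightarrow> 'n::finite \<Rightarrow> real ^ 'n \<Rightarrow> complex"
  assumes [measurable]: "(\<lambda>x. (grad_norm Dz x)\<^sup>2) \<in> borel_measurable borel"
    and lim: "((\<lambda>r. (\<integral>\<^sup>+x\<in>ball 0 r. ennreal ((grad_norm Dz x)\<^sup>2) \<partial>lborel) / ennreal (p r)) \<longlongrightarrow> 0) at_top"
  shows "loc_integrable (\<lambda>x. (grad_norm Dz x)\<^sup>2)"
  unfolding loc_integrable_def
proof
  fix R :: real
  let ?Q = "\<lambda>r. \<integral>\<^sup>+x\<in>ball 0 r. ennreal ((grad_norm Dz x)\<^sup>2) \<partial>lborel"
  have "\<forall>\<^sub>F r in at_top. ?Q r / ennreal (p r) < 1 \<and> R < r"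
    using order_tendstoD(2)[OF lim, of 1] eventually_gt_at_top[of R] by (intro eventually_conj) simp_all
  then obtain r where r: "?Q r / ennreal (p r) < 1" "R < r"
    using eventually_happens'[OF trivial_limit_at_top_linorder] by blast
  have "?Q r \<noteq> top"
  proof
    assume "?Q r = top"
    with r(1) show False by (simp add: ennreal_top_divide)
  qed
  show "set_integrable lborel (cball 0 R) (\<lambda>x. (grad_norm Dz x)\<^sup>2)"
    unfolding set_integrable_def
  proof (rule integrableI_bounded)
    have "(\<integral>\<^sup>+x. ennreal (norm (indicator (cball 0 R) x *\<^sub>R (grad_norm Dz x)\<^sup>2)) \<partial>lborel) \<le> ?Q r"
      using r(2) by (intro nn_integral_mono) (auto simp: indicator_def)
    also have "\<dots> < \<infinity>" using \<open>?Q r \<noteq> top\<close> by (simp only: less_top infinity_ennreal_def)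
    finally show "(\<integral>\<^sup>+x. ennreal (norm (indicator (cball 0 R) x *\<^sub>R (grad_norm Dz x)\<^sup>2)) \<partial>lborel) < \<infinity>" .
  qed measurable
qed

theorem proposition4p3:
  fixes f :: "real ^ 'n::finite \<Rightarrow> 'm::finite heis"
    and Dz :: "'m \<Rightarrow> 'n \<Rightarrow> real ^ 'n \<Rightarrow> complex"
  assumes "weak_gradient f Dz"
    and "weak_solution Dz"
  shows "(W12_loc f \<and>
          ((\<lambda>r. (\<integral>\<^sup>+x\<in>ball 0 r. ennreal ((grad_norm Dz x)\<^sup>2) \<partial>lborel)
                  / ennreal (r powr (real CARD('n) - 2))) \<longlongrightarrow> 0) at_top
          \<longrightarrow> (AE x in lborel. grad_norm Dz x = 0))
       \<and> (W12 UNIV f \<and> (CARD('n) = 2 \<longrightarrow> CARD('m) = 1)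
          \<longrightarrow> (AE x in lborel. grad_norm Dz x = 0))"
proof (intro conjI impI; elim conjE)
  have meas: "Dz k \<beta> \<in> borel_measurable borel" for k \<beta>
    using assms(1) unfolding weak_gradient_def weak_pderivative_def
    by (intro loc_integrable_measurable locally_integrable_imp) blast
  note [measurable] = meas
  have e_meas: "(\<lambda>x. (grad_norm Dz x)\<^sup>2) \<in> borel_measurable borel"
    unfolding grad_norm_sq by measurable
  show "AE x in lborel. grad_norm Dz x = 0"
    if lim: "((\<lambda>r. (\<integral>\<^sup>+x\<in>ball 0 r. ennreal ((grad_norm Dz x)\<^sup>2) \<partial>lborel)
                  / ennreal (r powr (real CARD('n) - 2))) \<longlongrightarrow> 0) at_top"
  proof -
    interpret weak_solution_gradient Dz
      by (unfold_locales) (rule meas loc_integrable_energy[OF e_meas lim] assms(2))+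
    show ?thesis by (rule small_growth_vanishing[OF lim])
  qed
  show "AE x in lborel. grad_norm Dz x = 0"
    if W: "W12 UNIV f" and card: "CARD('n) = 2 \<longrightarrow> CARD('m) = 1"
  proof -
    have fin: "integrable lborel (\<lambda>x. (grad_norm Dz x)\<^sup>2)"
      using finite_energy_gradient[OF assms(1) W] e_meas by (intro integrableI_bounded) simp_all
    have "loc_integrable (\<lambda>x. (grad_norm Dz x)\<^sup>2)"
      unfolding loc_integrable_def set_integrable_def
      by (intro allI integrable_mult_indicator fin) simp
    then interpret weak_solution_gradient Dz
      by unfold_locales (use meas assms(2) in auto)
    show ?thesis
      using finite_energy_vanishing[OF fin] planar_vanishing[OF fin] card by blast
  qed
qed

end
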